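(* For $i=1,2$ let $\phi_i\in W_2^{s_i}(\mathbb{R}^d)$ provide approximation order $k_i>s_i$ in $W_2^{s_i}(\mathbb{R}^d)$. If the convolution product $\psi=\phi_1*\phi_2$ lies in $W_2^{s_1+s_2}(\mathbb{R}^d)$, then $\psi$ provides approximation order $k_1+k_2$ there. (Approximation orders here may be negative, in the extended sense defined in the context.)
   Context: $\widehat f(\omega)=\int f(x)e^{-i\omega\cdot x}dx$; $|\cdot|$ is the Euclidean norm. For $s\in\mathbb{R}$, $W_2^s=W_2^s(\mathbb{R}^d)$ is the space of tempered distributions $f$ with $\widehat f$ locally in $L_2(\mathbb{R}^d)$ and $\|f\|_{W_2^s}^2=\int(1+|\omega|)^{2s}|\widehat f(\omega)|^2d\omega<\infty$. For $\phi\in W_2^s$, $S_\phi(W_2^s)$ is the smallest closed subspace of $W_2^s$ containing $\phi$ and invariant under integer translations. The convolution $\psi=\phi_1*\phi_2$ has $\widehat\psi=\widehat\phi_1\widehat\phi_2$. Approximation order of $\phi$ in $W_2^s$, for $k>s$: (i) if $k>0$: $\phi$ provides approximation order $k$ in $W_2^s$ if, with $S^h=\{g(\cdot/h):g\in S_\phi(W_2^s)\}$, there is a constant $C$ such that $\inf_{g\in S^h}\|f-g\|_{W_2^s}\le Ch^{k-s}\|f\|_{W_2^k}$ for every $f\in W_2^k(\mathbb{R}^d)$ and $h>0$; (ii) if $s<k\le0$: $\phi$ provides approximation order $k$ in $W_2^s$ if, for some neighborhood $\Omega$ of the origin, $$\frac{[\widehat\phi,\widehat\phi]^0_s}{[\widehat\phi,\widehat\phi]_s}\frac1{|\cdot|^{2k-2s}}\in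 L_\infty(\Omega),$$ where $[\widehat\phi,\widehat\phi]_s=\sum_{\alpha\in2\pi\mathbb{Z}^d}|\widehat\phi(\cdot+\alpha)|^2|\cdot+\alpha|^{2s}$ and $[\widehat\phi,\widehat\phi]^0_s=\sum_{\alpha\in2\pi\mathbb{Z}^d\setminus\{0\}}|\widehat\phi(\cdot+\alpha)|^2|\cdot+\alpha|^{2s}$. *)

theory Defs
  imports "HOL-Analysis.Analysis"
begin

section \<open>Schwartz functions and tempered distributions on \<open>\<real>\<^sup>d\<close>\<close>

definition partial_deriv :: "'d::finite \<Rightarrow> (real^'d \<Rightarrow> complex) \<Rightarrow> real^'d \<Rightarrow> complex" where
  "partial_deriv j f x = frechet_derivative f (at x) (axis j 1)"

text \<open>Iterated partial derivatives are indexed by lists of coordinate directions instead of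
  multi-indices; for smooth functions the order of the list is irrelevant.\<close>

primrec partial_derivs :: "'d::finite list \<Rightarrow> (real^'d \<Rightarrow> complex) \<Rightarrow> real^'d \<Rightarrow> complex" where
  "partial_derivs [] f = f"
| "partial_derivs (j # js) f = partial_deriv j (partial_derivs js f)"

definition smooth :: "(real^'d::finite \<Rightarrow> complex) \<Rightarrow> bool" where
  "smooth f \<longleftrightarrow> (\<forall>js x. partial_derivs js f differentiable (at x))"

definition schwartz_space :: "(real^'d::finite \<Rightarrow> complex) set" where
  "schwartz_space = {f. smooth f \<and>
     (\<forall>N js. bdd_above (range (\<lambda>x. (1 + norm x) ^ N * norm (partial_derivs js f x))))}"

definition schwartz_norm :: "nat \<Rightarrow> (real^'d::finite \<Rightarrow> complex) \<Rightarrow> real" where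
  "schwartz_norm N f =
     (\<Sum>js | length js \<le> N. SUP x. (1 + norm x) ^ N * norm (partial_derivs js f x))"

type_synonym 'd functional = "(real^'d \<Rightarrow> complex) \<Rightarrow> complex"

text \<open>Continuous complex-linear functionals on the Schwartz space. The value outside the Schwartz
  space is fixed to be 0, so that HOL equality is equality of distributions.\<close>

definition tempered_distributions :: "'d::finite functional set" where
  "tempered_distributions = {u.
     (\<forall>f. f \<notin> schwartz_space \<longrightarrow> u f = 0) \<and>
     (\<forall>f\<in>schwartz_space. \<forall>g\<in>schwartz_space. \<forall>a b.
        u (\<lambda>x. a * f x + b * g x) = a * u f + b * u g) \<and>
     (\<exists>C N. \<forall>f\<in>schwartz_space. norm (u f) \<le> C * schwartz_norm N f)}"

text \<open>Translates \<open>u(\<cdot> - a)\<close> and dilates \<open>u(\<cdot> / h)\<close>, defined by duality.\<close>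

definition dist_translate :: "real^'d::finite \<Rightarrow> 'd functional \<Rightarrow> 'd functional" where
  "dist_translate a u = (\<lambda>f. u (\<lambda>x. f (x + a)))"

definition dist_dilate :: "real \<Rightarrow> 'd::finite functional \<Rightarrow> 'd functional" where
  "dist_dilate h u = (\<lambda>f. of_real (h ^ CARD('d)) * u (\<lambda>x. f (h *\<^sub>R x)))"

definition fourier :: "(real^'d::finite \<Rightarrow> complex) \<Rightarrow> real^'d \<Rightarrow> complex" where
  "fourier f \<omega> = (\<integral>x. f x * exp (- \<i> * of_real (\<omega> \<bullet> x)) \<partial>lborel)"

definition dist_fourier :: "'d::finite functional \<Rightarrow> 'd functional" where
  "dist_fourier u = (\<lambda>f. if f \<in> schwartz_space then u (fourier f) else 0)"

definition represented_by :: "'d::finite functional \<Rightarrow> (real^'d \<Rightarrow> complex) \<Rightarrow> bool" where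
  "represented_by u F \<longleftrightarrow> F \<in> borel_measurable lborel \<and>
     (\<forall>f\<in>schwartz_space. integrable lborel (\<lambda>x. F x * f x) \<and> u f = (\<integral>x. F x * f x \<partial>lborel))"

text \<open>The function representing the Fourier transform of \<open>u\<close>, if there is one. It is determined
  only almost everywhere, and is used below only in ways insensitive to null sets.\<close>

definition ft_fun :: "'d::finite functional \<Rightarrow> real^'d \<Rightarrow> complex" where
  "ft_fun u = (SOME F. represented_by (dist_fourier u) F)"


section \<open>The spaces \<open>W\<^sub>2\<^sup>s\<close> and their shift-invariant subspaces\<close>

definition sobolev_space :: "real \<Rightarrow> 'd::finite functional set" where
  "sobolev_space s = {u \<in> tempered_distributions.
     (\<exists>F. represented_by (dist_fourier u) F) \<and>
     (\<forall>K. compact K \<longrightarrow> set_integrable lborel K (\<lambda>\<omega>. (norm (ft_fun u \<omega>))\<^sup>2)) \<and>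
     integrable lborel (\<lambda>\<omega>. (1 + norm \<omega>) powr (2 * s) * (norm (ft_fun u \<omega>))\<^sup>2)}"

definition sobolev_norm :: "real \<Rightarrow> 'd::finite functional \<Rightarrow> real" where
  "sobolev_norm s u =
     sqrt (\<integral>\<omega>. (1 + norm \<omega>) powr (2 * s) * (norm (ft_fun u \<omega>))\<^sup>2 \<partial>lborel)"

definition dist_diff :: "'d::finite functional \<Rightarrow> 'd functional \<Rightarrow> 'd functional" where
  "dist_diff u v = (\<lambda>f. u f - v f)"

definition closed_subspace :: "real \<Rightarrow> 'd::finite functional set \<Rightarrow> bool" where
  "closed_subspace s V \<longleftrightarrow> V \<subseteq> sobolev_space s \<and> (\<lambda>f. 0) \<in> V \<and>
     (\<forall>u\<in>V. \<forall>v\<in>V. \<forall>a b. (\<lambda>f. a * u f + b * v f) \<in> V) \<and>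
     (\<forall>u\<in>sobolev_space s. (\<forall>e>0. \<exists>v\<in>V. sobolev_norm s (dist_diff u v) < e) \<longrightarrow> u \<in> V)"

definition int_lattice :: "(real^'d::finite) set" where
  "int_lattice = {a. \<forall>i. a $ i \<in> \<int>}"

definition shift_invariant :: "'d::finite functional set \<Rightarrow> bool" where
  "shift_invariant V \<longleftrightarrow> (\<forall>u\<in>V. \<forall>a\<in>int_lattice. dist_translate a u \<in> V)"

definition shift_space :: "real \<Rightarrow> 'd::finite functional \<Rightarrow> 'd functional set" where
  "shift_space s \<phi> = \<Inter> {V. closed_subspace s V \<and> shift_invariant V \<and> \<phi> \<in> V}"


section \<open>Approximation orders\<close>

definition dual_lattice :: "(real^'d::finite) set" where
  "dual_lattice = (\<lambda>a. (2 * pi) *\<^sub>R a) ` int_lattice"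

text \<open>For \<open>A = dual_lattice\<close> this is the bracket \<open>[F, F]\<^sub>s\<close>, and for \<open>A = dual_lattice - {0}\<close>
  it is \<open>[F, F]\<^sup>0\<^sub>s\<close>.\<close>

definition bracket :: "(real^'d::finite) set \<Rightarrow> real \<Rightarrow> (real^'d \<Rightarrow> complex) \<Rightarrow> real^'d \<Rightarrow> ennreal" where
  "bracket A s F \<omega> =
     (\<Sum>\<^sub>\<infinity>\<alpha>\<in>A. ennreal ((norm (F (\<omega> + \<alpha>)))\<^sup>2 * norm (\<omega> + \<alpha>) powr (2 * s)))"

definition approx_order_pos :: "real \<Rightarrow> 'd::finite functional \<Rightarrow> real \<Rightarrow> bool" where
  "approx_order_pos s \<phi> k \<longleftrightarrow> (\<exists>C. \<forall>f\<in>sobolev_space k. \<forall>h>0.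
     (INF g\<in>dist_dilate h ` shift_space s \<phi>. sobolev_norm s (dist_diff f g))
       \<le> C * h powr (k - s) * sobolev_norm k f)"

text \<open>Essential boundedness of the quotient on \<open>\<Omega>\<close> includes that the quotient is defined almost
  everywhere on \<open>\<Omega>\<close>; this has to be said explicitly, as \<open>0 / 0 = 0\<close> in HOL. Without it \<open>\<phi> = 0\<close>
  would provide every nonpositive order. Since \<open>k > s\<close>, it amounts to reading the quotient as 1
  where the full bracket vanishes (there \<open>|\<omega>|\<close> to the power \<open>2s - 2k\<close> is unbounded near 0).
  Finiteness of the bracket holds almost everywhere for \<open>\<phi>\<close> in \<open>W\<^sub>2\<^sup>s\<close>.\<close>

definition approx_order_nonpos :: "real \<Rightarrow> 'd::finite functional \<Rightarrow> real \<Rightarrow> bool" where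
  "approx_order_nonpos s \<phi> k \<longleftrightarrow> (\<exists>\<Omega>. open \<Omega> \<and> 0 \<in> \<Omega> \<and> (\<exists>C::real. AE \<omega> in lborel. \<omega> \<in> \<Omega> \<longrightarrow>
     0 < bracket dual_lattice s (ft_fun \<phi>) \<omega> \<and> bracket dual_lattice s (ft_fun \<phi>) \<omega> < \<infinity> \<and>
     bracket (dual_lattice - {0}) s (ft_fun \<phi>) \<omega> / bracket dual_lattice s (ft_fun \<phi>) \<omega>
       * ennreal (1 / norm \<omega> powr (2 * k - 2 * s)) \<le> ennreal C))"

text \<open>Meaningful for \<open>\<phi>\<close> in \<open>W\<^sub>2\<^sup>s\<close> and \<open>k > s\<close>.\<close>

definition provides_approx_order :: "real \<Rightarrow> 'd::finite functional \<Rightarrow> real \<Rightarrow> bool" where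
  "provides_approx_order s \<phi> k \<longleftrightarrow>
     (if k > 0 then approx_order_pos s \<phi> k else approx_order_nonpos s \<phi> k)"

text \<open>The convolution of \<open>\<phi>\<^sub>1\<close> and \<open>\<phi>\<^sub>2\<close> is the tempered distribution whose Fourier transform is the
  product of those of \<open>\<phi>\<^sub>1\<close> and \<open>\<phi>\<^sub>2\<close>.\<close>

definition is_convolution :: "'d::finite functional \<Rightarrow> 'd functional \<Rightarrow> 'd functional \<Rightarrow> bool" where
  "is_convolution \<psi> \<phi>\<^sub>1 \<phi>\<^sub>2 \<longleftrightarrow> \<psi> \<in> tempered_distributions \<and>
     represented_by (dist_fourier \<psi>) (\<lambda>\<omega>. ft_fun \<phi>\<^sub>1 \<omega> * ft_fun \<phi>\<^sub>2 \<omega>)"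

end

theory Submission
  imports Defs
begin

text \<open>The approximation order of \<open>\<phi>\<close> is governed by how strongly frequencies near the origin are
  confused with their translates by the dual lattice. With \<open>F\<close> the Fourier transform of \<open>\<phi>\<close> and
  \<open>B\<close> the bracket \<open>[F, F]\<^sup>0\<^sub>s\<close>, the condition that matters is the aliasing bound
  \<open>B(\<omega>) \<le> C |\<omega>| powr (2k) |F(\<omega>)|\<^sup>2\<close> together with \<open>F(\<omega>) \<noteq> 0\<close>, for almost all \<open>\<omega>\<close> near 0
  (\<open>alias_bound\<close>).

  The aliasing bound is multiplicative. The terms of \<open>B\<close> for a product \<open>F G\<close> are the products of the
  terms for \<open>F\<close> and for \<open>G\<close>, and a sum of products of nonnegative numbers is at most the product of
  the sums; so bounds with orders \<open>k\<^sub>1\<close> and \<open>k\<^sub>2\<close> give one with order \<open>k\<^sub>1 + k\<^sub>2\<close>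
  (\<open>alias_bound_mult\<close>). The theorem follows once providing approximation order \<open>k > s\<close> is known to be
  equivalent to the aliasing bound, in both the positive and the nonpositive range.

  For \<open>k \<le> 0\<close> the equivalence only rewrites the defining quotient: where the quotient is small, \<open>B\<close> is
  dominated by the term at the origin (\<open>alias_bound_imp_order\<close>, \<open>order_imp_alias_bound\<close>).

  For \<open>k > 0\<close> it is a theorem about approximation. After rescaling frequencies by \<open>h\<close>, an element of
  the dilated space has a transform that is proportional to \<open>F\<close> along each orbit \<open>\<omega> + dual_lattice\<close>.
  If it is to approximate the indicator of a small set \<open>A\<close> near the origin, then at \<open>\<omega> \<in> A\<close> it either
  misses the value 1 or is so large that its values at the aliases of \<open>\<omega>\<close> cost about
  \<open>B(\<omega>) / |F(\<omega>)|\<^sup>2\<close>. Letting \<open>A\<close> vary inside the shells \<open>|\<omega>| \<ge> h\<close> with \<open>h = (1/2)^n\<close> turns the error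
  estimate into the aliasing bound almost everywhere (\<open>order_pos_imp_alias_bound\<close>). Conversely, the
  quotient of the target by \<open>F\<close> near the origin, continued periodically, is a multiplier that
  reproduces the target at low frequencies; its error consists of the high frequencies of the target,
  small since \<open>s < k\<close>, and of the aliases, controlled by the bound (\<open>alias_bound_imp_order_pos\<close>).

  Two facts from harmonic analysis carry this argument. Sobolev distributions correspond exactly to
  weighted square integrable functions on the frequency side (\<open>sobolev_ft\<close>, \<open>dist_of_sobolev\<close>), which
  rests on Fourier inversion for Schwartz functions. And a shift-invariant closed subspace is closed
  under multiplication of the transform by all bounded periodic functions
  (\<open>periodic_multiplier_mem\<close>), because bounded periodic functions are obtained from trigonometric
  polynomials by bounded pointwise limits (\<open>bounded_reduce\<close>). This density also shows that an
  integrable function with vanishing Fourier transform vanishes (\<open>L1_fourier_zero\<close>), from which both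
  the uniqueness of transforms and the nonvanishing of the inversion constant are deduced; the value
  of that constant never enters.\<close>

section \<open>Schwartz functions\<close>

definition rapid_decay :: "(real^'d::finite \<Rightarrow> complex) \<Rightarrow> bool" where
  "rapid_decay f \<longleftrightarrow> (\<forall>N. \<exists>C. \<forall>x. (1 + norm x) ^ N * norm (f x) \<le> C)"

lemma rapid_decay_iff: "rapid_decay f \<longleftrightarrow> (\<forall>N. bdd_above (range (\<lambda>x. (1 + norm x) ^ N * norm (f x))))"
  unfolding rapid_decay_def bdd_above_def by auto

lemma schwartz_iff:
  "f \<in> schwartz_space \<longleftrightarrow> (\<forall>js. (\<forall>x. partial_derivs js f differentiable (at x)) \<and> rapid_decay (partial_derivs js f))"
  unfolding schwartz_space_def smooth_def rapid_decay_iff by auto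

text \<open>Membership in the Schwartz space quantifies over all iterated derivatives. It suffices to exhibit a
  set closed under first derivatives whose members are differentiable and rapidly decreasing. All
  closure properties below, and the invariance under the Fourier transform, are proved by choosing
  such a set, so that no Leibniz formula for higher derivatives is needed.\<close>

lemma schwartz_coinduct:
  assumes "f \<in> S"
    and "\<And>g x. g \<in> S \<Longrightarrow> g differentiable (at x)"
    and "\<And>g. g \<in> S \<Longrightarrow> rapid_decay g"
    and "\<And>g j. g \<in> S \<Longrightarrow> partial_deriv j g \<in> S"
  shows "f \<in> schwartz_space"
proof -
  have "partial_derivs js f \<in> S" for js
    by (induction js) (auto simp: assms)
  then show ?thesis unfolding schwartz_iff using assms by blast
qed

lemma partial_derivs_append: "partial_derivs (js @ ks) f = partial_derivs js (partial_derivs ks f)"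
  by (induction js) auto

lemma schwartz_partial_derivs: "f \<in> schwartz_space \<Longrightarrow> partial_derivs js f \<in> schwartz_space"
  unfolding schwartz_iff by (metis partial_derivs_append)

lemma schwartz_partial_deriv: "f \<in> schwartz_space \<Longrightarrow> partial_deriv j f \<in> schwartz_space"
  using schwartz_partial_derivs[of f "[j]"] by simp

lemma schwartz_differentiable: "f \<in> schwartz_space \<Longrightarrow> f differentiable (at x)"
  unfolding schwartz_iff by (metis partial_derivs.simps(1))

lemma schwartz_rapid: "f \<in> schwartz_space \<Longrightarrow> rapid_decay f"
  unfolding schwartz_iff by (metis partial_derivs.simps(1))

lemma schwartz_has_derivative:
  "f \<in> schwartz_space \<Longrightarrow> (f has_derivative frechet_derivative f (at x)) (at x)"
  using schwartz_differentiable frechet_derivative_works by blast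

lemma schwartz_continuous: "f \<in> schwartz_space \<Longrightarrow> continuous_on A f"
  using schwartz_differentiable differentiable_imp_continuous_within
  by (meson continuous_at_imp_continuous_on)

lemma schwartz_measurable: "f \<in> schwartz_space \<Longrightarrow> f \<in> borel_measurable borel"
  using borel_measurable_continuous_onI schwartz_continuous by blast

lemma partial_deriv_eq: "(f has_derivative f') (at x) \<Longrightarrow> partial_deriv j f x = f' (axis j 1)"
  unfolding partial_deriv_def by (metis frechet_derivative_at)

lemma rapid_decay_lincomb:
  assumes "rapid_decay f" "rapid_decay g"
  shows "rapid_decay (\<lambda>x. a * f x + b * g x)"
  unfolding rapid_decay_def
proof
  fix N
  obtain C D where C: "\<And>x. (1 + norm x) ^ N * norm (f x) \<le> C" and D: "\<And>x. (1 + norm x) ^ N * norm (g x) \<le> D"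
    using assms unfolding rapid_decay_def by metis
  show "\<exists>C. \<forall>x. (1 + norm x) ^ N * norm (a * f x + b * g x) \<le> C"
  proof (intro exI allI)
    fix x
    have "(1 + norm x) ^ N * norm (a * f x + b * g x) \<le> (1 + norm x) ^ N * (norm a * norm (f x) + norm b * norm (g x))"
      by (intro mult_left_mono) (auto simp: norm_mult intro: order.trans[OF norm_triangle_ineq])
    also have "\<dots> = norm a * ((1 + norm x) ^ N * norm (f x)) + norm b * ((1 + norm x) ^ N * norm (g x))"
      by (simp add: algebra_simps)
    also have "\<dots> \<le> norm a * C + norm b * D"
      by (intro add_mono mult_left_mono C D) auto
    finally show "(1 + norm x) ^ N * norm (a * f x + b * g x) \<le> norm a * C + norm b * D" .
  qed
qed

lemma rapid_decay_growth:
  assumes "rapid_decay f" and "\<And>x. norm (g x) \<le> K * (1 + norm x) ^ M * norm (f x)" and "K \<ge> 0"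
  shows "rapid_decay g"
  unfolding rapid_decay_def
proof
  fix N
  obtain C where C: "\<And>x. (1 + norm x) ^ (N + M) * norm (f x) \<le> C"
    using assms unfolding rapid_decay_def by metis
  show "\<exists>C. \<forall>x. (1 + norm x) ^ N * norm (g x) \<le> C"
  proof (intro exI allI)
    fix x
    have "(1 + norm x) ^ N * norm (g x) \<le> (1 + norm x) ^ N * (K * (1 + norm x) ^ M * norm (f x))"
      by (intro mult_left_mono assms) auto
    also have "\<dots> = K * ((1 + norm x) ^ (N + M) * norm (f x))" by (simp add: power_add)
    also have "\<dots> \<le> K * C" using C assms by (intro mult_left_mono) auto
    finally show "(1 + norm x) ^ N * norm (g x) \<le> K * C" .
  qed
qed

lemma has_derivative_lincomb:
  fixes f g :: "real^'d::finite \<Rightarrow> complex"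
  assumes "(f has_derivative f') (at x)" "(g has_derivative g') (at x)"
  shows "((\<lambda>x. a * f x + b * g x) has_derivative (\<lambda>v. a * f' v + b * g' v)) (at x)"
  using assms by (auto intro!: derivative_eq_intros)

lemma partial_deriv_lincomb:
  assumes "\<And>x. f differentiable (at x)" "\<And>x. g differentiable (at x)"
  shows "partial_deriv j (\<lambda>x. a * f x + b * g x) = (\<lambda>x. a * partial_deriv j f x + b * partial_deriv j g x)"
proof
  fix x
  show "partial_deriv j (\<lambda>x. a * f x + b * g x) x = a * partial_deriv j f x + b * partial_deriv j g x"
    unfolding partial_deriv_eq[OF has_derivative_lincomb[OF assms(1)[unfolded frechet_derivative_works] assms(2)[unfolded frechet_derivative_works]]]
    by (simp add: partial_deriv_def)
qed

lemma schwartz_lincomb: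
  assumes "f \<in> schwartz_space" "g \<in> schwartz_space"
  shows "(\<lambda>x. a * f x + b * g x) \<in> schwartz_space"
proof (rule schwartz_coinduct[of _ "{(\<lambda>x. a * f x + b * g x) | f g. f \<in> schwartz_space \<and> g \<in> schwartz_space}"], goal_cases)
  case 1
  show ?case using assms by blast
next
  case (2 g x)
  then show ?case using has_derivative_lincomb[OF schwartz_has_derivative schwartz_has_derivative]
    unfolding differentiable_def by blast
next
  case (3 g)
  then show ?case using rapid_decay_lincomb[OF schwartz_rapid schwartz_rapid] by blast
next
  case (4 g j)
  then show ?case using schwartz_partial_deriv by (auto simp: partial_deriv_lincomb schwartz_differentiable) blast
qed

lemma schwartz_cmult: "f \<in> schwartz_space \<Longrightarrow> (\<lambda>x. a * f x) \<in> schwartz_space"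
  using schwartz_lincomb[of f f a 0] by simp

lemma schwartz_zero: "(\<lambda>x::real^'d::finite. 0) \<in> schwartz_space"
proof (rule schwartz_coinduct[of _ "{\<lambda>x. 0}"])
  have "partial_deriv j (\<lambda>x::real^'d. 0) = (\<lambda>x. 0)" for j
    by (rule ext, subst partial_deriv_eq[where f'="\<lambda>x. 0"]) auto
  then show "\<And>g j. g \<in> {\<lambda>x::real^'d. 0} \<Longrightarrow> partial_deriv j g \<in> {\<lambda>x. 0}" by simp
qed (auto simp: rapid_decay_def)

lemma coord_has_derivative:
  fixes f :: "real^'d::finite \<Rightarrow> complex"
  assumes "(f has_derivative f') (at x)"
  shows "((\<lambda>x. of_real (x $ j) * f x) has_derivative (\<lambda>v. of_real (v $ j) * f x + of_real (x $ j) * f' v)) (at x)"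
  using assms by (auto intro!: derivative_eq_intros has_derivative_of_real 
    bounded_linear_imp_has_derivative[OF bounded_linear_vec_nth] simp: algebra_simps)

lemma coord_partial_deriv:
  assumes "\<And>x. f differentiable (at x)"
  shows "partial_deriv i (\<lambda>x. of_real (x $ j) * f x) = (\<lambda>x. of_real (x $ j) * partial_deriv i f x + (if i = j then 1 else 0) * f x)"
proof
  fix x
  show "partial_deriv i (\<lambda>x. of_real (x $ j) * f x) x = of_real (x $ j) * partial_deriv i f x + (if i = j then 1 else 0) * f x"
    unfolding partial_deriv_eq[OF coord_has_derivative[OF assms[unfolded frechet_derivative_works]]]
    by (simp add: partial_deriv_def axis_def)
qed

lemma coord_rapid_decay:
  fixes f :: "real^'d::finite \<Rightarrow> complex"
  assumes "rapid_decay f"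
  shows "rapid_decay (\<lambda>x. of_real (x $ j) * f x)"
proof (rule rapid_decay_growth[OF assms, where K=1 and M=1])
  fix x :: "real^'d"
  have "\<bar>x $ j\<bar> \<le> 1 + norm x" using component_le_norm_cart[of x j] by simp
  then show "norm (of_real (x $ j) * f x) \<le> 1 * (1 + norm x) ^ 1 * norm (f x)"
    by (simp add: norm_mult mult_right_mono)
qed simp

text \<open>The sums \<open>x\<^sub>j f + g\<close> form a set closed under differentiation: the product rule only produces a
  further summand of the second kind.\<close>

lemma schwartz_coord:
  fixes f :: "real^'d::finite \<Rightarrow> complex"
  assumes "f \<in> schwartz_space"
  shows "(\<lambda>x. of_real (x $ j) * f x) \<in> schwartz_space"
proof (rule schwartz_coinduct[of _ "{(\<lambda>x. of_real (x $ j) * f x + g x) | f g. f \<in> schwartz_space \<and> g \<in> schwartz_space}"], goal_cases)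
  case 1
  show ?case using assms schwartz_zero by force
next
  case (2 g x)
  then show ?case
    using has_derivative_add[OF coord_has_derivative[OF schwartz_has_derivative] schwartz_has_derivative]
    unfolding differentiable_def by blast
next
  case (3 g)
  then show ?case using rapid_decay_lincomb[OF coord_rapid_decay[OF schwartz_rapid] schwartz_rapid, where a=1 and b=1]
    by (simp only: mult_1) blast
next
  case (4 g i)
  then obtain f h where g: "g = (\<lambda>x. of_real (x $ j) * f x + h x)" and f: "f \<in> schwartz_space" "h \<in> schwartz_space" by blast
  have "\<And>x. (\<lambda>x. of_real (x $ j) * f x) differentiable (at x)"
    using coord_has_derivative[OF schwartz_has_derivative[OF f(1)]] unfolding differentiable_def by blast
  from partial_deriv_lincomb[OF this schwartz_differentiable[OF f(2)], of i 1 1]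
  have "partial_deriv i g = (\<lambda>x. of_real (x $ j) * partial_deriv i f x + ((if i = j then 1 else 0) * f x + 1 * partial_deriv i h x))"
    by (simp only: g coord_partial_deriv[OF schwartz_differentiable[OF f(1)]] mult_1 add.assoc)
  moreover have "(\<lambda>x. (if i = j then 1 else 0) * f x + 1 * partial_deriv i h x) \<in> schwartz_space"
    by (rule schwartz_lincomb[OF f(1) schwartz_partial_deriv[OF f(2)]])
  ultimately show ?case using schwartz_partial_deriv[OF f(1)]
    by (intro CollectI exI[where x="partial_deriv i f"] exI[where x="\<lambda>x. (if i = j then 1 else 0) * f x + 1 * partial_deriv i h x"]) auto
qed

lemma cis_has_derivative:
  fixes a :: "real^'d::finite"
  shows "((\<lambda>x. cis (a \<bullet> x)) has_derivative (\<lambda>v. \<i> * of_real (a \<bullet> v) * cis (a \<bullet> x))) (at x)"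
  by (auto intro!: derivative_eq_intros simp: algebra_simps scaleR_conv_of_real)

lemma cis_mult_has_derivative:
  fixes f :: "real^'d::finite \<Rightarrow> complex"
  assumes "(f has_derivative f') (at x)"
  shows "((\<lambda>x. cis (a \<bullet> x) * f x) has_derivative (\<lambda>v. cis (a \<bullet> x) * (\<i> * of_real (a \<bullet> v) * f x + f' v))) (at x)"
  using assms by (auto intro!: derivative_eq_intros simp: algebra_simps scaleR_conv_of_real)

lemma schwartz_modulate:
  assumes "f \<in> schwartz_space"
  shows "(\<lambda>x. cis (a \<bullet> x) * f x) \<in> schwartz_space"
proof (rule schwartz_coinduct[of _ "{(\<lambda>x. cis (a \<bullet> x) * f x) | f. f \<in> schwartz_space}"], goal_cases)
  case 1
  then show ?case using assms by blast
next
  case (2 g x)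
  then show ?case using cis_mult_has_derivative[OF schwartz_has_derivative] unfolding differentiable_def by blast
next
  case (3 g)
  then obtain f where g: "g = (\<lambda>x. cis (a \<bullet> x) * f x)" and f: "f \<in> schwartz_space" by blast
  show ?case unfolding g
    by (rule rapid_decay_growth[OF schwartz_rapid[OF f], where K=1 and M=0]) (auto simp: norm_mult)
next
  case (4 g j)
  then obtain f where g: "g = (\<lambda>x. cis (a \<bullet> x) * f x)" and f: "f \<in> schwartz_space" by blast
  have "partial_deriv j g = (\<lambda>x. cis (a \<bullet> x) * (\<i> * of_real (a $ j) * f x + 1 * partial_deriv j f x))"
    (is "_ = (\<lambda>x. _ * ?h x)")
    unfolding g partial_deriv_eq[OF cis_mult_has_derivative[OF schwartz_has_derivative[OF f]]]
    by (simp add: partial_deriv_def inner_axis)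
  moreover have "?h \<in> schwartz_space" by (rule schwartz_lincomb[OF f schwartz_partial_deriv[OF f]])
  ultimately show ?case by (auto intro!: exI[where x="?h"])
qed

lemma affine_has_derivative:
  fixes f :: "real^'d::finite \<Rightarrow> complex"
  assumes "(f has_derivative f') (at (a + h *\<^sub>R x))"
  shows "((\<lambda>x. f (a + h *\<^sub>R x)) has_derivative (\<lambda>v. of_real h * f' v)) (at x)"
proof -
  have "((\<lambda>x. a + h *\<^sub>R x) has_derivative (\<lambda>v. h *\<^sub>R v)) (at x)"
    by (auto intro!: derivative_eq_intros)
  from has_derivative_compose[OF this assms]
  show ?thesis using has_derivative_linear[OF assms] by (simp only: linear_cmul) (simp only: scaleR_conv_of_real)
qed

lemma schwartz_affine:
  assumes "f \<in> schwartz_space" and "h \<noteq> 0"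
  shows "(\<lambda>x. f (a + h *\<^sub>R x)) \<in> schwartz_space"
proof (rule schwartz_coinduct[of _ "{(\<lambda>x. f (a + h *\<^sub>R x)) | f. f \<in> schwartz_space}"], goal_cases)
  case 1
  then show ?case using assms by blast
next
  case (2 g x)
  then show ?case using affine_has_derivative[OF schwartz_has_derivative] unfolding differentiable_def by blast
next
  case (3 g)
  then obtain f where g: "g = (\<lambda>x. f (a + h *\<^sub>R x))" and f: "f \<in> schwartz_space" by blast
  show ?case unfolding rapid_decay_def
  proof
    fix N
    obtain C where C: "\<And>x. (1 + norm x) ^ N * norm (f x) \<le> C"
      using schwartz_rapid[OF f] unfolding rapid_decay_def by metis
    define K where "K = 1 + (1 + norm a) / \<bar>h\<bar>"
    have K0: "K \<ge> 0" unfolding K_def by auto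
    have K: "1 + norm x \<le> K * (1 + norm (a + h *\<^sub>R x))" for x
    proof -
      have "norm (h *\<^sub>R x) \<le> norm (a + h *\<^sub>R x) + norm a"
        using norm_triangle_ineq4[of "a + h *\<^sub>R x" a] by simp
      then have "\<bar>h\<bar> * norm x \<le> norm (a + h *\<^sub>R x) + norm a" by simp
      then have "norm x \<le> (norm (a + h *\<^sub>R x) + norm a) / \<bar>h\<bar>"
        using assms(2) by (simp add: field_simps)
      also have "\<dots> \<le> ((1 + norm a) * (1 + norm (a + h *\<^sub>R x))) / \<bar>h\<bar>"
        by (intro divide_right_mono) (auto simp: algebra_simps)
      also have "\<dots> = (1 + norm a) / \<bar>h\<bar> * (1 + norm (a + h *\<^sub>R x))" by simp
      finally show ?thesis unfolding K_def by (simp only: distrib_right mult_1) (use norm_ge_zero[of "a + h *\<^sub>R x"] in linarith)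
    qed
    show "\<exists>C. \<forall>x. (1 + norm x) ^ N * norm (g x) \<le> C"
    proof (intro exI allI)
      fix x
      have "(1 + norm x) ^ N \<le> (K * (1 + norm (a + h *\<^sub>R x))) ^ N" by (intro power_mono K) auto
      then have "(1 + norm x) ^ N * norm (g x) \<le> (K * (1 + norm (a + h *\<^sub>R x))) ^ N * norm (g x)"
        by (intro mult_right_mono) auto
      also have "\<dots> = K ^ N * ((1 + norm (a + h *\<^sub>R x)) ^ N * norm (f (a + h *\<^sub>R x)))"
        by (simp add: g power_mult_distrib)
      also have "\<dots> \<le> K ^ N * C" using C K0 by (intro mult_left_mono) auto
      finally show "(1 + norm x) ^ N * norm (g x) \<le> K ^ N * C" .
    qed
  qed
next
  case (4 g j)
  then obtain f where g: "g = (\<lambda>x. f (a + h *\<^sub>R x))" and f: "f \<in> schwartz_space" by blast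
  have "partial_deriv j g = (\<lambda>x. of_real h * partial_deriv j f (a + h *\<^sub>R x))"
    unfolding g partial_deriv_eq[OF affine_has_derivative[OF schwartz_has_derivative[OF f]]]
    by (simp add: partial_deriv_def)
  then show ?case using schwartz_cmult[OF schwartz_partial_deriv[OF f], where a = "of_real h"] by auto
qed

text \<open>Gaussians times polynomials: the smallest space that contains the Gaussian and is closed under
  multiplication by coordinates. Derivatives stay inside it.\<close>

inductive_set gauss_span :: "(real^'d::finite \<Rightarrow> complex) set" where
  base: "(\<lambda>x. of_real (exp (- (x \<bullet> x)))) \<in> gauss_span"
| coord: "f \<in> gauss_span \<Longrightarrow> (\<lambda>x. of_real (x $ j) * f x) \<in> gauss_span"
| comb: "f \<in> gauss_span \<Longrightarrow> g \<in> gauss_span \<Longrightarrow> (\<lambda>x. a * f x + b * g x) \<in> gauss_span"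

lemma gauss_has_derivative:
  "((\<lambda>x::real^'d::finite. of_real (exp (- (x \<bullet> x))) :: complex) has_derivative
     (\<lambda>v. of_real (- 2 * (x \<bullet> v) * exp (- (x \<bullet> x))))) (at x)"
  by (auto intro!: derivative_eq_intros has_derivative_of_real simp: inner_commute algebra_simps)

lemma gauss_rapid: "rapid_decay (\<lambda>x::real^'d::finite. of_real (exp (- (x \<bullet> x))))"
  unfolding rapid_decay_def
proof
  fix N
  have "((\<lambda>t::real. (1 + t) ^ N * exp (- (t * t))) \<longlongrightarrow> 0) at_top"
  proof -
    have "((\<lambda>t::real. t ^ N / exp t) \<longlongrightarrow> 0) at_top" by (rule tendsto_power_div_exp_0)
    then have "((\<lambda>t::real. (1 + t) ^ N / exp (1 + t)) \<longlongrightarrow> 0) at_top"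
      by (rule filterlim_compose) (rule filterlim_tendsto_add_at_top[OF tendsto_const filterlim_ident])
    then have "((\<lambda>t::real. exp 1 * ((1 + t) ^ N / exp (1 + t))) \<longlongrightarrow> exp 1 * 0) at_top"
      by (intro tendsto_intros)
    then have l: "((\<lambda>t::real. (1 + t) ^ N * exp (- t)) \<longlongrightarrow> 0) at_top"
      by (simp add: exp_add exp_minus field_simps)
    show ?thesis
    proof (rule real_tendsto_sandwich[OF _ _ tendsto_const l])
      show "\<forall>\<^sub>F t::real in at_top. 0 \<le> (1 + t) ^ N * exp (- (t * t))" 
        by (rule eventually_mono[OF eventually_ge_at_top[of "0::real"]]) auto
      show "\<forall>\<^sub>F t::real in at_top. (1 + t) ^ N * exp (- (t * t)) \<le> (1 + t) ^ N * exp (- t)"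
        using eventually_ge_at_top[of "1::real"] 
      proof eventually_elim
        case (elim t)
        then have "t * 1 \<le> t * t" by (intro mult_left_mono) auto
        then show ?case using elim by (intro mult_left_mono) auto
      qed
    qed
  qed
  then have "\<forall>\<^sub>F t::real in at_top. (1 + t) ^ N * exp (- (t * t)) < 1"
    by (rule order_tendstoD) simp
  then obtain T :: real where T: "\<And>t. t \<ge> T \<Longrightarrow> (1 + t) ^ N * exp (- (t * t)) < 1"
    unfolding eventually_at_top_linorder by blast
  show "\<exists>C. \<forall>x::real^'d. (1 + norm x) ^ N * norm (of_real (exp (- (x \<bullet> x))) :: complex) \<le> C"
  proof (intro exI allI)
    fix x :: "real^'d"
    have e: "norm (of_real (exp (- (x \<bullet> x))) :: complex) = exp (- (norm x * norm x))"
      by (simp add: dot_square_norm power2_eq_square del: of_real_exp exp_of_real)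
    show "(1 + norm x) ^ N * norm (of_real (exp (- (x \<bullet> x))) :: complex) \<le> 1 + (1 + \<bar>T\<bar>) ^ N"
    proof (cases "norm x \<ge> T")
      case True
      then show ?thesis using T[OF True] unfolding e by (smt (verit) zero_le_power)
    next
      case False
      have "(1 + norm x) ^ N * exp (- (norm x * norm x)) \<le> (1 + \<bar>T\<bar>) ^ N * 1"
        using False by (intro mult_mono power_mono) auto
      then show ?thesis unfolding e by linarith
    qed
  qed
qed

lemma schwartz_gauss: "(\<lambda>x::real^'d::finite. of_real (exp (- (x \<bullet> x)))) \<in> schwartz_space"
proof (rule schwartz_coinduct[of _ gauss_span])
  show d: "g differentiable (at x)" if "g \<in> gauss_span" for g :: "real^'d \<Rightarrow> complex" and x
    using that
  proof (induction arbitrary: x)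
    case base
    then show ?case using gauss_has_derivative differentiable_def by blast
  next
    case (coord f j)
    then show ?case using coord_has_derivative unfolding differentiable_def by blast
  qed (auto intro!: derivative_intros)
  show "rapid_decay g" if "g \<in> gauss_span" for g :: "real^'d \<Rightarrow> complex"
    using that by induction (auto intro: gauss_rapid coord_rapid_decay rapid_decay_lincomb)
  show "partial_deriv j g \<in> gauss_span" if "g \<in> gauss_span" for g :: "real^'d \<Rightarrow> complex" and j
    using that
  proof induction
    case base
    have "partial_deriv j (\<lambda>x::real^'d. of_real (exp (- (x \<bullet> x)))) = 
      (\<lambda>x. (-2) * (of_real (x $ j) * of_real (exp (- (x \<bullet> x)))) + 0 * of_real (exp (- (x \<bullet> x))))"
      unfolding partial_deriv_eq[OF gauss_has_derivative] by (simp add: inner_axis mult.assoc)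
    then show ?case by (simp only:) (intro gauss_span.intros)
  next
    case (coord f i)
    then show ?case using gauss_span.comb[OF gauss_span.coord[OF coord.IH] coord.hyps, of 1]
      by (simp add: coord_partial_deriv[OF d[OF coord.hyps]])
  next
    case (comb f g a b)
    then show ?case using gauss_span.comb by (simp add: partial_deriv_lincomb d)
  qed
qed (rule gauss_span.base)

section \<open>The Fourier transform on the Schwartz space\<close>

lemma rapid_decayE:
  assumes "rapid_decay f"
  obtains C where "\<And>x. (1 + norm x) ^ N * norm (f x) \<le> C"
  using assms unfolding rapid_decay_def by blast

lemma lborel_affine_cart:
  fixes a :: "real^'d::finite"
  assumes "h \<noteq> 0"
  shows "lborel = density (distr lborel borel (\<lambda>x. a + h *\<^sub>R x)) (\<lambda>_. \<bar>h\<bar> ^ CARD('d))"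
  using lborel_affine[OF assms, of a] by simp

lemma nn_integral_affine:
  fixes a :: "real^'d::finite"
  assumes [measurable]: "f \<in> borel_measurable borel" and "h \<noteq> 0"
  shows "(\<integral>\<^sup>+x. f x \<partial>lborel) = ennreal (\<bar>h\<bar> ^ CARD('d)) * (\<integral>\<^sup>+x. f (a + h *\<^sub>R x) \<partial>lborel)"
  by (subst lborel_affine_cart[OF assms(2), of a]) (simp add: nn_integral_density nn_integral_distr nn_integral_cmult)

lemma AE_affine:
  fixes a :: "real^'d::finite"
  assumes "AE x in lborel. P x" and "h \<noteq> 0"
  shows "AE x in lborel. P (a + h *\<^sub>R x)"
proof -
  have "AE x in density (distr lborel borel (\<lambda>x. a + h *\<^sub>R x)) (\<lambda>_. ennreal (\<bar>h\<bar> ^ CARD('d))). P x"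
    using assms(1) by (subst lborel_affine_cart[OF assms(2), of a, symmetric])
  then have "AE x in distr lborel borel (\<lambda>x. a + h *\<^sub>R x). P x"
    using assms(2) by (subst (asm) AE_density) auto
  then show ?thesis by (rule AE_distrD[rotated]) simp
qed

lemma integrable_affine:
  fixes a :: "real^'d::finite" and f :: "real^'d \<Rightarrow> 'b::{banach, second_countable_topology}"
  assumes "integrable lborel f" and "h \<noteq> 0"
  shows "integrable lborel (\<lambda>x. f (a + h *\<^sub>R x))"
proof -
  have [measurable]: "f \<in> borel_measurable borel" using assms by auto
  have "integrable lborel (\<lambda>x. \<bar>h\<bar> ^ CARD('d) *\<^sub>R f (a + h *\<^sub>R x))" using assms
    by (subst (asm) lborel_affine_cart[OF assms(2), of a]) (simp add: integrable_density integrable_distr_eq)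
  then have "integrable lborel (\<lambda>x. (1 / \<bar>h\<bar> ^ CARD('d)) *\<^sub>R (\<bar>h\<bar> ^ CARD('d) *\<^sub>R f (a + h *\<^sub>R x)))"
    by (rule integrable_scaleR_right)
  then show ?thesis using assms(2) by simp
qed

lemma integral_affine:
  fixes a :: "real^'d::finite" and f :: "real^'d \<Rightarrow> 'b::{banach, second_countable_topology}"
  assumes "f \<in> borel_measurable borel" and "h \<noteq> 0"
  shows "(\<integral>x. f x \<partial>lborel) = (\<bar>h\<bar> ^ CARD('d)) *\<^sub>R (\<integral>x. f (a + h *\<^sub>R x) \<partial>lborel)"
  using assms by (subst lborel_affine_cart[OF assms(2), of a]) (simp add: integral_density integral_distr)

text \<open>On the shell \<open>n \<le> |x| \<le> n + 1\<close> the integrand is at most \<open>1 / (n + 1)^(d + 2)\<close> and the ball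
  containing the shell has volume of order \<open>(n + 1)^d\<close>, so the shells contribute a summable series.\<close>

lemma integrable_decay: "integrable lborel (\<lambda>x::real^'d::finite. 1 / (1 + norm x) ^ (CARD('d) + 2))"
proof (rule integrableI_bounded)
  let ?d = "CARD('d)"
  let ?V = "unit_ball_vol (real ?d)"
  have V: "?V \<ge> 0" by simp
  have "(\<integral>\<^sup>+x. ennreal (norm (1 / (1 + norm (x::real^'d)) ^ (?d + 2))) \<partial>lborel)
     \<le> (\<integral>\<^sup>+x. (\<Sum>n. ennreal (1 / (1 + real n) ^ (?d + 2)) * indicator (cball 0 (real n + 1)) (x::real^'d)) \<partial>lborel)"
  proof (rule nn_integral_mono)
    fix x :: "real^'d"
    define n where "n = nat \<lfloor>norm x\<rfloor>"
    have "real n = of_int \<lfloor>norm x\<rfloor>" by (simp add: n_def)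
    then have n: "real n \<le> norm x" "norm x \<le> real n + 1" by linarith+
    have "ennreal (norm (1 / (1 + norm x) ^ (?d + 2))) \<le> ennreal (1 / (1 + real n) ^ (?d + 2))"
      using n by (intro ennreal_leI) (auto intro!: divide_left_mono mult_mono power_mono mult_pos_pos zero_less_power add_pos_nonneg)
    also have "\<dots> = ennreal (1 / (1 + real n) ^ (?d + 2)) * indicator (cball 0 (real n + 1)) x"
      using n by (simp add: indicator_def)
    also have "\<dots> \<le> (\<Sum>n. ennreal (1 / (1 + real n) ^ (?d + 2)) * indicator (cball 0 (real n + 1)) x)"
    proof -
      have "sum f {n} \<le> suminf f" for f :: "nat \<Rightarrow> ennreal" by (rule sum_le_suminf) auto
      then show ?thesis by (simp only: sum.insert[OF finite.emptyI] sum.empty add_0_right empty_iff not_False_eq_True)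
    qed
    finally show "ennreal (norm (1 / (1 + norm x) ^ (?d + 2))) \<le> (\<Sum>n. ennreal (1 / (1 + real n) ^ (?d + 2)) * indicator (cball 0 (real n + 1)) x)" .
  qed
  also have "\<dots> = (\<Sum>n. ennreal (1 / (1 + real n) ^ (?d + 2)) * emeasure lborel (cball (0::real^'d) (real n + 1)))"
  proof (subst nn_integral_suminf)
    show "(\<lambda>x. ennreal (1 / (1 + real n) ^ (?d + 2)) * indicator (cball 0 (real n + 1)) (x::real^'d)) \<in> borel_measurable lborel" for n
      by (rule borel_measurable_times_ennreal[OF borel_measurable_const borel_measurable_indicator]) simp
  qed (intro suminf_cong nn_integral_cmult_indicator, simp)
  also have "\<dots> = (\<Sum>n. ennreal (?V * (1 / (1 + real n) ^ 2)))"
  proof (rule suminf_cong)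
    fix n
    have "1 / (1 + real n) ^ (?d + 2) * (?V * (real n + 1) ^ ?d) = ?V * (1 / (1 + real n) ^ 2)"
      by (simp add: power_add add.commute power2_eq_square)
    then show "ennreal (1 / (1 + real n) ^ (?d + 2)) * emeasure lborel (cball (0::real^'d) (real n + 1)) = ennreal (?V * (1 / (1 + real n) ^ 2))"
      by (subst emeasure_cball) (simp_all add: ennreal_mult'[symmetric] del: of_nat_Suc)
  qed
  also have "\<dots> < \<infinity>"
  proof -
    have "summable (\<lambda>n. ?V * (1 / (1 + real n) ^ 2))"
    proof (rule summable_mult)
      have "summable (\<lambda>n. inverse (real (Suc n) ^ 2))"
        using inverse_power_summable[of 2, where 'a=real] by (subst summable_Suc_iff) simp
      then show "summable (\<lambda>n. 1 / (1 + real n) ^ 2)" by (simp add: inverse_eq_divide add.commute)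
    qed
    then show ?thesis using V by (subst suminf_ennreal2) simp_all
  qed
  finally show "(\<integral>\<^sup>+x. ennreal (norm (1 / (1 + norm (x::real^'d)) ^ (?d + 2))) \<partial>lborel) < \<infinity>" .
qed simp

definition decay_mass :: "'d::finite itself \<Rightarrow> real" where
  "decay_mass _ = (\<integral>x. 1 / (1 + norm x) ^ (CARD('d) + 2) \<partial>(lborel :: (real^'d) measure))"

lemma decay_bound:
  fixes f :: "real^'d::finite \<Rightarrow> complex"
  assumes [measurable]: "f \<in> borel_measurable borel" and C: "\<And>x. (1 + norm x) ^ (CARD('d) + 2) * norm (f x) \<le> C"
  shows "integrable lborel f" and "(\<integral>x. norm (f x) \<partial>lborel) \<le> C * decay_mass TYPE('d)"
proof -
  have b: "norm (f x) \<le> C * (1 / (1 + norm x) ^ (CARD('d) + 2))" for x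
    using C[of x] by (simp add: field_simps add_pos_nonneg del: power_Suc power_add)
  have i: "integrable lborel (\<lambda>x::real^'d. C * (1 / (1 + norm x) ^ (CARD('d) + 2)))"
    by (rule integrable_mult_right[OF integrable_decay])
  show fi: "integrable lborel f"
    by (rule Bochner_Integration.integrable_bound[OF i]) (use b order_trans[OF b abs_ge_self] in auto)
  have "(\<integral>x. norm (f x) \<partial>lborel) \<le> (\<integral>x. C * (1 / (1 + norm x) ^ (CARD('d) + 2)) \<partial>(lborel :: (real^'d) measure))"
    using fi i b by (intro integral_mono) auto
  then show "(\<integral>x. norm (f x) \<partial>lborel) \<le> C * decay_mass TYPE('d)"
    unfolding decay_mass_def by (simp only: integral_mult_right_zero)
qed

lemma schwartz_integrable:
  fixes f :: "real^'d::finite \<Rightarrow> complex"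
  assumes "f \<in> schwartz_space"
  shows "integrable lborel f"
proof -
  obtain C where "\<And>x. (1 + norm x) ^ (CARD('d) + 2) * norm (f x) \<le> C"
    using rapid_decayE[OF schwartz_rapid[OF assms], of "CARD('d) + 2"] by blast
  from decay_bound(1)[OF schwartz_measurable[OF assms] this] show ?thesis .
qed

text \<open>Difference quotients of \<open>g\<close> have integral 0 by translation invariance, and they converge to the
  derivative, dominated by the decay of the derivative through the mean value inequality. This replaces
  an integration over one coordinate at a time.\<close>

lemma integral_partial_deriv_zero:
  fixes g :: "real^'d::finite \<Rightarrow> complex"
  assumes g: "g \<in> schwartz_space"
  shows "(\<integral>x. partial_deriv j g x \<partial>lborel) = 0"
proof -
  let ?e = "axis j 1 :: real^'d"
  let ?D = "\<lambda>n x. (real (Suc n)) *\<^sub>R (g (x + (1 / real (Suc n)) *\<^sub>R ?e) - g x)"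
  have ne: "norm ?e = 1" by simp
  have deriv: "((\<lambda>t. g (x + t *\<^sub>R ?e)) has_derivative (\<lambda>u. u *\<^sub>R partial_deriv j g (x + t *\<^sub>R ?e))) (at t)" for x t
  proof -
    have 1: "((\<lambda>t. x + t *\<^sub>R ?e) has_derivative (\<lambda>u. u *\<^sub>R ?e)) (at t)" by (auto intro!: derivative_eq_intros)
    have 2: "(g has_derivative frechet_derivative g (at (x + t *\<^sub>R ?e))) (at (x + t *\<^sub>R ?e))"
      by (rule schwartz_has_derivative[OF g])
    show ?thesis using has_derivative_compose[OF 1 2] has_derivative_linear[OF 2]
      by (simp only: linear_cmul partial_deriv_def)
  qed
  obtain C where C: "\<And>x. (1 + norm x) ^ (CARD('d) + 2) * norm (partial_deriv j g x) \<le> C"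
    using rapid_decayE[OF schwartz_rapid[OF schwartz_partial_deriv[OF g, of j]], of "CARD('d) + 2"] by blast
  have gm[measurable]: "g \<in> borel_measurable borel" "partial_deriv j g \<in> borel_measurable borel"
    using schwartz_measurable g schwartz_partial_deriv by blast+
  have lim: "(\<lambda>n. \<integral>x. ?D n x \<partial>lborel) \<longlonglongrightarrow> (\<integral>x. partial_deriv j g x \<partial>lborel)"
  proof (rule integral_dominated_convergence[where w="\<lambda>x. (2 ^ (CARD('d) + 2) * C) * (1 / (1 + norm x) ^ (CARD('d) + 2))"])
    show "integrable lborel (\<lambda>x::real^'d. (2 ^ (CARD('d) + 2) * C) * (1 / (1 + norm x) ^ (CARD('d) + 2)))"
      by (rule integrable_mult_right[OF integrable_decay])
    show "AE x in lborel. (\<lambda>n. ?D n x) \<longlonglongrightarrow> partial_deriv j g x"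
    proof (rule AE_I2)
      fix x
      have q1: "((\<lambda>t. norm (g (x + t *\<^sub>R ?e) - g x - t *\<^sub>R partial_deriv j g x) / norm t) \<longlongrightarrow> 0) (at 0)"
        using deriv[of x 0] unfolding has_derivative_iff_norm by simp
      have q2: "norm (g (x + t *\<^sub>R ?e) - g x - t *\<^sub>R partial_deriv j g x) / norm t
          = norm ((g (x + t *\<^sub>R ?e) - g x) /\<^sub>R t - partial_deriv j g x)" if "t \<noteq> 0" for t
      proof -
        have e: "(g (x + t *\<^sub>R ?e) - g x - t *\<^sub>R partial_deriv j g x) /\<^sub>R t = (g (x + t *\<^sub>R ?e) - g x) /\<^sub>R t - partial_deriv j g x"
          by (simp only: scaleR_right_diff_distrib scaleR_scaleR left_inverse[OF that] scaleR_one)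
        have n: "norm (X /\<^sub>R t) = norm X / norm t" for X :: complex
          by (simp only: norm_scaleR divide_inverse real_norm_def abs_inverse) (rule mult.commute)
        show ?thesis unfolding e[symmetric] by (rule n[symmetric])
      qed
      have "((\<lambda>t. norm ((g (x + t *\<^sub>R ?e) - g x) /\<^sub>R t - partial_deriv j g x)) \<longlongrightarrow> 0) (at 0)"
      proof (rule Lim_transform_eventually[OF q1])
        show "\<forall>\<^sub>F t in at 0. norm (g (x + t *\<^sub>R ?e) - g x - t *\<^sub>R partial_deriv j g x) / norm t
          = norm ((g (x + t *\<^sub>R ?e) - g x) /\<^sub>R t - partial_deriv j g x)"
          unfolding eventually_at_filter by (intro always_eventually allI impI) (rule q2)
      qed
      then have l: "((\<lambda>t. (g (x + t *\<^sub>R ?e) - g x) /\<^sub>R t) \<longlongrightarrow> partial_deriv j g x) (at 0)"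
        by (rule LIM_zero_cancel[OF tendsto_norm_zero_cancel])
      have "filterlim (\<lambda>n. 1 / real (Suc n)) (at 0) sequentially"
        unfolding filterlim_at using LIMSEQ_Suc[OF lim_1_over_n] by auto
      from filterlim_compose[OF l this]
      show "(\<lambda>n. ?D n x) \<longlonglongrightarrow> partial_deriv j g x" by simp
    qed
    show "AE x in lborel. norm (?D n x) \<le> (2 ^ (CARD('d) + 2) * C) * (1 / (1 + norm x) ^ (CARD('d) + 2))" for n
    proof (rule AE_I2)
      fix x :: "real^'d"
      let ?t = "1 / real (Suc n)"
      have t: "0 < ?t" "?t \<le> 1" by auto
      have "\<exists>u\<in>{0<..<?t}. norm (g (x + ?t *\<^sub>R ?e) - g (x + 0 *\<^sub>R ?e)) \<le> norm ((?t - 0) *\<^sub>R partial_deriv j g (x + u *\<^sub>R ?e))"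
        using t deriv[of x] by (intro mvt_general[where f = "\<lambda>t. g (x + t *\<^sub>R ?e)"])
          (auto intro!: continuous_at_imp_continuous_on has_derivative_continuous)
      then obtain u where u: "0 < u" "u < ?t" and b: "norm (g (x + ?t *\<^sub>R ?e) - g x) \<le> ?t * norm (partial_deriv j g (x + u *\<^sub>R ?e))"
        by auto
      have "norm (?D n x) = real (Suc n) * norm (g (x + ?t *\<^sub>R ?e) - g x)" by (simp only: norm_scaleR real_norm_def abs_of_nat)
      also have "\<dots> \<le> real (Suc n) * (?t * norm (partial_deriv j g (x + u *\<^sub>R ?e)))" by (intro mult_left_mono b) auto
      also have "\<dots> = norm (partial_deriv j g (x + u *\<^sub>R ?e))" by simp
      finally have 1: "norm (?D n x) \<le> norm (partial_deriv j g (x + u *\<^sub>R ?e))" .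
      have "u \<le> 1" using u(2) t(2) by linarith
      then have "norm (u *\<^sub>R ?e) \<le> 1" using u(1) by (simp add: ne)
      then have "1 + norm x \<le> 2 * (1 + norm (x + u *\<^sub>R ?e))"
      proof -
        have aux: "1 + a \<le> 2 * (1 + b)" if "c \<le> 1" "a \<le> b + c" "0 \<le> b" for a b c :: real
        proof -
          have "1 + a \<le> 1 + (b + 1)" using that(1,2) by (meson add_left_mono order_trans)
          also have "\<dots> \<le> 2 * (1 + b)" using that(3) by simp
          finally show ?thesis .
        qed
        have "norm x \<le> norm (x + u *\<^sub>R ?e) + norm (u *\<^sub>R ?e)"
          using norm_triangle_ineq4[of "x + u *\<^sub>R ?e" "u *\<^sub>R ?e"] unfolding add_diff_cancel_right' .
        with \<open>norm (u *\<^sub>R ?e) \<le> 1\<close> show ?thesis by (rule aux) (rule norm_ge_zero)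
      qed
      then have "(1 + norm x) ^ (CARD('d) + 2) \<le> (2 * (1 + norm (x + u *\<^sub>R ?e))) ^ (CARD('d) + 2)"
        by (intro power_mono) auto
      then have "(1 + norm x) ^ (CARD('d) + 2) * norm (partial_deriv j g (x + u *\<^sub>R ?e))
         \<le> (2 * (1 + norm (x + u *\<^sub>R ?e))) ^ (CARD('d) + 2) * norm (partial_deriv j g (x + u *\<^sub>R ?e))"
        by (intro mult_right_mono) auto
      also have "\<dots> = 2 ^ (CARD('d) + 2) * ((1 + norm (x + u *\<^sub>R ?e)) ^ (CARD('d) + 2) * norm (partial_deriv j g (x + u *\<^sub>R ?e)))"
        by (simp only: power_mult_distrib mult.assoc)
      also have "\<dots> \<le> 2 ^ (CARD('d) + 2) * C" by (intro mult_left_mono C) auto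
      finally have "norm (partial_deriv j g (x + u *\<^sub>R ?e)) \<le> (2 ^ (CARD('d) + 2) * C) * (1 / (1 + norm x) ^ (CARD('d) + 2))"
        by (simp only: times_divide_eq_right mult_1_right mult.commute[of "norm _"] pos_le_divide_eq[OF zero_less_power[OF add_pos_nonneg[OF zero_less_one norm_ge_zero]]])
      with 1 show "norm (?D n x) \<le> (2 ^ (CARD('d) + 2) * C) * (1 / (1 + norm x) ^ (CARD('d) + 2))" by linarith
    qed
  qed auto
  have "(\<integral>x. ?D n x \<partial>lborel) = 0" for n
  proof -
    let ?y = "(1 / real (Suc n)) *\<^sub>R ?e"
    have "(\<integral>x. g x \<partial>lborel) = (\<integral>x. g (x + ?y) \<partial>lborel)"
      using integral_affine[OF gm(1), of 1 ?y] by (simp add: add.commute)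
    moreover have "integrable lborel (\<lambda>x. g (x + ?y))"
      using integrable_affine[OF schwartz_integrable[OF g], of 1 ?y] by (simp add: add.commute)
    ultimately show ?thesis using schwartz_integrable[OF g] by simp
  qed
  with lim show ?thesis using LIMSEQ_unique[OF tendsto_const, of "0::complex"] by simp
qed

lemma fourier_cis: "fourier f \<omega> = (\<integral>x. f x * cis (- (\<omega> \<bullet> x)) \<partial>lborel)"
  unfolding fourier_def cis_conv_exp by simp

lemma integrable_mult_cis:
  fixes f :: "real^'d::finite \<Rightarrow> complex"
  assumes "integrable lborel f"
  shows "integrable lborel (\<lambda>x. f x * cis (a \<bullet> x))" "integrable lborel (\<lambda>x. f x * cis (- (a \<bullet> x)))"
proof -
  have [measurable]: "f \<in> borel_measurable borel" using assms by auto
  have [measurable]: "(\<lambda>x. cis (a \<bullet> x)) \<in> borel_measurable borel" for a :: "real^'d"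
    by (intro borel_measurable_continuous_onI continuous_intros)
  show 1: "integrable lborel (\<lambda>x. f x * cis (a \<bullet> x))" for a
    by (rule Bochner_Integration.integrable_bound[OF assms]) (auto simp: norm_mult)
  from 1[of "-a"] show "integrable lborel (\<lambda>x. f x * cis (- (a \<bullet> x)))" by simp
qed

lemma norm_fourier_le: "norm (fourier f \<omega>) \<le> (\<integral>x. norm (f x) \<partial>lborel)"
  unfolding fourier_cis by (rule order_trans[OF integral_norm_bound]) (simp add: norm_mult)

lemma fourier_lincomb:
  assumes "integrable lborel f" "integrable lborel g"
  shows "fourier (\<lambda>x. a * f x + b * g x) \<omega> = a * fourier f \<omega> + b * fourier g \<omega>"
proof -
  have "(a * f x + b * g x) * cis (- (\<omega> \<bullet> x)) = a * (f x * cis (- (\<omega> \<bullet> x))) + b * (g x * cis (- (\<omega> \<bullet> x)))" for x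
    by (simp only: distrib_right mult.assoc)
  then show ?thesis
    unfolding fourier_cis
    by (simp only: Bochner_Integration.integral_add[OF integrable_mult_right[OF integrable_mult_cis(2)[OF assms(1)]]
          integrable_mult_right[OF integrable_mult_cis(2)[OF assms(2)]]] integral_mult_right_zero)
qed

lemma fourier_cmult: "fourier (\<lambda>x. a * f x) \<omega> = a * fourier f \<omega>"
  unfolding fourier_cis by (simp add: mult.assoc)

lemma cis_taylor: "norm (cis t - 1 - \<i> * of_real t) \<le> t\<^sup>2"
proof -
  have "norm (exp (\<i> * of_real t) - (\<Sum>k\<le>1. (\<i> * of_real t) ^ k / fact k)) \<le> exp \<bar>Re (\<i> * of_real t)\<bar> * (norm (\<i> * of_real t)) ^ Suc 1 / fact 1"
    by (rule Taylor_exp)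
  then show ?thesis by (simp add: cis_conv_exp norm_mult power2_eq_square diff_diff_eq)
qed

text \<open>The Taylor estimate \<open>|cis t - 1 - \<i> t| \<le> t\<^sup>2\<close> bounds the remainder by \<open>|v|\<^sup>2\<close> times the second absolute
  moment of \<open>f\<close>, which gives a Frechet derivative without differentiating under the integral.\<close>

lemma fourier_has_derivative:
  fixes f :: "real^'d::finite \<Rightarrow> complex"
  assumes f: "f \<in> schwartz_space"
  shows "(fourier f has_derivative (\<lambda>v. \<Sum>j\<in>UNIV. of_real (v $ j) * fourier (\<lambda>x. - \<i> * (of_real (x $ j) * f x)) \<omega>)) (at \<omega>)"
    (is "(_ has_derivative ?D) _")
proof -
  note fi = schwartz_integrable[OF f]
  have [measurable]: "f \<in> borel_measurable borel" using schwartz_measurable f by blast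
  have [measurable]: "(\<lambda>x. cis (a \<bullet> x)) \<in> borel_measurable borel" for a :: "real^'d"
    by (intro borel_measurable_continuous_onI continuous_intros)
  define h where "h = (\<lambda>x. of_real ((norm x)\<^sup>2) * f x)"
  have hm: "h \<in> borel_measurable borel"
  proof -
    have "(\<lambda>x::real^'d. of_real ((norm x)\<^sup>2) :: complex) \<in> borel_measurable borel"
      by (intro borel_measurable_continuous_onI continuous_intros)
    then show ?thesis unfolding h_def using schwartz_measurable[OF f] by (rule borel_measurable_times)
  qed
  have h_le: "norm (h x) \<le> 1 * (1 + norm x) ^ 2 * norm (f x)" for x
  proof -
    have "(norm x)\<^sup>2 \<le> (1 + norm x)\<^sup>2" by (rule power_mono) simp_all
    then show ?thesis by (simp add: h_def norm_mult norm_power mult_right_mono)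
  qed
  have "rapid_decay h"
    by (rule rapid_decay_growth[OF schwartz_rapid[OF f] h_le]) simp
  then obtain C where "\<And>x. (1 + norm x) ^ (CARD('d) + 2) * norm (h x) \<le> C"
    using rapid_decayE[of h "CARD('d) + 2"] by blast
  from decay_bound(1)[OF hm this] have hi: "integrable lborel h" .
  define K where "K = (\<integral>x. norm (h x) \<partial>lborel)"
  have K: "K \<ge> 0" unfolding K_def by simp
  have bl: "bounded_linear ?D"
    by (intro bounded_linear_sum bounded_linear_mult_left[THEN bounded_linear_compose]
      bounded_linear_of_real[THEN bounded_linear_compose] bounded_linear_vec_nth)
  have D: "?D v = (\<integral>x. - \<i> * of_real (v \<bullet> x) * f x * cis (- (\<omega> \<bullet> x)) \<partial>lborel)"
      and Di: "integrable lborel (\<lambda>x. - \<i> * of_real (v \<bullet> x) * f x * cis (- (\<omega> \<bullet> x)))" for v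
  proof -
    have i: "integrable lborel (\<lambda>x. of_real (v $ j) * (- \<i> * (of_real (x $ j) * f x) * cis (- (\<omega> \<bullet> x))))" for j
      by (intro integrable_mult_right integrable_mult_cis(2) schwartz_integrable schwartz_cmult schwartz_coord f)
    have e: "- \<i> * of_real (v \<bullet> x) * f x * cis (- (\<omega> \<bullet> x)) = (\<Sum>j\<in>UNIV. of_real (v $ j) * (- \<i> * (of_real (x $ j) * f x) * cis (- (\<omega> \<bullet> x))))" for x
      by (simp add: inner_vec_def sum_distrib_left sum_distrib_right mult_ac sum_negf)
    show "?D v = (\<integral>x. - \<i> * of_real (v \<bullet> x) * f x * cis (- (\<omega> \<bullet> x)) \<partial>lborel)"
      unfolding e using i by (subst Bochner_Integration.integral_sum) (auto simp: fourier_cis)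
    show "integrable lborel (\<lambda>x. - \<i> * of_real (v \<bullet> x) * f x * cis (- (\<omega> \<bullet> x)))"
      unfolding e using i by (intro Bochner_Integration.integrable_sum) auto
  qed
  have rem: "norm (fourier f \<xi> - fourier f \<omega> - ?D (\<xi> - \<omega>)) \<le> (norm (\<xi> - \<omega>))\<^sup>2 * K" for \<xi>
  proof -
    let ?v = "\<xi> - \<omega>"
    have "fourier f \<xi> - fourier f \<omega> - ?D ?v = (\<integral>x. f x * cis (- (\<xi> \<bullet> x)) - f x * cis (- (\<omega> \<bullet> x)) - (- \<i> * of_real (?v \<bullet> x) * f x * cis (- (\<omega> \<bullet> x))) \<partial>lborel)"
      unfolding D unfolding fourier_cis
    proof -
      have i: "integrable lborel (\<lambda>x. f x * cis (- (\<xi> \<bullet> x)))" "integrable lborel (\<lambda>x. f x * cis (- (\<omega> \<bullet> x)))"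
        by (rule integrable_mult_cis(2)[OF fi])+
      show "(\<integral>x. f x * cis (- (\<xi> \<bullet> x)) \<partial>lborel) - (\<integral>x. f x * cis (- (\<omega> \<bullet> x)) \<partial>lborel)
          - (\<integral>x. - \<i> * of_real (?v \<bullet> x) * f x * cis (- (\<omega> \<bullet> x)) \<partial>lborel)
        = (\<integral>x. f x * cis (- (\<xi> \<bullet> x)) - f x * cis (- (\<omega> \<bullet> x)) - (- \<i> * of_real (?v \<bullet> x) * f x * cis (- (\<omega> \<bullet> x))) \<partial>lborel)"
        by (simp only: Bochner_Integration.integral_diff[OF Bochner_Integration.integrable_diff[OF i] Di]
          Bochner_Integration.integral_diff[OF i])
    qed
    also have "norm \<dots> \<le> (\<integral>x. (norm ?v)\<^sup>2 * norm (h x) \<partial>lborel)"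
    proof (rule order_trans[OF integral_norm_bound integral_mono])
      show "integrable lborel (\<lambda>x. norm (f x * cis (- (\<xi> \<bullet> x)) - f x * cis (- (\<omega> \<bullet> x)) - (- \<i> * of_real (?v \<bullet> x) * f x * cis (- (\<omega> \<bullet> x)))))"
        using integrable_mult_cis(2)[OF fi] Di by (intro integrable_norm Bochner_Integration.integrable_diff) auto
      show "integrable lborel (\<lambda>x. (norm ?v)\<^sup>2 * norm (h x))" using hi by simp
      fix x :: "real^'d"
      have "cis (- (\<xi> \<bullet> x)) = cis (- (\<omega> \<bullet> x)) * cis (- (?v \<bullet> x))"
        by (simp add: cis_mult inner_diff_left)
      then have "f x * cis (- (\<xi> \<bullet> x)) - f x * cis (- (\<omega> \<bullet> x)) - (- \<i> * of_real (?v \<bullet> x) * f x * cis (- (\<omega> \<bullet> x)))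
         = f x * cis (- (\<omega> \<bullet> x)) * (cis (- (?v \<bullet> x)) - 1 - \<i> * of_real (- (?v \<bullet> x)))"
        by (simp add: algebra_simps)
      also have "norm \<dots> \<le> norm (f x) * (- (?v \<bullet> x))\<^sup>2"
        unfolding norm_mult using cis_taylor[of "- (?v \<bullet> x)"] by (simp add: mult_left_mono)
      also have "\<dots> \<le> norm (f x) * (norm ?v * norm x)\<^sup>2"
        using Cauchy_Schwarz_ineq2[of ?v x] by (intro mult_left_mono) (auto simp: power2_le_iff_abs_le)
      also have "\<dots> = (norm ?v)\<^sup>2 * norm (h x)"
        by (simp add: h_def norm_mult norm_power power_mult_distrib)
      finally show "norm (f x * cis (- (\<xi> \<bullet> x)) - f x * cis (- (\<omega> \<bullet> x)) - (- \<i> * of_real (?v \<bullet> x) * f x * cis (- (\<omega> \<bullet> x)))) \<le> (norm ?v)\<^sup>2 * norm (h x)" .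
    qed
    also have "\<dots> = (norm ?v)\<^sup>2 * K" by (simp add: K_def)
    finally show ?thesis .
  qed
  have "((\<lambda>\<xi>. norm (fourier f \<xi> - fourier f \<omega> - ?D (\<xi> - \<omega>)) / norm (\<xi> - \<omega>)) \<longlongrightarrow> 0) (at \<omega>)"
  proof (rule Lim_null_comparison)
    show "\<forall>\<^sub>F \<xi> in at \<omega>. norm (norm (fourier f \<xi> - fourier f \<omega> - ?D (\<xi> - \<omega>)) / norm (\<xi> - \<omega>)) \<le> norm (\<xi> - \<omega>) * K"
    proof (rule always_eventually, rule allI)
      fix \<xi>
      show "norm (norm (fourier f \<xi> - fourier f \<omega> - ?D (\<xi> - \<omega>)) / norm (\<xi> - \<omega>)) \<le> norm (\<xi> - \<omega>) * K"
      proof (cases "\<xi> = \<omega>")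
        case False
        then have n: "norm (\<xi> - \<omega>) > 0" by (simp only: zero_less_norm_iff) simp
        have "norm (fourier f \<xi> - fourier f \<omega> - ?D (\<xi> - \<omega>)) / norm (\<xi> - \<omega>) \<le> (norm (\<xi> - \<omega>))\<^sup>2 * K / norm (\<xi> - \<omega>)"
          by (rule divide_right_mono[OF rem]) (rule norm_ge_zero)
        also have "\<dots> = norm (\<xi> - \<omega>) * K" using n by (simp only: power2_eq_square) (simp only: mult.assoc nonzero_mult_div_cancel_left[OF less_imp_neq[OF n, symmetric]])
        finally show ?thesis by (simp only: real_norm_def abs_divide abs_norm_cancel)
      qed simp
    qed
    have "((\<lambda>\<xi>. norm (\<xi> - \<omega>) * K) \<longlongrightarrow> norm (\<omega> - \<omega>) * K) (at \<omega>)" by (intro tendsto_intros)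
    then show "((\<lambda>\<xi>. norm (\<xi> - \<omega>) * K) \<longlongrightarrow> 0) (at \<omega>)" by simp
  qed
  then show ?thesis unfolding has_derivative_iff_norm using bl by simp
qed

lemma partial_deriv_fourier:
  fixes f :: "real^'d::finite \<Rightarrow> complex"
  assumes f: "f \<in> schwartz_space"
  shows "partial_deriv j (fourier f) = fourier (\<lambda>x. - \<i> * (of_real (x $ j) * f x))"
proof
  fix \<omega>
  have "(\<Sum>i\<in>UNIV. of_real (axis j 1 $ i) * fourier (\<lambda>x. - \<i> * (of_real (x $ i) * f x)) \<omega>)
      = (\<Sum>i\<in>UNIV. if i = j then fourier (\<lambda>x. - \<i> * (of_real (x $ i) * f x)) \<omega> else 0)"
    by (intro sum.cong) (auto simp: axis_def)
  then show "partial_deriv j (fourier f) \<omega> = fourier (\<lambda>x. - \<i> * (of_real (x $ j) * f x)) \<omega>"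
    unfolding partial_deriv_eq[OF fourier_has_derivative[OF f]] by simp
qed

lemma fourier_partial_deriv:
  fixes f :: "real^'d::finite \<Rightarrow> complex"
  assumes f: "f \<in> schwartz_space"
  shows "fourier (partial_deriv j f) \<omega> = \<i> * of_real (\<omega> $ j) * fourier f \<omega>"
proof -
  have "partial_deriv j (\<lambda>x. cis (- \<omega> \<bullet> x) * f x) = (\<lambda>x. cis (- \<omega> \<bullet> x) * (\<i> * of_real (- \<omega> $ j) * f x + partial_deriv j f x))"
    unfolding partial_deriv_eq[OF cis_mult_has_derivative[OF schwartz_has_derivative[OF f]]]
    by (simp add: partial_deriv_def inner_axis)
  then have "(\<integral>x. cis (- \<omega> \<bullet> x) * (\<i> * of_real (- \<omega> $ j) * f x + partial_deriv j f x) \<partial>lborel) = 0"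
    using integral_partial_deriv_zero[OF schwartz_modulate[OF f, of "-\<omega>"], of j] by simp
  also have "(\<integral>x. cis (- \<omega> \<bullet> x) * (\<i> * of_real (- \<omega> $ j) * f x + partial_deriv j f x) \<partial>lborel) =
     (\<integral>x. (\<i> * of_real (- \<omega> $ j)) * (f x * cis (- (\<omega> \<bullet> x))) + partial_deriv j f x * cis (- (\<omega> \<bullet> x)) \<partial>lborel)"
    by (intro Bochner_Integration.integral_cong) (auto simp: algebra_simps)
  also have "\<dots> = (\<i> * of_real (- \<omega> $ j)) * fourier f \<omega> + fourier (partial_deriv j f) \<omega>"
    unfolding fourier_cis
    using integrable_mult_cis(2)[OF schwartz_integrable[OF f]] integrable_mult_cis(2)[OF schwartz_integrable[OF schwartz_partial_deriv[OF f]]]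
    by (subst Bochner_Integration.integral_add) auto
  finally show ?thesis by (simp add: algebra_simps)
qed

lemma fourier_partial_derivs_replicate:
  fixes f :: "real^'d::finite \<Rightarrow> complex"
  assumes f: "f \<in> schwartz_space"
  shows "fourier (partial_derivs (replicate n j) f) \<omega> = (\<i> * of_real (\<omega> $ j)) ^ n * fourier f \<omega>"
  by (induction n) (auto simp: fourier_partial_deriv[OF schwartz_partial_derivs[OF f]])

lemma schwartz_seminorm_le:
  fixes f :: "real^'d::finite \<Rightarrow> complex"
  assumes f: "f \<in> schwartz_space" and "length js \<le> N" "M \<le> N"
  shows "(1 + norm x) ^ M * norm (partial_derivs js f x) \<le> schwartz_norm N f"
proof -
  have bdd: "bdd_above (range (\<lambda>x. (1 + norm x) ^ N * norm (partial_derivs ks f x)))" for ks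
    using f unfolding schwartz_space_def by simp
  have "(1 + norm x) ^ M * norm (partial_derivs js f x) \<le> (1 + norm x) ^ N * norm (partial_derivs js f x)"
    using assms by (intro mult_right_mono power_increasing) auto
  also have "\<dots> \<le> (SUP x. (1 + norm x) ^ N * norm (partial_derivs js f x))"
    by (rule cSUP_upper[OF _ bdd]) simp
  also have "\<dots> \<le> schwartz_norm N f" unfolding schwartz_norm_def
  proof (rule member_le_sum)
    show "js \<in> {js. length js \<le> N}" using assms by simp
    show "0 \<le> (SUP x. (1 + norm x) ^ N * norm (partial_derivs ks f x))" for ks
      by (rule cSUP_upper2[OF bdd, of 0]) auto
    show "finite {js::'d list. length js \<le> N}" using finite_lists_length_le[of "UNIV::'d set" N] by simp
  qed
  finally show ?thesis .
qed

text \<open>Applying the transform to \<open>M\<close>-fold derivatives in one coordinate direction multiplies it by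
  \<open>(\<i> \<omega>\<^sub>j)^M\<close>; the largest coordinate controls \<open>|\<omega>|\<close>. The explicit constant in front of
  \<open>schwartz_norm\<close> is independent of \<open>f\<close>, which is what makes the functionals \<open>dist_of F\<close> continuous.\<close>

lemma fourier_decay:
  fixes f :: "real^'d::finite \<Rightarrow> complex"
  assumes f: "f \<in> schwartz_space"
  shows "(1 + norm \<omega>) ^ M * norm (fourier f \<omega>)
    \<le> ((1 + real CARD('d)) ^ (M + 1) * decay_mass TYPE('d)) * schwartz_norm (M + CARD('d) + 2) f"
proof -
  let ?d = "real CARD('d)"
  let ?S = "schwartz_norm (M + CARD('d) + 2) f * decay_mass TYPE('d)"
  have b: "norm (fourier (partial_derivs js f) \<omega>) \<le> ?S" if "length js \<le> M" for js
  proof (rule order_trans[OF norm_fourier_le decay_bound(2)])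
    show "partial_derivs js f \<in> borel_measurable borel"
      using schwartz_measurable schwartz_partial_derivs[OF f] by blast
    show "(1 + norm x) ^ (CARD('d) + 2) * norm (partial_derivs js f x) \<le> schwartz_norm (M + CARD('d) + 2) f" for x
      using that by (intro schwartz_seminorm_le[OF f]) auto
  qed
  have c: "\<bar>\<omega> $ j\<bar> ^ M * norm (fourier f \<omega>) \<le> ?S" for j
    using b[of "replicate M j"] by (simp add: fourier_partial_derivs_replicate[OF f] norm_mult norm_power)
  have "Max (range (\<lambda>i. \<bar>\<omega> $ i\<bar>)) \<in> range (\<lambda>i. \<bar>\<omega> $ i\<bar>)" by (rule Max_in) auto
  then obtain j where "Max (range (\<lambda>i. \<bar>\<omega> $ i\<bar>)) = \<bar>\<omega> $ j\<bar>" by blast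
  then have j: "\<And>i. \<bar>\<omega> $ i\<bar> \<le> \<bar>\<omega> $ j\<bar>" using Max_ge[of "range (\<lambda>i. \<bar>\<omega> $ i\<bar>)"] by simp
  define m where "m = max 1 \<bar>\<omega> $ j\<bar>"
  have "norm \<omega> \<le> (\<Sum>i\<in>UNIV. \<bar>\<omega> $ i\<bar>)" by (rule norm_le_l1_cart)
  also have "\<dots> \<le> (\<Sum>i::'d\<in>UNIV. m)" using j by (intro sum_mono) (auto simp: m_def intro: max.coboundedI2)
  finally have "1 + norm \<omega> \<le> (1 + ?d) * m" by (simp add: algebra_simps m_def)
  then have "(1 + norm \<omega>) ^ M \<le> ((1 + ?d) * m) ^ M" by (intro power_mono) auto
  then have "(1 + norm \<omega>) ^ M * norm (fourier f \<omega>) \<le> ((1 + ?d) * m) ^ M * norm (fourier f \<omega>)"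
    by (intro mult_right_mono) auto
  also have "\<dots> = (1 + ?d) ^ M * (m ^ M * norm (fourier f \<omega>))" by (simp add: power_mult_distrib)
  also have "\<dots> \<le> (1 + ?d) ^ M * ?S"
    using b[of "[]"] c[of j] by (intro mult_left_mono) (auto simp: m_def max_def)
  also have "\<dots> \<le> (1 + ?d) ^ (M + 1) * ?S"
    using order_trans[OF norm_ge_zero b[of "[]"]] by (intro mult_right_mono power_increasing) auto
  finally show ?thesis by (simp add: mult_ac)
qed

lemma schwartz_fourier:
  fixes f :: "real^'d::finite \<Rightarrow> complex"
  assumes f: "f \<in> schwartz_space"
  shows "fourier f \<in> schwartz_space"
proof (rule schwartz_coinduct[of _ "fourier ` schwartz_space"], goal_cases)
  case 1
  show ?case using f by blast
next
  case (2 g x)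
  then show ?case using fourier_has_derivative unfolding differentiable_def by blast
next
  case (3 g)
  then show ?case unfolding rapid_decay_def using fourier_decay by blast
next
  case (4 g j)
  then obtain h where g: "g = fourier h" and h: "h \<in> schwartz_space" by blast
  show ?case unfolding g partial_deriv_fourier[OF h]
    by (intro imageI schwartz_cmult schwartz_coord h)
qed

section \<open>Approximation by trigonometric polynomials\<close>

text \<open>Periodic functions are treated as functions on a compact subset of \<open>complex^'d\<close>, where the
  Stone-Weierstrass theorem for polynomials applies.\<close>

definition torus :: "real^'d::finite \<Rightarrow> complex^'d" where
  "torus x = (\<chi> j. cis (x $ j))"

text \<open>The argument of a unit complex number, in \<open>[-\<pi>, \<pi>]\<close>. The truncation of the real part makes the
  function total and evidently Borel.\<close>

definition angle :: "complex \<Rightarrow> real" where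
  "angle z = (if Im z \<ge> 0 then arccos (max (-1) (min 1 (Re z))) else - arccos (max (-1) (min 1 (Re z))))"

text \<open>The representative of a point modulo the dual lattice in the cube centred at the origin.\<close>

definition reduce :: "real^'d::finite \<Rightarrow> real^'d" where
  "reduce x = (\<chi> j. angle (cis (x $ j)))"

lemma cis_angle: "cis (angle (cis t)) = cis t"
proof -
  have m: "max (-1) (min 1 (cos t)) = cos t"
    using cos_le_one[of t] cos_ge_minus_one[of t] by (simp add: max_absorb2 min_absorb2)
  have s: "sin (arccos (cos t)) = \<bar>sin t\<bar>"
    using sin_arccos[of "cos t"] by (simp add: sin_squared_eq[symmetric])
  show ?thesis by (rule complex_eqI) (auto simp: angle_def m s)
qed

lemma angle_cis: "\<bar>t\<bar> < pi \<Longrightarrow> angle (cis t) = t"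
proof -
  assume t: "\<bar>t\<bar> < pi"
  have m: "max (-1) (min 1 (cos t)) = cos t"
    using cos_le_one[of t] cos_ge_minus_one[of t] by (simp add: max_absorb2 min_absorb2)
  show ?thesis
  proof (cases "t \<ge> 0")
    case True
    then have "sin t \<ge> 0" using t by (intro sin_ge_zero) auto
    then show ?thesis using True t by (simp add: angle_def m arccos_cos)
  next
    case False
    then have "sin (- t) > 0" using t by (intro sin_gt_zero) auto
    then have "\<not> sin t \<ge> 0" by simp
    then show ?thesis using False t arccos_cos2[of t] by (simp add: angle_def m)
  qed
qed

lemma angle_measurable[measurable]: "angle \<in> borel_measurable borel"
proof -
  have [measurable]: "(\<lambda>z. arccos (max (-1) (min 1 (Re z)))) \<in> borel_measurable borel"
    by (intro borel_measurable_continuous_onI continuous_on_arccos continuous_intros) auto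
  have [measurable]: "Measurable.pred borel (\<lambda>z. 0 \<le> Im z)"
    by measurable
  show ?thesis unfolding angle_def by measurable
qed

lemma cis_eq_imp: "cis s = cis t \<Longrightarrow> \<exists>n::int. s = t + 2 * pi * of_int n"
  using sin_cos_eq_iff[of s t] by (auto simp: complex_eq_iff)

lemma dual_lattice_iff: "a \<in> dual_lattice \<longleftrightarrow> (\<forall>j. \<exists>n::int. a $ j = 2 * pi * of_int n)"
  for a :: "real^'d::finite"
proof
  assume "a \<in> dual_lattice"
  then show "\<forall>j. \<exists>n::int. a $ j = 2 * pi * of_int n"
    unfolding dual_lattice_def int_lattice_def by (auto elim!: Ints_cases) (metis Ints_cases)
next
  assume "\<forall>j. \<exists>n::int. a $ j = 2 * pi * of_int n"
  then obtain n :: "'d \<Rightarrow> int" where n: "\<And>j. a $ j = 2 * pi * of_int (n j)" by metis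
  have "a = (2 * pi) *\<^sub>R (\<chi> j. of_int (n j))" by (simp add: vec_eq_iff n)
  then show "a \<in> dual_lattice" unfolding dual_lattice_def int_lattice_def by auto
qed

lemma reduce_diff: "x - reduce x \<in> dual_lattice"
  unfolding dual_lattice_iff
proof
  fix j
  obtain n :: int where "x $ j = angle (cis (x $ j)) + 2 * pi * of_int n"
    using cis_eq_imp[OF cis_angle[symmetric]] by blast
  then show "\<exists>n::int. (x - reduce x) $ j = 2 * pi * of_int n" by (auto simp: reduce_def intro!: exI[of _ n])
qed

lemma cis_dual_lattice: "a \<in> dual_lattice \<Longrightarrow> cis ((x + a) $ j) = cis (x $ j)"
  unfolding dual_lattice_iff cis_conv_exp
proof -
  assume "\<forall>j. \<exists>n::int. a $ j = 2 * pi * of_int n"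
  then obtain n :: int where "a $ j = 2 * pi * of_int n" by blast
  then have "cis ((x + a) $ j) = cis (x $ j) * cis (2 * pi * of_int n)" 
    by (simp only: cis_mult vector_add_component \<open>a $ j = 2 * pi * of_int n\<close>)
  moreover have "cis (2 * pi * of_int n) = 1" by (rule cis_multiple_2pi) simp
  ultimately show "exp (\<i> * complex_of_real ((x + a) $ j)) = exp (\<i> * complex_of_real (x $ j))"
    by (simp only: cis_conv_exp mult_1_right)
qed

lemma reduce_periodic: "a \<in> dual_lattice \<Longrightarrow> reduce (x + a) = reduce x"
  unfolding reduce_def by (simp only: cis_dual_lattice)

lemma reduce_small: "norm x < pi \<Longrightarrow> reduce x = x"
  unfolding reduce_def vec_eq_iff
  using component_le_norm_cart[of x] by (auto intro!: angle_cis elim: order_le_less_trans[rotated])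

lemma vec_lambda_measurable:
  assumes "\<And>j. (\<lambda>x. f x j) \<in> borel_measurable M"
  shows "(\<lambda>x. (\<chi> j. f x j) :: real^'d::finite) \<in> borel_measurable M"
proof (rule borel_measurable_euclidean_space[THEN iffD2], rule ballI)
  fix b :: "real^'d"
  assume "b \<in> Basis"
  then obtain j where "b = axis j 1" by (auto simp: Basis_vec_def)
  then show "(\<lambda>x. (\<chi> j. f x j) \<bullet> b) \<in> borel_measurable M" using assms by (simp add: inner_axis)
qed

lemma continuous_on_cis_comp: "continuous_on S f \<Longrightarrow> continuous_on S (\<lambda>x. cis (f x))"
  unfolding cis_conv_exp by (intro continuous_intros)

lemma reduce_measurable[measurable]: "(reduce :: real^'d::finite \<Rightarrow> _) \<in> borel_measurable borel"
  unfolding reduce_def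
proof (rule vec_lambda_measurable)
  fix j :: 'd
  have "(\<lambda>x::real^'d. cis (x $ j)) \<in> borel_measurable borel"
    by (intro borel_measurable_continuous_onI continuous_on_cis_comp continuous_intros)
  from measurable_compose[OF this angle_measurable]
  show "(\<lambda>x::real^'d. angle (cis (x $ j))) \<in> borel_measurable borel" .
qed

inductive_set trig_poly :: "(real^'d::finite \<Rightarrow> complex) set" where
  char: "a \<in> int_lattice \<Longrightarrow> (\<lambda>x. cis (a \<bullet> x)) \<in> trig_poly"
| comb: "f \<in> trig_poly \<Longrightarrow> g \<in> trig_poly \<Longrightarrow> (\<lambda>x. a * f x + b * g x) \<in> trig_poly"

lemma int_lattice_add: "a \<in> int_lattice \<Longrightarrow> b \<in> int_lattice \<Longrightarrow> a + b \<in> int_lattice"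
  unfolding int_lattice_def by simp

lemma int_lattice_axis: "axis j 1 \<in> int_lattice" "- axis j 1 \<in> int_lattice" "0 \<in> int_lattice"
  unfolding int_lattice_def by (auto simp: axis_def)

lemma trig_poly_mult:
  assumes "f \<in> trig_poly" "g \<in> trig_poly"
  shows "(\<lambda>x. f x * g x) \<in> trig_poly"
  using assms(1)
proof induction
  case (char a)
  show ?case using assms(2)
  proof induction
    case (char b)
    have "(\<lambda>x. cis (a \<bullet> x) * cis (b \<bullet> x)) = (\<lambda>x. cis ((a + b) \<bullet> x))"
      by (simp add: cis_mult inner_add_left)
    then show ?case using trig_poly.char[OF int_lattice_add[OF \<open>a \<in> int_lattice\<close> char]] by (simp only:)
  next
    case (comb f g c d)
    have "(\<lambda>x. cis (a \<bullet> x) * (c * f x + d * g x)) = (\<lambda>x. c * (cis (a \<bullet> x) * f x) + d * (cis (a \<bullet> x) * g x))"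
      by (simp add: algebra_simps)
    then show ?case using trig_poly.comb[OF comb.IH] by (simp only:)
  qed
next
  case (comb f h c d)
  have "(\<lambda>x. (c * f x + d * h x) * g x) = (\<lambda>x. c * (f x * g x) + d * (h x * g x))"
    by (simp add: algebra_simps)
  then show ?case using trig_poly.comb[OF comb.IH] by (simp only:)
qed

lemma trig_poly_const: "(\<lambda>x. c) \<in> trig_poly"
  using trig_poly.comb[OF trig_poly.char[OF int_lattice_axis(3)] trig_poly.char[OF int_lattice_axis(3)], of c 0] by simp

lemma trig_poly_sum: "finite I \<Longrightarrow> (\<And>i. i \<in> I \<Longrightarrow> f i \<in> trig_poly) \<Longrightarrow> (\<lambda>x. \<Sum>i\<in>I. f i x) \<in> trig_poly"
proof (induction I rule: finite_induct)
  case empty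
  then show ?case by (simp add: trig_poly_const)
next
  case (insert i I)
  then show ?case using trig_poly.comb[of "f i" "\<lambda>x. \<Sum>i\<in>I. f i x" 1 1] by simp
qed

text \<open>Real polynomials in real and imaginary parts of \<open>cis x\<^sub>j\<close> are trigonometric polynomials, as
  \<open>cos\<close> and \<open>sin\<close> are combinations of \<open>cis x\<^sub>j\<close> and \<open>cis (- x\<^sub>j)\<close>.\<close>

lemma trig_poly_torus:
  fixes p :: "complex^'d::finite \<Rightarrow> real"
  assumes "real_polynomial_function p"
  shows "(\<lambda>x. of_real (p (torus x))) \<in> trig_poly"
  using assms
proof induction
  case (linear f)
  let ?c = "\<lambda>j. (of_real (f (axis j 1)) - \<i> * of_real (f (axis j \<i>))) / 2"
  let ?d = "\<lambda>j. (of_real (f (axis j 1)) + \<i> * of_real (f (axis j \<i>))) / 2"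
  have "of_real (f (torus x)) = (\<Sum>j\<in>UNIV. ?c j * cis (axis j 1 \<bullet> x) + ?d j * cis (- axis j 1 \<bullet> x))" for x
  proof -
    have "torus x = (\<Sum>j\<in>UNIV. cos (x $ j) *\<^sub>R axis j 1 + sin (x $ j) *\<^sub>R axis j \<i>)"
    proof (rule vec_eq_iff[THEN iffD2], rule allI)
      fix i
      have "(\<Sum>j\<in>UNIV. cos (x $ j) *\<^sub>R axis j 1 + sin (x $ j) *\<^sub>R axis j \<i>) $ i
          = (\<Sum>j\<in>UNIV. if j = i then cis (x $ i) else 0)"
        unfolding sum_component by (intro sum.cong) (auto simp: axis_def complex_eq_iff)
      then show "torus x $ i = (\<Sum>j\<in>UNIV. cos (x $ j) *\<^sub>R axis j 1 + sin (x $ j) *\<^sub>R axis j \<i>) $ i"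
        by (simp add: torus_def)
    qed
    then have "f (torus x) = (\<Sum>j\<in>UNIV. cos (x $ j) * f (axis j 1) + sin (x $ j) * f (axis j \<i>))"
      using bounded_linear.linear[OF linear] by (simp add: linear_sum linear_add linear_cmul)
    moreover have "of_real (cos (x $ j) * f (axis j 1) + sin (x $ j) * f (axis j \<i>))
        = ?c j * cis (axis j 1 \<bullet> x) + ?d j * cis (- axis j 1 \<bullet> x)" for j
    proof -
      have "axis j 1 \<bullet> x = x $ j" by (simp add: inner_axis')
      then show ?thesis by (simp add: complex_eq_iff field_simps)
    qed
    ultimately show ?thesis by (simp only: of_real_sum)
  qed
  then show ?case
    by (simp only:) (intro trig_poly_sum trig_poly.comb trig_poly.char int_lattice_axis finite)
next
  case (const c)
  then show ?case by (rule trig_poly_const)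
next
  case (add f g)
  then show ?case using trig_poly.comb[of "\<lambda>x. of_real (f (torus x))" "\<lambda>x. of_real (g (torus x))" 1 1] by simp
next
  case (mult f g)
  then show ?case using trig_poly_mult[of "\<lambda>x. of_real (f (torus x))" "\<lambda>x. of_real (g (torus x))"] by simp
qed

text \<open>Classes of functions that contain the integer characters and are closed under linear combinations
  and bounded pointwise limits. Such a class contains every bounded Borel function that is periodic
  with respect to the dual lattice: polynomials approximate continuous functions on the torus,
  continuous functions approximate indicators of closed sets, the sets with indicator in the class
  form a Dynkin system, and simple functions approximate the rest.\<close>

locale bp_closed =
  fixes T :: "(real^'d::finite \<Rightarrow> complex) set"
  assumes char: "c \<in> int_lattice \<Longrightarrow> (\<lambda>x. cis (c \<bullet> x)) \<in> T"
    and comb: "f \<in> T \<Longrightarrow> g \<in> T \<Longrightarrow> (\<lambda>x. a * f x + b * g x) \<in> T"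
    and lim: "(\<And>n. F n \<in> T) \<Longrightarrow> (\<And>n x. norm (F n x) \<le> K) \<Longrightarrow> (\<And>x. (\<lambda>n. F n x) \<longlonglongrightarrow> f x) \<Longrightarrow> f \<in> T"
begin

lemma trig: "f \<in> trig_poly \<Longrightarrow> f \<in> T"
  by (induction rule: trig_poly.induct) (auto intro: char comb)

lemma sum: "finite I \<Longrightarrow> (\<And>i. i \<in> I \<Longrightarrow> f i \<in> T) \<Longrightarrow> (\<lambda>x. \<Sum>i\<in>I. c i * f i x) \<in> T"
proof (induction I rule: finite_induct)
  case empty
  then show ?case using trig[OF trig_poly_const[of 0]] by simp
next
  case (insert i I)
  then show ?case using comb[of "f i" "\<lambda>x. \<Sum>i\<in>I. c i * f i x" "c i" 1] by simp
qed

lemma continuous_torus: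
  fixes g :: "complex^'d \<Rightarrow> real"
  assumes g: "continuous_on UNIV g"
  shows "(\<lambda>x. of_real (g (torus x))) \<in> T"
proof -
  define S where "S = cball (0::complex^'d) (real CARD('d))"
  have S: "compact S" unfolding S_def by simp
  have inS: "torus x \<in> S" for x
  proof -
    have "norm (torus x) \<le> (\<Sum>j\<in>UNIV. norm (torus x $ j))"
      unfolding norm_vec_def by (rule L2_set_le_sum) simp
    then show ?thesis by (simp add: S_def torus_def)
  qed
  have "\<exists>p. real_polynomial_function p \<and> (\<forall>z\<in>S. \<bar>g z - p z\<bar> < 1 / real (Suc n))" for n
    using Stone_Weierstrass_real_polynomial_function[OF S continuous_on_subset[OF g subset_UNIV], of "1 / real (Suc n)"]
    by (metis of_nat_0_less_iff zero_less_Suc zero_less_divide_1_iff)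
  then obtain p where p: "\<And>n. real_polynomial_function (p n)" and d: "\<And>n z. z \<in> S \<Longrightarrow> \<bar>g z - p n z\<bar> < 1 / real (Suc n)"
    by metis
  have "bounded (g ` S)" by (rule compact_imp_bounded[OF compact_continuous_image[OF continuous_on_subset[OF g subset_UNIV] S]])
  then obtain K where K: "\<And>z. z \<in> S \<Longrightarrow> \<bar>g z\<bar> \<le> K" unfolding bounded_iff by auto
  show ?thesis
  proof (rule lim[where F="\<lambda>n x. of_real (p n (torus x))" and K="K + 1"])
    show "(\<lambda>x. complex_of_real (p n (torus x))) \<in> T" for n by (rule trig[OF trig_poly_torus[OF p]])
    show "norm (complex_of_real (p n (torus x))) \<le> K + 1" for n x
    proof -
      have "1 / real (Suc n) \<le> 1" by simp
      then show ?thesis using d[OF inS, of x n] K[OF inS, of x] by (simp only: norm_of_real)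
    qed
    show "(\<lambda>n. complex_of_real (p n (torus x))) \<longlonglongrightarrow> complex_of_real (g (torus x))" for x
    proof (rule tendsto_of_real)
      have "(\<lambda>n. p n (torus x) - g (torus x)) \<longlonglongrightarrow> 0"
      proof (rule Lim_null_comparison)
        show "\<forall>\<^sub>F n in sequentially. norm (p n (torus x) - g (torus x)) \<le> 1 / real (Suc n)"
          by (intro always_eventually allI) (use d[OF inS, of x] in \<open>simp add: abs_minus_commute less_imp_le\<close>)
        show "(\<lambda>n. 1 / real (Suc n)) \<longlonglongrightarrow> 0" by (rule LIMSEQ_Suc[OF lim_1_over_n])
      qed
      then show "(\<lambda>n. p n (torus x)) \<longlonglongrightarrow> g (torus x)" by (rule LIM_zero_cancel)
    qed
  qed
qed

lemma closed_torus:
  assumes A: "closed A"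
  shows "(\<lambda>x. of_real (indicator A (torus x))) \<in> T"
proof (cases "A = {}")
  case True
  then show ?thesis using trig[OF trig_poly_const[of 0]] by simp
next
  case False
  let ?g = "\<lambda>n z. max 0 (1 - real n * infdist z A)"
  show ?thesis
  proof (rule lim[where F="\<lambda>n x. of_real (?g n (torus x))" and K=1])
    show "(\<lambda>x. complex_of_real (?g n (torus x))) \<in> T" for n
      by (rule continuous_torus) (intro continuous_intros)
    show "norm (complex_of_real (?g n (torus x))) \<le> 1" for n x
      using infdist_nonneg[of "torus x" A] by (simp only: norm_of_real) simp
    show "(\<lambda>n. complex_of_real (?g n (torus x))) \<longlonglongrightarrow> complex_of_real (indicator A (torus x))" for x
    proof (rule tendsto_of_real)
      let ?z = "torus x"
      show "(\<lambda>n. ?g n ?z) \<longlonglongrightarrow> indicator A ?z"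
      proof (cases "?z \<in> A")
        case True
        then show ?thesis by (simp add: infdist_zero)
      next
        case F: False
        then have pos: "infdist ?z A > 0" by (rule infdist_pos_not_in_closed[OF A False])
        obtain N :: nat where N: "1 < real N * infdist ?z A" using reals_Archimedean3[OF pos] by blast
        have "?g n ?z = 0" if "n \<ge> N" for n
        proof -
          have "real N * infdist ?z A \<le> real n * infdist ?z A" using that pos by (intro mult_right_mono) auto
          then show ?thesis using N by simp
        qed
        then have "\<forall>\<^sub>F n in sequentially. ?g n ?z = 0" unfolding eventually_sequentially by blast
        then show ?thesis using F by (simp add: tendsto_eventually)
      qed
    qed
  qed
qed

lemma borel_torus:
  assumes "A \<in> sets borel"
  shows "(\<lambda>x. of_real (indicator A (torus x))) \<in> T"
proof -
  have A: "A \<in> sigma_sets UNIV (Collect closed)" using assms unfolding borel_eq_closed by simp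
  have "Int_stable (Collect closed :: (complex^'d) set set)" by (auto simp: Int_stable_def)
  from this subset_Pow_Union[of "Collect closed", THEN subset_trans, of "Pow UNIV"] A
  have "Int_stable (Collect closed :: (complex^'d) set set)" "Collect closed \<subseteq> Pow (UNIV :: (complex^'d) set)"
    "A \<in> sigma_sets UNIV (Collect closed)" by auto
  then show ?thesis
  proof (induction rule: sigma_sets_induct_disjoint)
    case (union A)
    show ?case
    proof (rule lim[where F="\<lambda>n x. of_real (indicator (\<Union>i<n. A i) (torus x))" and K=1])
      show "(\<lambda>x. complex_of_real (indicator (\<Union>i<n. A i) (torus x))) \<in> T" for n
      proof -
        have "complex_of_real (indicator (\<Union>i<n. A i) z) = (\<Sum>i<n. 1 * complex_of_real (indicator (A i) z))" for z
        proof -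
          have "disjoint_family_on A {..<n}" using union(1) by (rule disjoint_family_on_mono[rotated]) simp
          from indicator_UN_disjoint[OF finite_lessThan this, of z]
          have "indicator (\<Union>i<n. A i) z = (\<Sum>i<n. indicator (A i) z :: real)" .
          then show ?thesis by simp
        qed
        then show ?thesis by (simp only:) (rule sum[OF finite_lessThan union(3)])
      qed
      show "norm (complex_of_real (indicator (\<Union>i<n. A i) (torus x))) \<le> 1" for n x
        by (simp add: indicator_def)
      show "(\<lambda>n. complex_of_real (indicator (\<Union>i<n. A i) (torus x))) \<longlonglongrightarrow> complex_of_real (indicator (\<Union>i. A i) (torus x))" for x
        by (intro tendsto_of_real LIMSEQ_indicator_UN)
    qed
  next
    case (basic A)
    then show ?case by (intro closed_torus) simp
  next
    case empty
    then show ?case using trig[OF trig_poly_const[of 0]] by simp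
  next
    case (compl A)
    have "complex_of_real (indicator (UNIV - A) z) = 1 * 1 + (-1) * complex_of_real (indicator A z)" for z
      by (simp add: indicator_def)
    then show ?case by (simp only:) (rule comb[OF trig[OF trig_poly_const] compl(2)])
  qed
qed

lemma bounded_torus:
  assumes q: "q \<in> borel_measurable borel" and K: "\<And>z. norm (q z) \<le> K"
  shows "(\<lambda>x. q (torus x)) \<in> T"
proof -
  from borel_measurable_implies_sequence_metric[OF q, of 0]
  obtain s where s: "\<And>i. simple_function borel (s i)" "\<And>z. (\<lambda>i. s i z) \<longlonglongrightarrow> q z" "\<And>i z. norm (s i z) \<le> 2 * norm (q z)"
    by auto
  show ?thesis
  proof (rule lim[where F="\<lambda>n x. s n (torus x)" and K="2 * K"])
    show "(\<lambda>x. s n (torus x)) \<in> T" for n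
    proof -
      have fin: "finite (range (s n))" using simple_functionD(1)[OF s(1)] by simp
      have meas: "s n -` {y} \<in> sets borel" for y using simple_functionD(2)[OF s(1), of n "{y}"] by simp
      have "s n z = (\<Sum>y\<in>range (s n). y * complex_of_real (indicator (s n -` {y}) z))" for z
      proof -
        have "(\<Sum>y\<in>range (s n). y * complex_of_real (indicator (s n -` {y}) z)) = (\<Sum>y\<in>range (s n). if y = s n z then s n z else 0)"
          by (intro sum.cong) (auto simp: indicator_def)
        then show ?thesis using fin by simp
      qed
      then have "(\<lambda>x. s n (torus x)) = (\<lambda>x. \<Sum>y\<in>range (s n). y * complex_of_real (indicator (s n -` {y}) (torus x)))"
        by blast
      also have "\<dots> \<in> T" by (rule sum[OF fin borel_torus[OF meas]])
      finally show ?thesis .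
    qed
    show "norm (s n (torus x)) \<le> 2 * K" for n x using s(3)[of n "torus x"] K[of "torus x"] by linarith
  qed (rule s(2))
qed

theorem bounded_reduce:
  assumes q: "q \<in> borel_measurable borel" and K: "\<And>z. norm (q z) \<le> K"
  shows "(\<lambda>x. q (reduce x)) \<in> T"
proof -
  have "(\<lambda>z::complex^'d. (\<chi> j. angle (z $ j)) :: real^'d) \<in> borel_measurable borel"
  proof (rule vec_lambda_measurable)
    fix j :: 'd
    have "(\<lambda>z::complex^'d. z $ j) \<in> borel_measurable borel"
      by (intro borel_measurable_continuous_onI continuous_intros)
    from measurable_compose[OF this angle_measurable]
    show "(\<lambda>z::complex^'d. angle (z $ j)) \<in> borel_measurable borel" .
  qed
  from bounded_torus[OF measurable_compose[OF this q] K]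
  show ?thesis by (simp add: reduce_def torus_def)
qed

end

text \<open>For every scale \<open>h = 1 / (n + 1)\<close> the functions \<open>\<tau>\<close> with \<open>\<integral> G(x) \<tau>(h x) dx = 0\<close> form a class as above, since
  characters give values of the Fourier transform. Hence \<open>G\<close> is orthogonal to all bounded periodic
  functions of period \<open>2\<pi>(n + 1)\<close>. As the period grows these reproduce the indicator of an arbitrary Borel
  set \<open>A\<close> at every point, so \<open>\<integral>\<^sub>A G = 0\<close>.\<close>

lemma L1_fourier_zero:
  fixes G :: "real^'d::finite \<Rightarrow> complex"
  assumes G: "integrable lborel G" and zero: "\<And>\<omega>. fourier G \<omega> = 0"
  shows "AE x in lborel. G x = 0"
proof (rule sigma_finite_measure.density_zero[OF sigma_finite_lborel G])
  fix A :: "(real^'d) set"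
  assume "A \<in> sets lborel"
  then have A[measurable]: "A \<in> sets borel" by simp
  have Gm[measurable]: "G \<in> borel_measurable borel" using G by auto
  have scaled: "(\<integral>x. G x * q (reduce ((1 / real (Suc n)) *\<^sub>R x)) \<partial>lborel) = 0"
    if q: "q \<in> borel_measurable borel" and K: "\<And>z. norm (q z) \<le> 1" for q :: "real^'d \<Rightarrow> complex" and n
  proof -
    let ?h = "1 / real (Suc n)"
    define T where "T = {\<tau>. \<tau> \<in> borel_measurable borel \<and> (\<exists>K. \<forall>x. norm (\<tau> x) \<le> K) \<and> (\<integral>x. G x * \<tau> (?h *\<^sub>R x) \<partial>lborel) = 0}"
    have int: "integrable lborel (\<lambda>x. G x * \<tau> (?h *\<^sub>R x))" if "\<tau> \<in> borel_measurable borel" "\<And>x. norm (\<tau> x) \<le> K" for \<tau> :: "real^'d \<Rightarrow> complex" and K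
    proof (rule Bochner_Integration.integrable_bound)
      show "integrable lborel (\<lambda>x. K * norm (G x))" using G by (intro integrable_mult_right integrable_norm)
      have [measurable]: "\<tau> \<in> borel_measurable borel" by fact
      show "(\<lambda>x. G x * \<tau> (?h *\<^sub>R x)) \<in> borel_measurable lborel" by measurable
      show "AE x in lborel. norm (G x * \<tau> (?h *\<^sub>R x)) \<le> norm (K * norm (G x))"
      proof (rule AE_I2)
        fix x
        have "norm (G x) * norm (\<tau> (?h *\<^sub>R x)) \<le> norm (G x) * K" by (intro mult_left_mono that) simp
        then show "norm (G x * \<tau> (?h *\<^sub>R x)) \<le> norm (K * norm (G x))"
          using order_trans[OF _ abs_ge_self] by (simp add: norm_mult mult.commute)
      qed
    qed
    interpret bp_closed T
    proof
      fix a :: "real^'d"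
      have "(\<lambda>x::real^'d. cis (a \<bullet> x)) \<in> borel_measurable borel"
        by (intro borel_measurable_continuous_onI continuous_on_cis_comp continuous_intros)
      moreover have "(\<integral>x. G x * cis (a \<bullet> (?h *\<^sub>R x)) \<partial>lborel) = 0"
        using zero[of "- (?h *\<^sub>R a)"] unfolding fourier_cis by simp
      ultimately show "(\<lambda>x. cis (a \<bullet> x)) \<in> T" unfolding T_def by (auto intro!: exI[of _ 1])
    next
      fix f g :: "real^'d \<Rightarrow> complex" and a b
      assume "f \<in> T" "g \<in> T"
      then obtain K L where f: "f \<in> borel_measurable borel" "\<And>x. norm (f x) \<le> K" "(\<integral>x. G x * f (?h *\<^sub>R x) \<partial>lborel) = 0"
        and g: "g \<in> borel_measurable borel" "\<And>x. norm (g x) \<le> L" "(\<integral>x. G x * g (?h *\<^sub>R x) \<partial>lborel) = 0"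
        unfolding T_def by blast
      have "(\<lambda>x. a * f x + b * g x) \<in> borel_measurable borel" using f(1) g(1) by measurable
      moreover have "norm (a * f x + b * g x) \<le> norm a * K + norm b * L" for x
        using norm_triangle_ineq[of "a * f x" "b * g x"] mult_left_mono[OF f(2)[of x], of "norm a"] mult_left_mono[OF g(2)[of x], of "norm b"]
        by (simp add: norm_mult)
      moreover have "(\<integral>x. G x * (a * f (?h *\<^sub>R x) + b * g (?h *\<^sub>R x)) \<partial>lborel) = 0"
      proof -
        have "(\<integral>x. G x * (a * f (?h *\<^sub>R x) + b * g (?h *\<^sub>R x)) \<partial>lborel)
            = (\<integral>x. a * (G x * f (?h *\<^sub>R x)) + b * (G x * g (?h *\<^sub>R x)) \<partial>lborel)"
          by (rule arg_cong[where f="integral\<^sup>L lborel"]) (simp add: algebra_simps)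
        also have "\<dots> = a * (\<integral>x. G x * f (?h *\<^sub>R x) \<partial>lborel) + b * (\<integral>x. G x * g (?h *\<^sub>R x) \<partial>lborel)"
          by (simp only: Bochner_Integration.integral_add[OF integrable_mult_right[OF int[OF f(1,2)]] integrable_mult_right[OF int[OF g(1,2)]]] integral_mult_right_zero)
        finally show ?thesis by (simp only: f(3) g(3) mult_zero_right add_0)
      qed
      ultimately show "(\<lambda>x. a * f x + b * g x) \<in> T" unfolding T_def by blast
    next
      fix F :: "nat \<Rightarrow> real^'d \<Rightarrow> complex" and K f
      assume F: "\<And>n. F n \<in> T" and K: "\<And>n x. norm (F n x) \<le> K" and l: "\<And>x. (\<lambda>n. F n x) \<longlonglongrightarrow> f x"
      have Fm[measurable]: "F n \<in> borel_measurable borel" for n using F[of n] unfolding T_def by blast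
      have fm[measurable]: "f \<in> borel_measurable borel" by (rule borel_measurable_LIMSEQ_metric[OF Fm l])
      have "norm (f x) \<le> K" for x by (rule LIMSEQ_le_const2[OF tendsto_norm[OF l]]) (use K in blast)
      moreover have "(\<lambda>n. \<integral>x. G x * F n (?h *\<^sub>R x) \<partial>lborel) \<longlonglongrightarrow> (\<integral>x. G x * f (?h *\<^sub>R x) \<partial>lborel)"
      proof (rule integral_dominated_convergence[where w="\<lambda>x. K * norm (G x)"])
        show "integrable lborel (\<lambda>x. K * norm (G x))" using G by (intro integrable_mult_right integrable_norm)
        show "(\<lambda>x. G x * f (?h *\<^sub>R x)) \<in> borel_measurable lborel" by measurable
        show "(\<lambda>x. G x * F n (?h *\<^sub>R x)) \<in> borel_measurable lborel" for n by measurable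
        show "AE x in lborel. (\<lambda>n. G x * F n (?h *\<^sub>R x)) \<longlonglongrightarrow> G x * f (?h *\<^sub>R x)"
          by (intro AE_I2 tendsto_mult tendsto_const l)
        show "AE x in lborel. norm (G x * F n (?h *\<^sub>R x)) \<le> K * norm (G x)" for n
          by (rule AE_I2) (simp only: norm_mult mult.commute[of "norm (G _)"], rule mult_right_mono[OF K norm_ge_zero])
      qed
      then have "(\<lambda>n::nat. 0) \<longlonglongrightarrow> (\<integral>x. G x * f (?h *\<^sub>R x) \<partial>lborel)"
        using F unfolding T_def by simp
      then have "(\<integral>x. G x * f (?h *\<^sub>R x) \<partial>lborel) = 0" using LIMSEQ_const_iff by metis
      ultimately show "f \<in> T" using fm unfolding T_def by blast
    qed
    from bounded_reduce[OF q K] show ?thesis unfolding T_def by simp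
  qed
  let ?q = "\<lambda>n (y::real^'d). complex_of_real (indicator A (real (Suc n) *\<^sub>R y))"
  let ?r = "\<lambda>n (x::real^'d). reduce ((1 / real (Suc n)) *\<^sub>R x)"
  have qm[measurable]: "?q n \<in> borel_measurable borel" for n by measurable
  have z: "(\<integral>x. G x * ?q n (?r n x) \<partial>lborel) = 0" for n
    by (rule scaled[OF qm]) (simp add: indicator_def)
  have "(\<lambda>n. \<integral>x. G x * ?q n (?r n x) \<partial>lborel) \<longlonglongrightarrow> (\<integral>x. G x * complex_of_real (indicator A x) \<partial>lborel)"
  proof (rule integral_dominated_convergence[where w="\<lambda>x. norm (G x)"])
    show "integrable lborel (\<lambda>x. norm (G x))" using G by (rule integrable_norm)
    show "(\<lambda>x. G x * complex_of_real (indicator A x)) \<in> borel_measurable lborel" by measurable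
    show "(\<lambda>x. G x * ?q n (?r n x)) \<in> borel_measurable lborel" for n by measurable
    show "AE x in lborel. norm (G x * ?q n (?r n x)) \<le> norm (G x)" for n
      by (rule AE_I2) (simp add: norm_mult indicator_def)
    show "AE x in lborel. (\<lambda>n. G x * ?q n (?r n x)) \<longlonglongrightarrow> G x * complex_of_real (indicator A x)"
    proof (rule AE_I2, rule tendsto_eventually)
      fix x :: "real^'d"
      obtain N :: nat where N: "norm x < real N * pi" using reals_Archimedean3[OF pi_gt_zero] by blast
      have "?q n (?r n x) = complex_of_real (indicator A x)" if "n \<ge> N" for n
      proof -
        have "real N * pi \<le> real (Suc n) * pi" using that by (intro mult_right_mono) auto
        then have "norm x < real (Suc n) * pi" using N by (rule less_le_trans[rotated])
        then have "norm ((1 / real (Suc n)) *\<^sub>R x) < pi" by (simp add: divide_less_eq mult.commute)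
        from reduce_small[OF this] have r: "?r n x = (1 / real (Suc n)) *\<^sub>R x" .
        show ?thesis unfolding r by simp
      qed
      then show "\<forall>\<^sub>F n in sequentially. G x * ?q n (?r n x) = G x * complex_of_real (indicator A x)"
        unfolding eventually_sequentially by (intro exI[of _ N]) simp
    qed
  qed
  then have "(\<lambda>n::nat. 0) \<longlonglongrightarrow> (\<integral>x. G x * complex_of_real (indicator A x) \<partial>lborel)" unfolding z .
  then have "(\<integral>x. G x * complex_of_real (indicator A x) \<partial>lborel) = 0" using LIMSEQ_const_iff by metis
  then show "set_lebesgue_integral lborel A G = 0"
    unfolding set_lebesgue_integral_def by (simp add: scaleR_conv_of_real mult.commute)
qed

section \<open>Fourier inversion\<close>

lemma cis_measurable[measurable]: "cis \<in> borel_measurable borel"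
  by (intro borel_measurable_continuous_onI continuous_on_cis_comp continuous_intros)

abbreviation gaussian :: "real^'d::finite \<Rightarrow> complex" where
  "gaussian \<equiv> \<lambda>x. of_real (exp (- (x \<bullet> x)))"

text \<open>Multiplied by a Gaussian, the difference of two representing functions becomes integrable, and its
  Fourier transform is a pairing with modulated Gaussians, which are Schwartz functions.\<close>

lemma represented_unique:
  fixes u :: "'d::finite functional"
  assumes F: "represented_by u F" and G: "represented_by u G"
  shows "AE x in lborel. F x = G x"
proof -
  let ?m = "\<lambda>\<omega> x. cis (- \<omega> \<bullet> x) * gaussian (x :: real^'d)"
  have S: "?m \<omega> \<in> schwartz_space" for \<omega> by (rule schwartz_modulate[OF schwartz_gauss])
  have i: "integrable lborel (\<lambda>x. F x * ?m \<omega> x)" "integrable lborel (\<lambda>x. G x * ?m \<omega> x)"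
    and e: "(\<integral>x. F x * ?m \<omega> x \<partial>lborel) = (\<integral>x. G x * ?m \<omega> x \<partial>lborel)" for \<omega>
    using F G S[of \<omega>] unfolding represented_by_def by auto
  let ?H = "\<lambda>x. F x * gaussian x - G x * gaussian x"
  have "AE x in lborel. ?H x = 0"
  proof (rule L1_fourier_zero)
    show "integrable lborel ?H" using i[of 0] by (intro Bochner_Integration.integrable_diff) simp_all
    fix \<omega> :: "real^'d"
    have "fourier ?H \<omega> = (\<integral>x. F x * ?m \<omega> x - G x * ?m \<omega> x \<partial>lborel)"
      unfolding fourier_cis by (rule arg_cong[where f="integral\<^sup>L lborel"]) (simp add: fun_eq_iff algebra_simps)
    also have "\<dots> = 0" by (simp only: Bochner_Integration.integral_diff[OF i] e diff_self)
    finally show "fourier ?H \<omega> = 0" .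
  qed
  then show ?thesis by eventually_elim (simp add: left_diff_distrib[symmetric])
qed

lemma fourier_mult_formula:
  fixes f g :: "real^'d::finite \<Rightarrow> complex"
  assumes f: "integrable lborel f" and g: "integrable lborel g"
  shows "(\<integral>\<omega>. fourier f \<omega> * g \<omega> \<partial>lborel) = (\<integral>x. f x * fourier g x \<partial>lborel)"
proof -
  have fm[measurable]: "f \<in> borel_measurable borel" and gm[measurable]: "g \<in> borel_measurable borel"
    using f g by auto
  let ?k = "\<lambda>x \<omega>. f x * (g \<omega> * cis (- (x \<bullet> \<omega>)))"
  have "integrable (lborel \<Otimes>\<^sub>M lborel) (case_prod ?k)"
  proof (rule lborel_pair.Fubini_integrable)
    show "case_prod ?k \<in> borel_measurable (lborel \<Otimes>\<^sub>M lborel)" by measurable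
    have "(\<integral>\<omega>. norm (case_prod ?k (x, \<omega>)) \<partial>lborel) = norm (f x) * (\<integral>\<omega>. norm (g \<omega>) \<partial>lborel)" for x
      by (simp add: norm_mult)
    then show "integrable lborel (\<lambda>x. \<integral>\<omega>. norm (case_prod ?k (x, \<omega>)) \<partial>lborel)"
      by (simp only:) (intro integrable_mult_left integrable_norm f)
    show "AE x in lborel. integrable lborel (\<lambda>\<omega>. case_prod ?k (x, \<omega>))"
      unfolding prod.case by (intro AE_I2 integrable_mult_right integrable_mult_cis(2) g)
  qed
  from lborel_pair.Fubini_integral[OF this]
  have e1: "(\<integral>\<omega>. (\<integral>x. ?k x \<omega> \<partial>lborel) \<partial>lborel) = (\<integral>x. (\<integral>\<omega>. ?k x \<omega> \<partial>lborel) \<partial>lborel)" .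
  have e2: "(\<integral>x. ?k x \<omega> \<partial>lborel) = fourier f \<omega> * g \<omega>" for \<omega>
  proof -
    have "(\<integral>x. ?k x \<omega> \<partial>lborel) = (\<integral>x. (f x * cis (- (\<omega> \<bullet> x))) * g \<omega> \<partial>lborel)"
      by (rule arg_cong[where f="integral\<^sup>L lborel"]) (simp add: fun_eq_iff inner_commute)
    then show ?thesis unfolding fourier_cis by (simp only: integral_mult_left_zero)
  qed
  have e3: "(\<integral>\<omega>. ?k x \<omega> \<partial>lborel) = f x * fourier g x" for x
    unfolding fourier_cis by (rule integral_mult_right_zero)
  from e1[unfolded e2 e3] show ?thesis .
qed

text \<open>The constant in the inversion formula is the integral of the transform of the Gaussian. Only its
  nonvanishing matters, so the transform of the Gaussian need not be computed.\<close>

definition inv_const :: "'d::finite itself \<Rightarrow> complex" where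
  "inv_const _ = (\<integral>\<omega>. fourier (gaussian :: real^'d \<Rightarrow> complex) \<omega> \<partial>lborel)"

lemma inverse_nat_tendsto: "(\<lambda>n. (1 / real (Suc n)) *\<^sub>R x) \<longlonglongrightarrow> (0 :: 'a::real_normed_vector)"
proof -
  have "(\<lambda>n. (1 / real (Suc n)) *\<^sub>R x) \<longlonglongrightarrow> 0 *\<^sub>R x"
    by (intro tendsto_scaleR LIMSEQ_Suc[OF lim_1_over_n] tendsto_const)
  then show ?thesis by simp
qed

lemma schwartz_bounded:
  assumes "f \<in> schwartz_space"
  shows "\<exists>C. \<forall>x. norm (f x) \<le> C"
  using rapid_decayE[OF schwartz_rapid[OF assms], of 0] by (simp only: power_0 mult_1) blast

text \<open>Gaussian summation: insert \<open>gaussian (h \<omega>)\<close> with \<open>h = 1 / (n + 1)\<close> into the outer transform, move the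
  transform to the other factor by Fubini, substitute, and let \<open>n\<close> tend to infinity on both sides.\<close>

lemma fourier_fourier:
  fixes f :: "real^'d::finite \<Rightarrow> complex"
  assumes f: "f \<in> schwartz_space"
  shows "fourier (fourier f) x = inv_const TYPE('d) * f (- x)"
proof -
  let ?h = "\<lambda>n. 1 / real (Suc n)"
  let ?K = "gaussian :: real^'d \<Rightarrow> complex"
  let ?g = "\<lambda>n \<omega>. cis (- x \<bullet> \<omega>) * ?K (0 + ?h n *\<^sub>R \<omega>)"
  have h: "?h n \<noteq> 0" for n by simp
  have fm[measurable]: "f \<in> borel_measurable borel" by (rule schwartz_measurable[OF f])
  have F: "fourier f \<in> schwartz_space" by (rule schwartz_fourier[OF f])
  have Fm[measurable]: "fourier f \<in> borel_measurable borel" by (rule schwartz_measurable[OF F])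
  have KF: "fourier ?K \<in> schwartz_space" by (rule schwartz_fourier[OF schwartz_gauss])
  have KFm[measurable]: "fourier ?K \<in> borel_measurable borel" by (rule schwartz_measurable[OF KF])
  have gS: "?g n \<in> schwartz_space" for n by (rule schwartz_modulate[OF schwartz_affine[OF schwartz_gauss h]])
  have gm: "?g n \<in> borel_measurable borel" for n by (rule schwartz_measurable[OF gS])
  have eq: "(\<integral>\<omega>. fourier f \<omega> * ?g n \<omega> \<partial>lborel) = (\<integral>z. f (- x + ?h n *\<^sub>R z) * fourier ?K z \<partial>lborel)" for n
  proof -
    have "(\<integral>\<omega>. fourier f \<omega> * ?g n \<omega> \<partial>lborel) = (\<integral>y. f y * fourier (?g n) y \<partial>lborel)"
      by (rule fourier_mult_formula[OF schwartz_integrable[OF f] schwartz_integrable[OF gS]])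
    also have "\<dots> = \<bar>?h n\<bar> ^ CARD('d) *\<^sub>R (\<integral>z. f (- x + ?h n *\<^sub>R z) * fourier (?g n) (- x + ?h n *\<^sub>R z) \<partial>lborel)"
      by (rule integral_affine[OF _ h]) (intro borel_measurable_times fm schwartz_measurable schwartz_fourier gS)
    also have "\<dots> = (\<integral>z. \<bar>?h n\<bar> ^ CARD('d) *\<^sub>R (f (- x + ?h n *\<^sub>R z) * fourier (?g n) (- x + ?h n *\<^sub>R z)) \<partial>lborel)"
      by (rule integral_scaleR_right[symmetric])
    also have "(\<lambda>z. \<bar>?h n\<bar> ^ CARD('d) *\<^sub>R (f (- x + ?h n *\<^sub>R z) * fourier (?g n) (- x + ?h n *\<^sub>R z))) = (\<lambda>z. f (- x + ?h n *\<^sub>R z) * fourier ?K z)"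
    proof
      fix z
      have "fourier ?K z = \<bar>?h n\<bar> ^ CARD('d) *\<^sub>R (\<integral>\<omega>. ?K (0 + ?h n *\<^sub>R \<omega>) * cis (- (z \<bullet> (0 + ?h n *\<^sub>R \<omega>))) \<partial>lborel)"
        unfolding fourier_cis by (rule integral_affine[OF _ h]) measurable
      also have "(\<integral>\<omega>. ?K (0 + ?h n *\<^sub>R \<omega>) * cis (- (z \<bullet> (0 + ?h n *\<^sub>R \<omega>))) \<partial>lborel) = fourier (?g n) (- x + ?h n *\<^sub>R z)"
        unfolding fourier_cis
      proof (rule arg_cong[where f="integral\<^sup>L lborel"], rule ext)
        fix \<omega>
        have "cis (- (z \<bullet> (0 + ?h n *\<^sub>R \<omega>))) = cis (- x \<bullet> \<omega>) * cis (- ((- x + ?h n *\<^sub>R z) \<bullet> \<omega>))"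
          unfolding cis_mult by (rule arg_cong[where f=cis]) (simp add: inner_add_left inner_diff_left)
        then show "?K (0 + ?h n *\<^sub>R \<omega>) * cis (- (z \<bullet> (0 + ?h n *\<^sub>R \<omega>))) = ?g n \<omega> * cis (- ((- x + ?h n *\<^sub>R z) \<bullet> \<omega>))"
          by (simp only: mult.assoc mult.commute mult.left_commute)
      qed
      finally show "\<bar>?h n\<bar> ^ CARD('d) *\<^sub>R (f (- x + ?h n *\<^sub>R z) * fourier (?g n) (- x + ?h n *\<^sub>R z)) = f (- x + ?h n *\<^sub>R z) * fourier ?K z"
        by (simp only: mult_scaleR_right)
    qed
    finally show ?thesis .
  qed
  have l1: "(\<lambda>n. \<integral>\<omega>. fourier f \<omega> * ?g n \<omega> \<partial>lborel) \<longlonglongrightarrow> (\<integral>\<omega>. fourier f \<omega> * cis (- (x \<bullet> \<omega>)) \<partial>lborel)"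
  proof (rule integral_dominated_convergence[where w="\<lambda>\<omega>. norm (fourier f \<omega>)"])
    show "(\<lambda>\<omega>. fourier f \<omega> * cis (- (x \<bullet> \<omega>))) \<in> borel_measurable lborel" by measurable
    show "(\<lambda>\<omega>. fourier f \<omega> * ?g n \<omega>) \<in> borel_measurable lborel" for n using Fm gm by measurable
    show "integrable lborel (\<lambda>\<omega>. norm (fourier f \<omega>))" by (intro integrable_norm schwartz_integrable F)
    show "AE \<omega> in lborel. norm (fourier f \<omega> * ?g n \<omega>) \<le> norm (fourier f \<omega>)" for n
    proof (rule AE_I2)
      fix \<omega> :: "real^'d"
      have "norm (?g n \<omega>) \<le> 1" by (simp only: norm_mult norm_cis norm_of_real) simp
      then show "norm (fourier f \<omega> * ?g n \<omega>) \<le> norm (fourier f \<omega>)"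
        unfolding norm_mult[of "fourier f \<omega>"] by (rule mult_left_le[OF _ norm_ge_zero])
    qed
    show "AE \<omega> in lborel. (\<lambda>n. fourier f \<omega> * ?g n \<omega>) \<longlonglongrightarrow> fourier f \<omega> * cis (- (x \<bullet> \<omega>))"
    proof (rule AE_I2)
      fix \<omega> :: "real^'d"
      have "(\<lambda>n. exp (- ((?h n *\<^sub>R \<omega>) \<bullet> (?h n *\<^sub>R \<omega>)))) \<longlonglongrightarrow> exp (- (0 \<bullet> (0::real^'d)))"
        by (intro tendsto_exp tendsto_minus tendsto_inner inverse_nat_tendsto)
      then have "(\<lambda>n. ?K (?h n *\<^sub>R \<omega>)) \<longlonglongrightarrow> of_real (exp (- (0 \<bullet> (0::real^'d))))"
        by (rule tendsto_of_real)
      then have "(\<lambda>n. fourier f \<omega> * (cis (- x \<bullet> \<omega>) * ?K (?h n *\<^sub>R \<omega>))) \<longlonglongrightarrow> fourier f \<omega> * (cis (- x \<bullet> \<omega>) * of_real (exp (- (0 \<bullet> (0::real^'d)))))"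
        by (intro tendsto_mult tendsto_const)
      then show "(\<lambda>n. fourier f \<omega> * ?g n \<omega>) \<longlonglongrightarrow> fourier f \<omega> * cis (- (x \<bullet> \<omega>))"
        by (simp only: add_0 inner_zero_left minus_zero exp_zero of_real_1 mult_1_right inner_minus_left)
    qed
  qed
  obtain C where C: "\<And>x. norm (f x) \<le> C" using schwartz_bounded[OF f] by blast
  have l2: "(\<lambda>n. \<integral>z. f (- x + ?h n *\<^sub>R z) * fourier ?K z \<partial>lborel) \<longlonglongrightarrow> (\<integral>z. f (- x) * fourier ?K z \<partial>lborel)"
  proof (rule integral_dominated_convergence[where w="\<lambda>z. C * norm (fourier ?K z)"])
    show "(\<lambda>z. f (- x) * fourier ?K z) \<in> borel_measurable lborel" by measurable
    show "(\<lambda>z. f (- x + ?h n *\<^sub>R z) * fourier ?K z) \<in> borel_measurable lborel" for n by measurable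
    show "integrable lborel (\<lambda>z. C * norm (fourier ?K z))" by (intro integrable_mult_right integrable_norm schwartz_integrable KF)
    show "AE z in lborel. norm (f (- x + ?h n *\<^sub>R z) * fourier ?K z) \<le> C * norm (fourier ?K z)" for n
      unfolding norm_mult by (intro AE_I2 mult_right_mono C norm_ge_zero)
    show "AE z in lborel. (\<lambda>n. f (- x + ?h n *\<^sub>R z) * fourier ?K z) \<longlonglongrightarrow> f (- x) * fourier ?K z"
    proof (rule AE_I2)
      fix z
      have "(\<lambda>n. - x + ?h n *\<^sub>R z) \<longlonglongrightarrow> - x + 0" by (intro tendsto_add tendsto_const inverse_nat_tendsto)
      then have "(\<lambda>n. - x + ?h n *\<^sub>R z) \<longlonglongrightarrow> - x" by simp
      moreover have "isCont f (- x)" by (rule differentiable_imp_continuous_within[OF schwartz_differentiable[OF f]])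
      ultimately have "(\<lambda>n. f (- x + ?h n *\<^sub>R z)) \<longlonglongrightarrow> f (- x)" by (rule isCont_tendsto_compose[rotated])
      then show "(\<lambda>n. f (- x + ?h n *\<^sub>R z) * fourier ?K z) \<longlonglongrightarrow> f (- x) * fourier ?K z"
        by (intro tendsto_mult tendsto_const)
    qed
  qed
  have "(\<integral>\<omega>. fourier f \<omega> * cis (- (x \<bullet> \<omega>)) \<partial>lborel) = (\<integral>z. f (- x) * fourier ?K z \<partial>lborel)"
    using l1 l2 unfolding eq by (rule LIMSEQ_unique)
  then show ?thesis
    unfolding fourier_cis[of "fourier f"] inv_const_def by (simp only: integral_mult_right_zero mult.commute)
qed

text \<open>Otherwise the transform of the Gaussian would itself have vanishing transform and hence vanish almost
  everywhere, although it is continuous with a positive value at the origin.\<close>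

lemma inv_const_nonzero: "inv_const TYPE('d::finite) \<noteq> 0"
proof
  let ?K = "gaussian :: real^'d \<Rightarrow> complex"
  assume 0: "inv_const TYPE('d) = 0"
  have KS: "fourier ?K \<in> schwartz_space" by (rule schwartz_fourier[OF schwartz_gauss])
  have "fourier (fourier ?K) x = 0" for x
    unfolding fourier_fourier[OF schwartz_gauss] 0 by simp
  then have ae: "AE \<omega> in lborel. fourier ?K \<omega> = 0"
    by (rule L1_fourier_zero[OF schwartz_integrable[OF KS]])
  have "fourier ?K 0 = of_real (\<integral>x. exp (- (x \<bullet> x)) \<partial>(lborel :: (real^'d) measure))"
    unfolding fourier_cis by simp
  moreover have "(\<integral>x. exp (- (x \<bullet> x)) \<partial>(lborel :: (real^'d) measure)) \<noteq> 0"
  proof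
    assume "(\<integral>x. exp (- (x \<bullet> x)) \<partial>(lborel :: (real^'d) measure)) = 0"
    moreover have "integrable lborel (\<lambda>x::real^'d. exp (- (x \<bullet> x)))"
      using integrable_norm[OF schwartz_integrable[OF schwartz_gauss]] by (simp only: norm_of_real abs_exp_cancel)
    ultimately have "AE x in (lborel :: (real^'d) measure). exp (- (x \<bullet> x)) = 0"
      by (subst (asm) integral_nonneg_eq_0_iff_AE) auto
    then have "AE x in (lborel :: (real^'d) measure). False" by eventually_elim simp
    then have "emeasure (lborel :: (real^'d) measure) UNIV = 0" by (simp add: AE_iff_measurable[OF _ refl])
    then show False by (simp add: emeasure_lborel_UNIV)
  qed
  ultimately have nz: "fourier ?K 0 \<noteq> 0" by (simp only: of_real_eq_0_iff not_False_eq_True)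
  have "continuous_on UNIV (fourier ?K)" by (rule schwartz_continuous[OF KS])
  then have op: "open (fourier ?K -` (- {0}))" by (intro open_vimage) auto
  have "0 \<in> fourier ?K -` (- {0})" using nz by (simp only: vimage_eq Compl_iff singleton_iff not_False_eq_True)
  with op obtain e where e: "e > 0" "ball 0 e \<subseteq> fourier ?K -` (- {0})" by (rule openE)
  have "AE \<omega> in lborel. \<omega> \<notin> ball (0::real^'d) e"
    using ae by eventually_elim (use e(2) in blast)
  then have "emeasure lborel (ball (0::real^'d) e) = 0"
    by (intro null_setsD1) (simp add: AE_iff_null_sets)
  then show False using e(1) content_ball_pos[OF e(1), of "0::real^'d"] by (simp add: measure_def)
qed

section \<open>Sobolev spaces in the frequency domain\<close>

abbreviation weight :: "real \<Rightarrow> real \<Rightarrow> 'a::real_normed_vector \<Rightarrow> real" where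
  "weight h s x \<equiv> (h + norm x) powr (2 * s)"

text \<open>The frequency side of \<open>sobolev_space s\<close>.\<close>

definition weighted_L2 :: "real \<Rightarrow> (real^'d::finite \<Rightarrow> complex) \<Rightarrow> bool" where
  "weighted_L2 s F \<longleftrightarrow> F \<in> borel_measurable borel \<and> integrable lborel (\<lambda>\<omega>. weight 1 s \<omega> * (norm (F \<omega>))\<^sup>2)"

definition wnorm2 :: "real \<Rightarrow> (real^'d::finite \<Rightarrow> complex) \<Rightarrow> ennreal" where
  "wnorm2 s F = (\<integral>\<^sup>+\<omega>. ennreal (weight 1 s \<omega> * (norm (F \<omega>))\<^sup>2) \<partial>lborel)"

text \<open>The inverse Fourier transform of \<open>F\<close>, written as a functional: the inverse transform of a Schwartz
  function is its transform, reflected and divided by \<open>inv_const\<close>.\<close>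

definition dist_of :: "(real^'d::finite \<Rightarrow> complex) \<Rightarrow> 'd functional" where
  "dist_of F = (\<lambda>f. if f \<in> schwartz_space then (1 / inv_const TYPE('d)) * (\<integral>\<omega>. F \<omega> * fourier f (- \<omega>) \<partial>lborel) else 0)"

lemma weighted_L2_iff: "weighted_L2 s F \<longleftrightarrow> F \<in> borel_measurable borel \<and> wnorm2 s F < \<infinity>"
proof -
  have "integrable lborel (\<lambda>\<omega>. weight 1 s \<omega> * (norm (F \<omega>))\<^sup>2) \<longleftrightarrow> wnorm2 s F < \<infinity>"
    if [measurable]: "F \<in> borel_measurable borel"
  proof -
    have "(\<lambda>\<omega>. weight 1 s \<omega> * (norm (F \<omega>))\<^sup>2) \<in> borel_measurable lborel" by measurable
    then show ?thesis unfolding wnorm2_def by (subst integrable_iff_bounded) auto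
  qed
  then show ?thesis unfolding weighted_L2_def by blast
qed

lemma weighted_L2_measurable: "weighted_L2 s F \<Longrightarrow> F \<in> borel_measurable borel"
  unfolding weighted_L2_def by simp

lemma weighted_L2_finite: "weighted_L2 s F \<Longrightarrow> wnorm2 s F < \<infinity>"
  unfolding weighted_L2_iff by simp

lemma wnorm2_cong:
  assumes "AE \<omega> in lborel. F \<omega> = G \<omega>"
  shows "wnorm2 s F = wnorm2 s G"
  unfolding wnorm2_def
proof (rule nn_integral_cong_AE)
  show "AE \<omega> in lborel. ennreal (weight 1 s \<omega> * (norm (F \<omega>))\<^sup>2) = ennreal (weight 1 s \<omega> * (norm (G \<omega>))\<^sup>2)"
    using assms by eventually_elim simp
qed

lemma one_le_norm_pos: "1 \<le> 1 + norm x" "0 < 1 + norm x" "1 + norm x \<noteq> 0"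
  using norm_ge_zero[of x] by linarith+

text \<open>An exponent \<open>M\<close> for which \<open>(1 + |\<omega>|) powr (- s - M)\<close> is square integrable on \<open>real^'d\<close>.\<close>

definition sobolev_power :: "real \<Rightarrow> 'd::finite itself \<Rightarrow> nat" where
  "sobolev_power s _ = nat \<lceil>\<bar>s\<bar>\<rceil> + CARD('d) + 2"

text \<open>With \<open>a = (1 + |\<omega>|) powr s * |F|\<close>, the integrand is \<open>a b\<close> for a square integrable negative power \<open>b\<close>
  of \<open>1 + |\<omega>|\<close>, and \<open>a b \<le> a\<^sup>2 + b\<^sup>2\<close>.\<close>

lemma weighted_L2_decay:
  fixes F :: "real^'d::finite \<Rightarrow> complex"
  assumes F: "weighted_L2 s F"
  shows "integrable lborel (\<lambda>\<omega>. norm (F \<omega>) * (1 / (1 + norm \<omega>) ^ sobolev_power s TYPE('d)))"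
proof (rule Bochner_Integration.integrable_bound)
  let ?M = "sobolev_power s TYPE('d)"
  have [measurable]: "F \<in> borel_measurable borel" by (rule weighted_L2_measurable[OF F])
  show "integrable lborel (\<lambda>\<omega>::real^'d. weight 1 s \<omega> * (norm (F \<omega>))\<^sup>2 + 1 / (1 + norm \<omega>) ^ (CARD('d) + 2))"
    using F integrable_decay unfolding weighted_L2_def by (intro Bochner_Integration.integrable_add) blast+
  show "(\<lambda>\<omega>. norm (F \<omega>) * (1 / (1 + norm \<omega>) ^ ?M)) \<in> borel_measurable lborel" by measurable
  show "AE \<omega> in lborel. norm (norm (F \<omega>) * (1 / (1 + norm \<omega>) ^ ?M)) \<le> norm (weight 1 s \<omega> * (norm (F \<omega>))\<^sup>2 + 1 / (1 + norm \<omega>) ^ (CARD('d) + 2))"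
  proof (rule AE_I2)
    fix \<omega> :: "real^'d"
    let ?r = "1 + norm \<omega>"
    note r = one_le_norm_pos[of \<omega>]
    define a where "a = ?r powr s * norm (F \<omega>)"
    define b where "b = ?r powr (- s - real ?M)"
    have ab: "a * b = norm (F \<omega>) * (1 / ?r ^ ?M)"
    proof -
      have "?r powr s * ?r powr (- s - real ?M) = ?r powr (- real ?M)" by (simp only: powr_add[symmetric]) simp
      also have "\<dots> = 1 / ?r ^ ?M" using r by (simp add: powr_minus_divide powr_realpow)
      finally show ?thesis unfolding a_def b_def by (simp only: mult.assoc mult.commute mult.left_commute)
    qed
    have a2: "a\<^sup>2 = ?r powr (2 * s) * (norm (F \<omega>))\<^sup>2"
      unfolding a_def power_mult_distrib by (simp add: power2_eq_square powr_add[symmetric])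
    have "- s - real ?M \<le> - real (CARD('d) + 2)"
    proof -
      have "- s \<le> real (nat \<lceil>\<bar>s\<bar>\<rceil>)" using real_nat_ceiling_ge[of "\<bar>s\<bar>"] abs_ge_minus_self[of s] by (rule order_trans[rotated])
      then show ?thesis unfolding sobolev_power_def by simp
    qed
    then have "b \<le> ?r powr (- real (CARD('d) + 2))" unfolding b_def using r(1) by (rule powr_mono)
    also have "\<dots> = 1 / ?r ^ (CARD('d) + 2)" using r by (simp only: powr_minus_divide powr_realpow)
    finally have b1: "b \<le> 1 / ?r ^ (CARD('d) + 2)" .
    have b0: "b \<ge> 0" unfolding b_def by simp
    have "1 / ?r ^ (CARD('d) + 2) \<le> 1" using one_le_power[OF r(1), of "CARD('d) + 2"] by (simp only: divide_le_eq_1_pos[OF zero_less_power[OF r(2)]])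
    with b1 have "b \<le> 1" by (rule order_trans)
    with b0 have "b\<^sup>2 \<le> b" by (simp add: power2_eq_square mult_left_le)
    with b1 have b2: "b\<^sup>2 \<le> 1 / ?r ^ (CARD('d) + 2)" by (rule order_trans[rotated])
    have a0: "a \<ge> 0" unfolding a_def by simp
    have "a * b \<le> a\<^sup>2 + b\<^sup>2"
    proof -
      have "0 \<le> (a - b)\<^sup>2" by simp
      then have "2 * (a * b) \<le> a\<^sup>2 + b\<^sup>2" by (simp add: power2_diff)
      moreover have "0 \<le> a * b" using a0 b0 by simp
      ultimately show ?thesis by simp
    qed
    also have "\<dots> \<le> ?r powr (2 * s) * (norm (F \<omega>))\<^sup>2 + 1 / ?r ^ (CARD('d) + 2)" unfolding a2 using b2 by simp
    finally have "norm (F \<omega>) * (1 / ?r ^ ?M) \<le> ?r powr (2 * s) * (norm (F \<omega>))\<^sup>2 + 1 / ?r ^ (CARD('d) + 2)" unfolding ab .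
    moreover have "0 \<le> norm (F \<omega>) * (1 / ?r ^ ?M)" unfolding ab[symmetric] using a0 b0 by simp
    ultimately show "norm (norm (F \<omega>) * (1 / ?r ^ ?M)) \<le> norm (?r powr (2 * s) * (norm (F \<omega>))\<^sup>2 + 1 / ?r ^ (CARD('d) + 2))"
      unfolding real_norm_def by (simp only: abs_of_nonneg)
  qed
qed

lemma weighted_L2_pairing:
  fixes F g :: "real^'d::finite \<Rightarrow> complex"
  assumes F: "weighted_L2 s F" and g: "g \<in> borel_measurable borel"
    and C: "\<And>\<omega>. (1 + norm \<omega>) ^ sobolev_power s TYPE('d) * norm (g \<omega>) \<le> C"
  shows "integrable lborel (\<lambda>\<omega>. F \<omega> * g \<omega>)"
    and "norm (\<integral>\<omega>. F \<omega> * g \<omega> \<partial>lborel) \<le> C * (\<integral>\<omega>. norm (F \<omega>) * (1 / (1 + norm \<omega>) ^ sobolev_power s TYPE('d)) \<partial>lborel)"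
proof -
  let ?M = "sobolev_power s TYPE('d)"
  let ?w = "\<lambda>\<omega>. norm (F \<omega>) * (1 / (1 + norm \<omega>) ^ ?M)"
  have Fm: "F \<in> borel_measurable borel" by (rule weighted_L2_measurable[OF F])
  have b: "norm (F \<omega> * g \<omega>) \<le> C * ?w \<omega>" for \<omega>
  proof -
    have p: "(1 + norm \<omega>) ^ ?M > 0" by (rule zero_less_power) (rule one_le_norm_pos)
    have "norm (g \<omega>) \<le> C / (1 + norm \<omega>) ^ ?M" using C[of \<omega>] by (simp only: pos_le_divide_eq[OF p] mult.commute)
    then have "norm (F \<omega>) * norm (g \<omega>) \<le> norm (F \<omega>) * (C / (1 + norm \<omega>) ^ ?M)" by (rule mult_left_mono) simp
    then show ?thesis by (simp add: norm_mult mult_ac)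
  qed
  have wi: "integrable lborel (\<lambda>\<omega>. C * ?w \<omega>)" by (rule integrable_mult_right[OF weighted_L2_decay[OF F]])
  show i: "integrable lborel (\<lambda>\<omega>. F \<omega> * g \<omega>)"
  proof (rule Bochner_Integration.integrable_bound[OF wi])
    show "(\<lambda>\<omega>. F \<omega> * g \<omega>) \<in> borel_measurable lborel" using Fm g by measurable
    show "AE \<omega> in lborel. norm (F \<omega> * g \<omega>) \<le> norm (C * ?w \<omega>)"
      by (intro AE_I2 order_trans[OF b]) (simp only: real_norm_def abs_ge_self)
  qed
  have "norm (\<integral>\<omega>. F \<omega> * g \<omega> \<partial>lborel) \<le> (\<integral>\<omega>. norm (F \<omega> * g \<omega>) \<partial>lborel)" by (rule integral_norm_bound)
  also have "\<dots> \<le> (\<integral>\<omega>. C * ?w \<omega> \<partial>lborel)" by (rule integral_mono[OF integrable_norm[OF i] wi b])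
  also have "\<dots> = C * (\<integral>\<omega>. ?w \<omega> \<partial>lborel)" by (rule integral_mult_right_zero)
  finally show "norm (\<integral>\<omega>. F \<omega> * g \<omega> \<partial>lborel) \<le> C * (\<integral>\<omega>. ?w \<omega> \<partial>lborel)" .
qed

lemma weighted_L2_schwartz:
  fixes F g :: "real^'d::finite \<Rightarrow> complex"
  assumes F: "weighted_L2 s F" and g: "g \<in> schwartz_space"
  shows "integrable lborel (\<lambda>\<omega>. F \<omega> * g \<omega>)"
proof -
  obtain C where "\<And>x. (1 + norm x) ^ sobolev_power s TYPE('d) * norm (g x) \<le> C"
    using rapid_decayE[OF schwartz_rapid[OF g], of "sobolev_power s TYPE('d)"] by blast
  from weighted_L2_pairing(1)[OF F schwartz_measurable[OF g] this] show ?thesis .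
qed

lemma schwartz_reflect: "f \<in> schwartz_space \<Longrightarrow> (\<lambda>x. f (- x)) \<in> schwartz_space"
  using schwartz_affine[of f "-1" 0] by simp

lemma fourier_reflect:
  fixes f :: "real^'d::finite \<Rightarrow> complex"
  assumes "f \<in> borel_measurable borel"
  shows "fourier (\<lambda>x. f (- x)) \<omega> = fourier f (- \<omega>)"
proof -
  have m: "(\<lambda>x. f x * cis (- (- \<omega> \<bullet> x))) \<in> borel_measurable borel" using assms by measurable
  show ?thesis unfolding fourier_cis using integral_affine[OF m, of "-1" 0] by simp
qed

lemma fourier_surj:
  fixes f :: "real^'d::finite \<Rightarrow> complex"
  assumes f: "f \<in> schwartz_space"
  defines "g \<equiv> \<lambda>x. (1 / inv_const TYPE('d)) * fourier f (- x)"
  shows "g \<in> schwartz_space" "fourier g = f"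
proof -
  have F: "fourier f \<in> schwartz_space" by (rule schwartz_fourier[OF f])
  show "g \<in> schwartz_space" unfolding g_def by (intro schwartz_cmult schwartz_reflect F)
  show "fourier g = f"
  proof
    fix x
    have "fourier g x = (1 / inv_const TYPE('d)) * fourier (fourier f) (- x)"
      unfolding g_def fourier_cmult fourier_reflect[OF schwartz_measurable[OF F]] ..
    then show "fourier g x = f x" by (simp add: fourier_fourier[OF f] inv_const_nonzero)
  qed
qed

lemma dist_of_represented:
  fixes F :: "real^'d::finite \<Rightarrow> complex"
  assumes F: "weighted_L2 s F"
  shows "represented_by (dist_fourier (dist_of F)) F"
  unfolding represented_by_def
proof (intro conjI ballI)
  show "F \<in> borel_measurable lborel" using weighted_L2_measurable[OF F] by simp
  fix f :: "real^'d \<Rightarrow> complex" assume f: "f \<in> schwartz_space"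
  show "integrable lborel (\<lambda>x. F x * f x)" by (rule weighted_L2_schwartz[OF F f])
  show "dist_fourier (dist_of F) f = (\<integral>x. F x * f x \<partial>lborel)"
  proof -
    have "(\<integral>\<omega>. F \<omega> * fourier (fourier f) (- \<omega>) \<partial>lborel) = (\<integral>\<omega>. inv_const TYPE('d) * (F \<omega> * f \<omega>) \<partial>lborel)"
      by (rule arg_cong[where f="integral\<^sup>L lborel"]) (simp add: fun_eq_iff fourier_fourier[OF f] mult_ac)
    also have "\<dots> = inv_const TYPE('d) * (\<integral>\<omega>. F \<omega> * f \<omega> \<partial>lborel)" by (rule integral_mult_right_zero)
    finally show ?thesis
      by (simp add: dist_fourier_def dist_of_def f schwartz_fourier inv_const_nonzero)
  qed
qed

lemma dist_of_tempered:
  fixes F :: "real^'d::finite \<Rightarrow> complex"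
  assumes F: "weighted_L2 s F"
  shows "dist_of F \<in> tempered_distributions"
  unfolding tempered_distributions_def
proof (intro CollectI conjI allI ballI impI)
  fix f :: "real^'d \<Rightarrow> complex"
  assume "f \<notin> schwartz_space"
  then show "dist_of F f = 0" by (simp add: dist_of_def)
next
  fix f g :: "real^'d \<Rightarrow> complex" and a b
  assume f: "f \<in> schwartz_space" and g: "g \<in> schwartz_space"
  have i: "integrable lborel (\<lambda>\<omega>. F \<omega> * fourier h (- \<omega>))" if "h \<in> schwartz_space" for h
    by (rule weighted_L2_schwartz[OF F schwartz_reflect[OF schwartz_fourier[OF that]]])
  have "(\<integral>\<omega>. F \<omega> * fourier (\<lambda>x. a * f x + b * g x) (- \<omega>) \<partial>lborel)
     = (\<integral>\<omega>. a * (F \<omega> * fourier f (- \<omega>)) + b * (F \<omega> * fourier g (- \<omega>)) \<partial>lborel)"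
    by (rule arg_cong[where f="integral\<^sup>L lborel"])
      (simp add: fun_eq_iff fourier_lincomb[OF schwartz_integrable[OF f] schwartz_integrable[OF g]] algebra_simps)
  also have "\<dots> = a * (\<integral>\<omega>. F \<omega> * fourier f (- \<omega>) \<partial>lborel) + b * (\<integral>\<omega>. F \<omega> * fourier g (- \<omega>) \<partial>lborel)"
    by (simp only: Bochner_Integration.integral_add[OF integrable_mult_right[OF i[OF f]] integrable_mult_right[OF i[OF g]]] integral_mult_right_zero)
  finally show "dist_of F (\<lambda>x. a * f x + b * g x) = a * dist_of F f + b * dist_of F g"
    by (simp add: dist_of_def f g schwartz_lincomb algebra_simps add_divide_distrib)
next
  let ?M = "sobolev_power s TYPE('d)"
  let ?I = "\<integral>\<omega>. norm (F \<omega>) * (1 / (1 + norm \<omega>) ^ ?M) \<partial>lborel"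
  let ?C = "(1 + real CARD('d)) ^ (?M + 1) * decay_mass TYPE('d)"
  let ?N = "?M + CARD('d) + 2"
  have "norm (dist_of F f) \<le> (norm (1 / inv_const TYPE('d)) * ?C * ?I) * schwartz_norm ?N f" if f: "f \<in> schwartz_space" for f
  proof -
    have "norm (\<integral>\<omega>. F \<omega> * fourier f (- \<omega>) \<partial>lborel) \<le> (?C * schwartz_norm ?N f) * ?I"
    proof (rule weighted_L2_pairing(2)[OF F])
      show "(\<lambda>\<omega>. fourier f (- \<omega>)) \<in> borel_measurable borel"
        by (intro schwartz_measurable schwartz_reflect schwartz_fourier f)
      show "(1 + norm \<omega>) ^ ?M * norm (fourier f (- \<omega>)) \<le> ?C * schwartz_norm ?N f" for \<omega>
        using fourier_decay[OF f, of "- \<omega>" ?M] by (simp only: norm_minus_cancel)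
    qed
    then have "norm (1 / inv_const TYPE('d)) * norm (\<integral>\<omega>. F \<omega> * fourier f (- \<omega>) \<partial>lborel)
      \<le> norm (1 / inv_const TYPE('d)) * ((?C * schwartz_norm ?N f) * ?I)" by (rule mult_left_mono) simp
    then show ?thesis unfolding dist_of_def using f by (simp only: if_True norm_mult mult_ac)
  qed
  then show "\<exists>C N. \<forall>f\<in>schwartz_space. norm (dist_of F f) \<le> C * schwartz_norm N f" by blast
qed

text \<open>A tempered distribution is determined by its Fourier transform, because the transform maps the
  Schwartz space onto itself.\<close>

lemma tempered_eq_dist_of:
  fixes u :: "'d::finite functional"
  assumes u: "u \<in> tempered_distributions" and F: "represented_by (dist_fourier u) F"
  shows "u = dist_of F"
proof
  fix f
  show "u f = dist_of F f"
  proof (cases "f \<in> schwartz_space")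
    case False
    then show ?thesis using u unfolding tempered_distributions_def dist_of_def by simp
  next
    case True
    let ?g = "\<lambda>x. (1 / inv_const TYPE('d)) * fourier f (- x)"
    have g: "?g \<in> schwartz_space" and fg: "fourier ?g = f" using fourier_surj[OF True] by auto
    have "u f = dist_fourier u ?g" unfolding dist_fourier_def using g fg by (simp only: if_True)
    also have "\<dots> = (\<integral>x. F x * ?g x \<partial>lborel)" using F g unfolding represented_by_def by blast
    also have "\<dots> = (\<integral>x. (1 / inv_const TYPE('d)) * (F x * fourier f (- x)) \<partial>lborel)"
      by (simp only: mult.left_commute)
    also have "\<dots> = (1 / inv_const TYPE('d)) * (\<integral>x. F x * fourier f (- x) \<partial>lborel)" by (rule integral_mult_right_zero)
    finally show ?thesis unfolding dist_of_def using True by (simp only: if_True)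
  qed
qed

lemma ft_dist_of:
  fixes F :: "real^'d::finite \<Rightarrow> complex"
  assumes F: "weighted_L2 s F"
  shows "represented_by (dist_fourier (dist_of F)) (ft_fun (dist_of F))"
    and "AE \<omega> in lborel. ft_fun (dist_of F) \<omega> = F \<omega>"
    and "ft_fun (dist_of F) \<in> borel_measurable borel"
proof -
  show 1: "represented_by (dist_fourier (dist_of F)) (ft_fun (dist_of F))"
    unfolding ft_fun_def by (rule someI[of "represented_by (dist_fourier (dist_of F))"]) (rule dist_of_represented[OF F])
  show "AE \<omega> in lborel. ft_fun (dist_of F) \<omega> = F \<omega>"
    by (rule represented_unique[OF 1 dist_of_represented[OF F]])
  show "ft_fun (dist_of F) \<in> borel_measurable borel" using 1 unfolding represented_by_def by simp
qed

lemma weighted_L2_cong: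
  assumes "weighted_L2 s F" "AE \<omega> in lborel. F \<omega> = G \<omega>" "G \<in> borel_measurable borel"
  shows "weighted_L2 s G"
  using assms wnorm2_cong[OF assms(2), of s] unfolding weighted_L2_iff by simp

lemma weighted_L2_local:
  fixes F :: "real^'d::finite \<Rightarrow> complex"
  assumes F: "weighted_L2 s F" and K: "compact K"
  shows "set_integrable lborel K (\<lambda>\<omega>. (norm (F \<omega>))\<^sup>2)"
proof -
  obtain R where R: "\<And>x. x \<in> K \<Longrightarrow> norm x \<le> R" using compact_imp_bounded[OF K] unfolding bounded_iff by blast
  show ?thesis unfolding set_integrable_def
  proof (rule Bochner_Integration.integrable_bound)
  have Km[measurable]: "K \<in> sets borel" using K by (simp add: borel_compact)
  have Fm[measurable]: "F \<in> borel_measurable borel" by (rule weighted_L2_measurable[OF F])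
  let ?c = "(1 + \<bar>R\<bar>) powr (2 * \<bar>s\<bar>)"
  show "integrable lborel (\<lambda>\<omega>. ?c * (weight 1 s \<omega> * (norm (F \<omega>))\<^sup>2))"
    using F unfolding weighted_L2_def by (intro integrable_mult_right) blast
  show "(\<lambda>\<omega>. indicat_real K \<omega> *\<^sub>R (norm (F \<omega>))\<^sup>2) \<in> borel_measurable lborel" by measurable
  show "AE \<omega> in lborel. norm (indicat_real K \<omega> *\<^sub>R (norm (F \<omega>))\<^sup>2) \<le> norm (?c * (weight 1 s \<omega> * (norm (F \<omega>))\<^sup>2))"
  proof (rule AE_I2)
    fix \<omega> :: "real^'d"
    show "norm (indicat_real K \<omega> *\<^sub>R (norm (F \<omega>))\<^sup>2) \<le> norm (?c * (weight 1 s \<omega> * (norm (F \<omega>))\<^sup>2))"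
    proof (cases "\<omega> \<in> K")
      case True
      let ?r = "1 + norm \<omega>"
      have r: "1 \<le> ?r" "?r \<le> 1 + \<bar>R\<bar>" using R[OF True] by auto
      have "1 = ?r powr (- 2 * s) * ?r powr (2 * s)" using one_le_norm_pos[of \<omega>] by (simp only: powr_add[symmetric]) simp
      also have "\<dots> \<le> ?c * ?r powr (2 * s)"
      proof (rule mult_right_mono)
        have "?r powr (- 2 * s) \<le> ?r powr (2 * \<bar>s\<bar>)" using r by (intro powr_mono) auto
        also have "\<dots> \<le> ?c" using r by (intro powr_mono2) auto
        finally show "?r powr (- 2 * s) \<le> ?c" .
      qed simp
      finally have "1 * (norm (F \<omega>))\<^sup>2 \<le> (?c * ?r powr (2 * s)) * (norm (F \<omega>))\<^sup>2" by (rule mult_right_mono) simp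
      then show ?thesis using True by (simp add: mult.assoc)
    qed simp
  qed
  qed
qed

lemma dist_of_sobolev:
  fixes F :: "real^'d::finite \<Rightarrow> complex"
  assumes F: "weighted_L2 s F"
  shows "dist_of F \<in> sobolev_space s"
proof -
  have G: "weighted_L2 s (ft_fun (dist_of F))"
  proof (rule weighted_L2_cong[OF F])
    show "AE \<omega> in lborel. F \<omega> = ft_fun (dist_of F) \<omega>" using ft_dist_of(2)[OF F] by eventually_elim simp
  qed (rule ft_dist_of(3)[OF F])
  show ?thesis unfolding sobolev_space_def
    using dist_of_tempered[OF F] ft_dist_of(1)[OF F] weighted_L2_local[OF G] G unfolding weighted_L2_def by blast
qed

text \<open>Together with \<open>dist_of_sobolev\<close> this identifies the Sobolev space with the weighted square integrable
  functions. Subspaces, translates and dilates are handled on the frequency side from here on.\<close>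

lemma sobolev_ft:
  fixes u :: "'d::finite functional"
  assumes u: "u \<in> sobolev_space s"
  shows "weighted_L2 s (ft_fun u)" and "u = dist_of (ft_fun u)"
proof -
  have t: "u \<in> tempered_distributions" and ex: "\<exists>F. represented_by (dist_fourier u) F"
    and i: "integrable lborel (\<lambda>\<omega>. weight 1 s \<omega> * (norm (ft_fun u \<omega>))\<^sup>2)"
    using u unfolding sobolev_space_def by auto
  have r: "represented_by (dist_fourier u) (ft_fun u)" unfolding ft_fun_def by (rule someI_ex[OF ex])
  then show "weighted_L2 s (ft_fun u)" unfolding weighted_L2_def represented_by_def using i by simp
  show "u = dist_of (ft_fun u)" by (rule tempered_eq_dist_of[OF t r])
qed

text \<open>Norms are compared through extended nonnegative integrals, which avoids integrability side
  conditions.\<close>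

lemma sobolev_normE:
  fixes F :: "real^'d::finite \<Rightarrow> complex"
  assumes F: "weighted_L2 s F"
  shows "ennreal ((sobolev_norm s (dist_of F))\<^sup>2) = wnorm2 s F"
proof -
  let ?G = "ft_fun (dist_of F)"
  have G: "weighted_L2 s ?G" by (rule sobolev_ft(1)[OF dist_of_sobolev[OF F]])
  have "(sobolev_norm s (dist_of F))\<^sup>2 = (\<integral>\<omega>. weight 1 s \<omega> * (norm (?G \<omega>))\<^sup>2 \<partial>lborel)"
    unfolding sobolev_norm_def by (rule real_sqrt_pow2) (rule integral_nonneg_AE, simp)
  then have "ennreal ((sobolev_norm s (dist_of F))\<^sup>2) = wnorm2 s ?G"
    unfolding wnorm2_def using G unfolding weighted_L2_def by (subst nn_integral_eq_integral) auto
  also have "\<dots> = wnorm2 s F" by (rule wnorm2_cong[OF ft_dist_of(2)[OF F]])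
  finally show ?thesis .
qed

lemma sobolev_norm_nonneg: "sobolev_norm s u \<ge> 0"
  unfolding sobolev_norm_def by (intro real_sqrt_ge_zero integral_nonneg_AE) simp

lemma sobolev_norm_le_iff:
  fixes F :: "real^'d::finite \<Rightarrow> complex"
  assumes F: "weighted_L2 s F" and c: "c \<ge> 0"
  shows "sobolev_norm s (dist_of F) \<le> c \<longleftrightarrow> wnorm2 s F \<le> ennreal (c\<^sup>2)"
proof -
  have "sobolev_norm s (dist_of F) \<le> c \<longleftrightarrow> (sobolev_norm s (dist_of F))\<^sup>2 \<le> c\<^sup>2"
    by (rule power_mono_iff[OF sobolev_norm_nonneg c, symmetric]) simp
  then show ?thesis unfolding sobolev_normE[OF F, symmetric] by (simp add: ennreal_le_iff)
qed

lemma square_sum_le: "(a + b)\<^sup>2 \<le> 2 * a\<^sup>2 + 2 * b\<^sup>2" for a b :: real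
proof -
  have "0 \<le> (a - b)\<^sup>2" by simp
  then show ?thesis by (simp add: power2_sum power2_diff)
qed

lemma weighted_L2_lincomb:
  fixes F G :: "real^'d::finite \<Rightarrow> complex"
  assumes F: "weighted_L2 s F" and G: "weighted_L2 s G"
  shows "weighted_L2 s (\<lambda>\<omega>. a * F \<omega> + b * G \<omega>)"
  unfolding weighted_L2_def
proof
  have Fm[measurable]: "F \<in> borel_measurable borel" and Gm[measurable]: "G \<in> borel_measurable borel"
    using weighted_L2_measurable F G by blast+
  show "(\<lambda>\<omega>. a * F \<omega> + b * G \<omega>) \<in> borel_measurable borel" by measurable
  show "integrable lborel (\<lambda>\<omega>. weight 1 s \<omega> * (norm (a * F \<omega> + b * G \<omega>))\<^sup>2)"
  proof (rule Bochner_Integration.integrable_bound)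
    show "integrable lborel (\<lambda>\<omega>. 2 * (norm a)\<^sup>2 * (weight 1 s \<omega> * (norm (F \<omega>))\<^sup>2) + 2 * (norm b)\<^sup>2 * (weight 1 s \<omega> * (norm (G \<omega>))\<^sup>2))"
      using F G unfolding weighted_L2_def by (intro Bochner_Integration.integrable_add integrable_mult_right) blast+
    show "(\<lambda>\<omega>. weight 1 s \<omega> * (norm (a * F \<omega> + b * G \<omega>))\<^sup>2) \<in> borel_measurable lborel" by measurable
    show "AE \<omega> in lborel. norm (weight 1 s \<omega> * (norm (a * F \<omega> + b * G \<omega>))\<^sup>2)
      \<le> norm (2 * (norm a)\<^sup>2 * (weight 1 s \<omega> * (norm (F \<omega>))\<^sup>2) + 2 * (norm b)\<^sup>2 * (weight 1 s \<omega> * (norm (G \<omega>))\<^sup>2))"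
    proof (rule AE_I2)
      fix \<omega> :: "real^'d"
      let ?w = "weight 1 s \<omega>"
      have "(norm (a * F \<omega> + b * G \<omega>))\<^sup>2 \<le> (norm a * norm (F \<omega>) + norm b * norm (G \<omega>))\<^sup>2"
        using norm_triangle_ineq[of "a * F \<omega>" "b * G \<omega>"] by (intro power_mono) (simp_all add: norm_mult)
      also have "\<dots> \<le> 2 * (norm a * norm (F \<omega>))\<^sup>2 + 2 * (norm b * norm (G \<omega>))\<^sup>2"
        by (rule square_sum_le)
      finally have "?w * (norm (a * F \<omega> + b * G \<omega>))\<^sup>2 \<le> ?w * (2 * (norm a * norm (F \<omega>))\<^sup>2 + 2 * (norm b * norm (G \<omega>))\<^sup>2)"
        by (rule mult_left_mono) simp
      also have "\<dots> = 2 * (norm a)\<^sup>2 * (?w * (norm (F \<omega>))\<^sup>2) + 2 * (norm b)\<^sup>2 * (?w * (norm (G \<omega>))\<^sup>2)"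
        by (simp add: power_mult_distrib algebra_simps)
      finally show "norm (?w * (norm (a * F \<omega> + b * G \<omega>))\<^sup>2) \<le> norm (2 * (norm a)\<^sup>2 * (?w * (norm (F \<omega>))\<^sup>2) + 2 * (norm b)\<^sup>2 * (?w * (norm (G \<omega>))\<^sup>2))"
        unfolding real_norm_def by (subst abs_of_nonneg) (auto intro: order_trans[OF _ abs_ge_self])
    qed
  qed
qed

lemma dist_of_lincomb:
  fixes F G :: "real^'d::finite \<Rightarrow> complex"
  assumes F: "weighted_L2 s F" and G: "weighted_L2 s G"
  shows "(\<lambda>f. a * dist_of F f + b * dist_of G f) = dist_of (\<lambda>\<omega>. a * F \<omega> + b * G \<omega>)"
proof
  fix f
  have "(\<integral>\<omega>. (a * F \<omega> + b * G \<omega>) * fourier f (- \<omega>) \<partial>lborel) = a * (\<integral>\<omega>. F \<omega> * fourier f (- \<omega>) \<partial>lborel) + b * (\<integral>\<omega>. G \<omega> * fourier f (- \<omega>) \<partial>lborel)"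
    if f: "f \<in> schwartz_space"
  proof -
    have i: "integrable lborel (\<lambda>\<omega>. H \<omega> * fourier f (- \<omega>))" if "weighted_L2 s H" for H
      by (rule weighted_L2_schwartz[OF that schwartz_reflect[OF schwartz_fourier[OF f]]])
    have "(\<integral>\<omega>. (a * F \<omega> + b * G \<omega>) * fourier f (- \<omega>) \<partial>lborel) = (\<integral>\<omega>. a * (F \<omega> * fourier f (- \<omega>)) + b * (G \<omega> * fourier f (- \<omega>)) \<partial>lborel)"
      by (simp only: distrib_right mult.assoc)
    then show ?thesis
      by (simp only: Bochner_Integration.integral_add[OF integrable_mult_right[OF i[OF F]] integrable_mult_right[OF i[OF G]]] integral_mult_right_zero)
  qed
  then show "a * dist_of F f + b * dist_of G f = dist_of (\<lambda>\<omega>. a * F \<omega> + b * G \<omega>) f"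
    unfolding dist_of_def by (simp add: algebra_simps add_divide_distrib)
qed

lemma dist_diff_dist_of:
  fixes F G :: "real^'d::finite \<Rightarrow> complex"
  assumes F: "weighted_L2 s F" and G: "weighted_L2 s G"
  shows "dist_diff (dist_of F) (dist_of G) = dist_of (\<lambda>\<omega>. F \<omega> - G \<omega>)" "weighted_L2 s (\<lambda>\<omega>. F \<omega> - G \<omega>)"
  using dist_of_lincomb[OF F G, of 1 "-1"] weighted_L2_lincomb[OF F G, of 1 "-1"] unfolding dist_diff_def by simp_all

lemma dist_of_zero: "dist_of (\<lambda>\<omega>. 0) = (\<lambda>f. 0)" "weighted_L2 s (\<lambda>\<omega>. 0)"
  unfolding dist_of_def weighted_L2_def by auto

lemma weighted_L2_bounded_mult:
  fixes F :: "real^'d::finite \<Rightarrow> complex"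
  assumes F: "weighted_L2 s F" and m: "m \<in> borel_measurable borel" and K: "\<And>\<omega>. norm (m \<omega>) \<le> K"
  shows "weighted_L2 s (\<lambda>\<omega>. m \<omega> * F \<omega>)"
  unfolding weighted_L2_iff
proof
  have Fm[measurable]: "F \<in> borel_measurable borel" by (rule weighted_L2_measurable[OF F])
  show "(\<lambda>\<omega>. m \<omega> * F \<omega>) \<in> borel_measurable borel" using m by measurable
  have "wnorm2 s (\<lambda>\<omega>. m \<omega> * F \<omega>) \<le> (\<integral>\<^sup>+\<omega>. ennreal (K\<^sup>2) * ennreal (weight 1 s \<omega> * (norm (F \<omega>))\<^sup>2) \<partial>lborel)"
    unfolding wnorm2_def
  proof (rule nn_integral_mono)
    fix \<omega> :: "real^'d"
    have "(norm (m \<omega>))\<^sup>2 \<le> K\<^sup>2" by (rule power_mono[OF K norm_ge_zero])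
    then have "(norm (m \<omega>))\<^sup>2 * (weight 1 s \<omega> * (norm (F \<omega>))\<^sup>2) \<le> K\<^sup>2 * (weight 1 s \<omega> * (norm (F \<omega>))\<^sup>2)"
      by (rule mult_right_mono) simp
    then show "ennreal (weight 1 s \<omega> * (norm (m \<omega> * F \<omega>))\<^sup>2) \<le> ennreal (K\<^sup>2) * ennreal (weight 1 s \<omega> * (norm (F \<omega>))\<^sup>2)"
      by (simp add: ennreal_mult'[symmetric] norm_mult power_mult_distrib mult_ac ennreal_leI)
  qed
  also have "\<dots> = ennreal (K\<^sup>2) * wnorm2 s F" unfolding wnorm2_def by (rule nn_integral_cmult) measurable
  also have "\<dots> < \<infinity>" using weighted_L2_finite[OF F] by (simp add: ennreal_mult_less_top)
  finally show "wnorm2 s (\<lambda>\<omega>. m \<omega> * F \<omega>) < \<infinity>" .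
qed

lemma wnorm2_mono: "s \<le> k \<Longrightarrow> wnorm2 s F \<le> wnorm2 k F"
  unfolding wnorm2_def
  by (intro nn_integral_mono ennreal_leI mult_right_mono powr_mono) auto

lemma weighted_L2_mono: "weighted_L2 k F \<Longrightarrow> s \<le> k \<Longrightarrow> weighted_L2 s F"
  unfolding weighted_L2_iff using wnorm2_mono[of s k F] by (auto intro: order_le_less_trans)

lemma dist_translate_dist_of:
  fixes F :: "real^'d::finite \<Rightarrow> complex"
  shows "dist_translate a (dist_of F) = dist_of (\<lambda>\<omega>. cis (- a \<bullet> \<omega>) * F \<omega>)"
proof
  fix f :: "real^'d \<Rightarrow> complex"
  have S: "(\<lambda>x. f (x + a)) \<in> schwartz_space \<longleftrightarrow> f \<in> schwartz_space"
  proof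
    assume "(\<lambda>x. f (x + a)) \<in> schwartz_space"
    from schwartz_affine[OF this, of 1 "-a"] show "f \<in> schwartz_space" by simp
  next
    assume "f \<in> schwartz_space"
    from schwartz_affine[OF this, of 1 "a"] show "(\<lambda>x. f (x + a)) \<in> schwartz_space" by (simp add: add.commute)
  qed
  have "F \<omega> * fourier (\<lambda>x. f (x + a)) (- \<omega>) = cis (- a \<bullet> \<omega>) * F \<omega> * fourier f (- \<omega>)" if f: "f \<in> schwartz_space" for \<omega>
  proof -
    have m: "(\<lambda>x. f x * cis (- (- \<omega> \<bullet> x))) \<in> borel_measurable borel" using schwartz_measurable[OF f] by measurable
    have "fourier f (- \<omega>) = (\<integral>x. f (a + 1 *\<^sub>R x) * cis (- (- \<omega> \<bullet> (a + 1 *\<^sub>R x))) \<partial>lborel)"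
      unfolding fourier_cis using integral_affine[OF m, of 1 a] by simp
    also have "\<dots> = (\<integral>x. cis (a \<bullet> \<omega>) * (f (x + a) * cis (- (- \<omega> \<bullet> x))) \<partial>lborel)"
    proof (rule arg_cong[where f="integral\<^sup>L lborel"], rule ext)
      fix x
      have "cis (- (- \<omega> \<bullet> (a + 1 *\<^sub>R x))) = cis (a \<bullet> \<omega>) * cis (- (- \<omega> \<bullet> x))"
        unfolding cis_mult by (rule arg_cong[where f=cis]) (simp add: inner_add_right inner_commute)
      then show "f (a + 1 *\<^sub>R x) * cis (- (- \<omega> \<bullet> (a + 1 *\<^sub>R x))) = cis (a \<bullet> \<omega>) * (f (x + a) * cis (- (- \<omega> \<bullet> x)))"
        by (simp only: scaleR_one add.commute mult.left_commute)
    qed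
    also have "\<dots> = cis (a \<bullet> \<omega>) * fourier (\<lambda>x. f (x + a)) (- \<omega>)" unfolding fourier_cis by (rule integral_mult_right_zero)
    finally have "cis (- a \<bullet> \<omega>) * fourier f (- \<omega>) = (cis (- a \<bullet> \<omega>) * cis (a \<bullet> \<omega>)) * fourier (\<lambda>x. f (x + a)) (- \<omega>)"
      by (simp only: mult.assoc)
    also have "cis (- a \<bullet> \<omega>) * cis (a \<bullet> \<omega>) = 1" by (simp add: cis_mult)
    finally show ?thesis by (simp only: mult_1 mult.assoc mult.left_commute)
  qed
  then have "(\<integral>\<omega>. F \<omega> * fourier (\<lambda>x. f (x + a)) (- \<omega>) \<partial>lborel) = (\<integral>\<omega>. cis (- a \<bullet> \<omega>) * F \<omega> * fourier f (- \<omega>) \<partial>lborel)"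
    if "f \<in> schwartz_space" using that by (simp only:)
  then show "dist_translate a (dist_of F) f = dist_of (\<lambda>\<omega>. cis (- a \<bullet> \<omega>) * F \<omega>) f"
    unfolding dist_translate_def dist_of_def S by (cases "f \<in> schwartz_space") (simp_all only: if_True if_False)
qed

lemma dist_dilate_dist_of:
  fixes F :: "real^'d::finite \<Rightarrow> complex"
  assumes h: "h > 0" and F: "F \<in> borel_measurable borel"
  shows "dist_dilate h (dist_of F) = dist_of (\<lambda>\<omega>. of_real (h ^ CARD('d)) * F (h *\<^sub>R \<omega>))"
proof
  fix f :: "real^'d \<Rightarrow> complex"
  have h0: "h \<noteq> 0" using h by simp
  have S: "(\<lambda>x. f (h *\<^sub>R x)) \<in> schwartz_space \<longleftrightarrow> f \<in> schwartz_space"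
  proof
    assume "(\<lambda>x. f (h *\<^sub>R x)) \<in> schwartz_space"
    from schwartz_affine[OF this, of "1 / h" 0] show "f \<in> schwartz_space" using h0 by simp
  next
    assume "f \<in> schwartz_space"
    from schwartz_affine[OF this h0, of 0] show "(\<lambda>x. f (h *\<^sub>R x)) \<in> schwartz_space" by simp
  qed
  have "of_real (h ^ CARD('d)) * (\<integral>\<omega>. F \<omega> * fourier (\<lambda>x. f (h *\<^sub>R x)) (- \<omega>) \<partial>lborel)
      = (\<integral>\<omega>. of_real (h ^ CARD('d)) * F (h *\<^sub>R \<omega>) * fourier f (- \<omega>) \<partial>lborel)" if f: "f \<in> schwartz_space"
  proof -
    have fh: "(\<lambda>x. f (h *\<^sub>R x)) \<in> schwartz_space" using S f by simp
    have 1: "fourier f (- \<omega>) = of_real (h ^ CARD('d)) * fourier (\<lambda>x. f (h *\<^sub>R x)) (- (h *\<^sub>R \<omega>))" for \<omega>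
    proof -
      have m: "(\<lambda>x. f x * cis (- (- \<omega> \<bullet> x))) \<in> borel_measurable borel" using schwartz_measurable[OF f] by measurable
      have e: "- \<omega> \<bullet> (0 + h *\<^sub>R x) = - (h *\<^sub>R \<omega>) \<bullet> x" for x by simp
      from integral_affine[OF m h0, of 0] show ?thesis
        unfolding fourier_cis e abs_of_pos[OF h] by (simp only: scaleR_conv_of_real add_0)
    qed
    have m: "(\<lambda>\<omega>. F \<omega> * fourier (\<lambda>x. f (h *\<^sub>R x)) (- \<omega>)) \<in> borel_measurable borel"
      by (intro borel_measurable_times F schwartz_measurable schwartz_reflect schwartz_fourier fh)
    have "of_real (h ^ CARD('d)) * (\<integral>\<omega>. F \<omega> * fourier (\<lambda>x. f (h *\<^sub>R x)) (- \<omega>) \<partial>lborel)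
       = of_real (h ^ CARD('d)) * (of_real (h ^ CARD('d)) * (\<integral>\<omega>. F (h *\<^sub>R \<omega>) * fourier (\<lambda>x. f (h *\<^sub>R x)) (- (h *\<^sub>R \<omega>)) \<partial>lborel))"
      using integral_affine[OF m h0, of 0] unfolding abs_of_pos[OF h] by (simp only: scaleR_conv_of_real add_0)
    also have "\<dots> = (\<integral>\<omega>. of_real (h ^ CARD('d)) * (of_real (h ^ CARD('d)) * (F (h *\<^sub>R \<omega>) * fourier (\<lambda>x. f (h *\<^sub>R x)) (- (h *\<^sub>R \<omega>)))) \<partial>lborel)"
      by (simp only: integral_mult_right_zero)
    also have "\<dots> = (\<integral>\<omega>. of_real (h ^ CARD('d)) * F (h *\<^sub>R \<omega>) * fourier f (- \<omega>) \<partial>lborel)"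
      by (rule arg_cong[where f="integral\<^sup>L lborel"]) (rule ext, simp only: 1 mult.assoc mult.left_commute)
    finally show ?thesis .
  qed
  then show "dist_dilate h (dist_of F) f = dist_of (\<lambda>\<omega>. of_real (h ^ CARD('d)) * F (h *\<^sub>R \<omega>)) f"
    unfolding dist_dilate_def dist_of_def S by (cases "f \<in> schwartz_space") (simp_all only: if_True if_False mult.left_commute mult_zero_right)
qed

section \<open>Aliasing bounds\<close>

lemma countable_int_lattice: "countable (int_lattice :: (real^'d::finite) set)"
proof -
  have "int_lattice \<subseteq> range (\<lambda>f::'d \<Rightarrow> int. (\<chi> j. of_int (f j)) :: real^'d)"
  proof
    fix a :: "real^'d" assume "a \<in> int_lattice"
    then have "\<forall>j. \<exists>n::int. a $ j = of_int n" unfolding int_lattice_def by (auto elim: Ints_cases)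
    then obtain f :: "'d \<Rightarrow> int" where "\<And>j. a $ j = of_int (f j)" by metis
    then have "a = (\<chi> j. of_int (f j))" by (simp add: vec_eq_iff)
    then show "a \<in> range (\<lambda>f::'d \<Rightarrow> int. (\<chi> j. of_int (f j)) :: real^'d)" by blast
  qed
  then show ?thesis by (rule countable_subset) simp
qed

lemma countable_dual_lattice: "countable (dual_lattice :: (real^'d::finite) set)"
  unfolding dual_lattice_def by (intro countable_image countable_int_lattice)

lemma dual_lattice_zero: "0 \<in> dual_lattice"
  unfolding dual_lattice_iff by (auto intro!: exI[of _ 0])

lemma dual_lattice_diff: "a \<in> dual_lattice \<Longrightarrow> b \<in> dual_lattice \<Longrightarrow> a - b \<in> dual_lattice"
  for a b :: "real^'d::finite"
  unfolding dual_lattice_iff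
proof
  fix j
  assume "\<forall>j. \<exists>n::int. a $ j = 2 * pi * of_int n" "\<forall>j. \<exists>n::int. b $ j = 2 * pi * of_int n"
  then obtain m n :: int where "a $ j = 2 * pi * of_int m" "b $ j = 2 * pi * of_int n" by metis
  then have "(a - b) $ j = 2 * pi * of_int (m - n)" by (simp add: algebra_simps)
  then show "\<exists>n::int. (a - b) $ j = 2 * pi * of_int n" by blast
qed

lemma dual_lattice_norm:
  assumes a: "a \<in> dual_lattice" and "a \<noteq> 0"
  shows "norm a \<ge> 6"
proof -
  obtain j where j: "a $ j \<noteq> 0" using assms(2) by (auto simp: vec_eq_iff)
  obtain n :: int where n: "a $ j = 2 * pi * of_int n" using a unfolding dual_lattice_iff by blast
  have "n \<noteq> 0" using j n by auto
  then have "1 \<le> \<bar>real_of_int n\<bar>" by linarith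
  then have "2 * pi * 1 \<le> 2 * pi * \<bar>real_of_int n\<bar>" by (intro mult_left_mono) auto
  also have "\<dots> = \<bar>a $ j\<bar>" using n by (simp add: abs_mult)
  also have "\<dots> \<le> norm a" by (rule component_le_norm_cart)
  finally show ?thesis using pi_gt3 by linarith
qed

text \<open>An enumeration of the nonzero points of the dual lattice: the frequencies that are added under
  aliasing. It turns brackets into ordinary series.\<close>

definition alias_freq :: "nat \<Rightarrow> real^'d::finite" where
  "alias_freq = from_nat_into (dual_lattice - {0})"

lemma infinite_dual_lattice: "infinite (dual_lattice - {0 :: real^'d::finite})"
proof -
  fix j :: 'd
  let ?f = "\<lambda>n::nat. (2 * pi * real (Suc n)) *\<^sub>R (axis j 1 :: real^'d)"
  have "inj ?f"
  proof (rule injI)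
    fix m n assume "?f m = ?f n"
    then have "?f m $ j = ?f n $ j" by simp
    then show "m = n" by (simp add: axis_def)
  qed
  then have "infinite (range ?f)" by (rule range_inj_infinite)
  moreover have "range ?f \<subseteq> dual_lattice - {0}"
  proof
    fix x assume "x \<in> range ?f"
    then obtain n where x: "x = ?f n" by blast
    have "x $ i = 2 * pi * of_int (if i = j then int (Suc n) else 0)" for i
      unfolding x by (simp add: axis_def)
    then have "x \<in> dual_lattice" unfolding dual_lattice_iff by blast
    moreover have "x $ j \<noteq> 0" unfolding x by (simp add: axis_def)
    then have "x \<noteq> 0" by auto
    ultimately show "x \<in> dual_lattice - {0}" by blast
  qed
  ultimately show "infinite (dual_lattice - {0 :: real^'d})" using infinite_super by blast
qed

lemma bij_alias: "bij_betw alias_freq UNIV (dual_lattice - {0 :: real^'d::finite})"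
  unfolding alias_freq_def
  by (rule bij_betw_from_nat_into) (rule countable_subset[OF Diff_subset countable_dual_lattice], rule infinite_dual_lattice)

lemma alias_mem: "alias_freq n \<in> dual_lattice" "alias_freq n \<noteq> (0 :: real^'d::finite)"
  using bij_betwE[OF bij_alias] by blast+

lemma alias_inj: "alias_freq m = (alias_freq n :: real^'d::finite) \<Longrightarrow> m = n"
  using bij_betw_imp_inj_on[OF bij_alias] unfolding inj_on_def by blast

lemma alias_surj: "a \<in> dual_lattice \<Longrightarrow> a \<noteq> 0 \<Longrightarrow> \<exists>n. a = alias_freq n"
  using bij_betw_imp_surj_on[OF bij_alias] by blast

lemma infsum_nat_ennreal: "infsum f UNIV = (\<Sum>n. f n)" for f :: "nat \<Rightarrow> ennreal"
proof -
  have "f summable_on UNIV" by (rule nonneg_summable_on_complete) simp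
  then have "f sums infsum f UNIV" by (intro has_sum_imp_sums has_sum_infsum)
  then show ?thesis by (simp add: sums_iff)
qed

definition alias_sum :: "real \<Rightarrow> (real^'d::finite \<Rightarrow> complex) \<Rightarrow> real^'d \<Rightarrow> ennreal" where
  "alias_sum s F \<omega> = (\<Sum>n. ennreal ((norm (F (\<omega> + alias_freq n)))\<^sup>2 * norm (\<omega> + alias_freq n) powr (2 * s)))"

lemma bracket_alias: "bracket (dual_lattice - {0}) s F \<omega> = alias_sum s F \<omega>"
  unfolding bracket_def alias_sum_def
  using infsum_reindex_bij_betw[OF bij_alias, of "\<lambda>\<alpha>. ennreal ((norm (F (\<omega> + \<alpha>)))\<^sup>2 * norm (\<omega> + \<alpha>) powr (2 * s))"]
    infsum_nat_ennreal[of "\<lambda>n. ennreal ((norm (F (\<omega> + alias_freq n)))\<^sup>2 * norm (\<omega> + alias_freq n) powr (2 * s))"]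
  by simp

lemma bracket_full: "bracket dual_lattice s F \<omega> = ennreal ((norm (F \<omega>))\<^sup>2 * norm \<omega> powr (2 * s)) + alias_sum s F \<omega>"
proof -
  let ?f = "\<lambda>\<alpha>. ennreal ((norm (F (\<omega> + \<alpha>)))\<^sup>2 * norm (\<omega> + \<alpha>) powr (2 * s))"
  have e: "dual_lattice = insert (0 :: real^'d) (dual_lattice - {0})" using dual_lattice_zero by blast
  have "infsum ?f (insert 0 (dual_lattice - {0})) = ?f 0 + infsum ?f (dual_lattice - {0})"
    by (rule infsum_insert) (auto intro: nonneg_summable_on_complete)
  then show ?thesis
    unfolding bracket_alias[symmetric] bracket_def e[symmetric] by simp
qed

lemma alias_sum_measurable[measurable]:
  assumes [measurable]: "F \<in> borel_measurable borel"
  shows "alias_sum s F \<in> borel_measurable borel"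
  unfolding alias_sum_def by measurable

lemma AE_alias:
  assumes "AE \<omega> in lborel. P (\<omega> :: real^'d::finite)"
  shows "AE \<omega> in lborel. \<forall>n. P (\<omega> + alias_freq n)"
  unfolding AE_all_countable
proof
  fix n
  from AE_affine[OF assms, of 1 "alias_freq n"] show "AE \<omega> in lborel. P (\<omega> + alias_freq n)"
    by (simp add: add.commute)
qed

lemma alias_norm:
  fixes \<omega> :: "real^'a::finite"
  assumes "norm \<omega> < 1"
  shows "5 \<le> norm (\<omega> + alias_freq n)"
proof -
  have "6 \<le> norm (alias_freq n :: real^'a)" by (rule dual_lattice_norm[OF alias_mem])
  then have "5 \<le> norm (alias_freq n :: real^'a) - norm \<omega>" using assms by linarith
  also have "\<dots> \<le> norm (alias_freq n + \<omega>)" by (rule norm_diff_ineq)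
  finally show ?thesis by (simp only: add.commute)
qed

text \<open>The common form of all approximation orders \<open>k > s\<close>. Since the term of the full bracket at the origin
  is \<open>|F(\<omega>)|\<^sup>2 |\<omega>| powr (2s)\<close>, the bound says that the aliases are smaller than it by a factor
  \<open>|\<omega>| powr (2k - 2s)\<close>.\<close>

definition alias_bound :: "real \<Rightarrow> real \<Rightarrow> (real^'d::finite \<Rightarrow> complex) \<Rightarrow> bool" where
  "alias_bound s k F \<longleftrightarrow> (\<exists>r C. 0 < r \<and> r \<le> 1 \<and> 0 \<le> C \<and>
     (AE \<omega> in lborel. norm \<omega> < r \<longrightarrow> F \<omega> \<noteq> 0 \<and>
        alias_sum s F \<omega> \<le> ennreal (C * norm \<omega> powr (2 * k) * (norm (F \<omega>))\<^sup>2)))"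

lemma small_power:
  fixes p C :: real
  assumes "p > 0" "C > 0"
  obtains r where "r > 0" "\<And>t. 0 \<le> t \<Longrightarrow> t < r \<Longrightarrow> t powr p \<le> C"
proof
  show "C powr (1 / p) > 0" using assms by simp
  show "t powr p \<le> C" if "0 \<le> t" "t < C powr (1 / p)" for t
  proof -
    have "t powr p \<le> (C powr (1 / p)) powr p" using that assms by (intro powr_mono2) auto
    then show ?thesis using assms by (simp add: powr_powr)
  qed
qed

lemma ennreal_div_mult: "b \<ge> 0 \<Longrightarrow> T > 0 \<Longrightarrow> q \<ge> 0 \<Longrightarrow> ennreal b / ennreal T * ennreal q = ennreal (b / T * q)"
  by (simp only: divide_ennreal) (rule ennreal_mult[symmetric], auto)

text \<open>The full bracket is at least its term at the origin, so the quotient is at most the relative size of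
  the aliases.\<close>

lemma alias_bound_imp_order:
  fixes \<phi> :: "'d::finite functional"
  assumes "alias_bound s k (ft_fun \<phi>)"
  shows "approx_order_nonpos s \<phi> k"
proof -
  let ?F = "ft_fun \<phi>"
  obtain r C where r: "0 < r" and C: "0 \<le> C"
    and ae: "AE \<omega> in lborel. norm \<omega> < r \<longrightarrow> ?F \<omega> \<noteq> 0 \<and> alias_sum s ?F \<omega> \<le> ennreal (C * norm \<omega> powr (2 * k) * (norm (?F \<omega>))\<^sup>2)"
    using assms unfolding alias_bound_def by blast
  have "AE \<omega> in lborel. \<omega> \<in> ball 0 r \<longrightarrow>
     0 < bracket dual_lattice s ?F \<omega> \<and> bracket dual_lattice s ?F \<omega> < \<infinity> \<and>
     bracket (dual_lattice - {0}) s ?F \<omega> / bracket dual_lattice s ?F \<omega>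
       * ennreal (1 / norm \<omega> powr (2 * k - 2 * s)) \<le> ennreal C"
    using ae AE_lborel_singleton[of 0]
  proof eventually_elim
    case (elim \<omega>)
    show ?case
    proof
      assume "\<omega> \<in> ball 0 r"
      then have w: "norm \<omega> < r" by simp
      let ?a = "(norm (?F \<omega>))\<^sup>2 * norm \<omega> powr (2 * s)"
      have n: "norm \<omega> > 0" using elim(2) by simp
      have F: "norm (?F \<omega>) > 0" and B: "alias_sum s ?F \<omega> \<le> ennreal (C * norm \<omega> powr (2 * k) * (norm (?F \<omega>))\<^sup>2)"
        using elim(1) w by auto
      have a: "?a > 0" using n F by simp
      obtain b where b: "alias_sum s ?F \<omega> = ennreal b" "b \<ge> 0" "b \<le> C * norm \<omega> powr (2 * k) * (norm (?F \<omega>))\<^sup>2"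
      proof -
        have "alias_sum s ?F \<omega> < top" using B by (rule order_le_less_trans) simp
        then obtain b where "b \<ge> 0" "alias_sum s ?F \<omega> = ennreal b" by (cases "alias_sum s ?F \<omega>") auto
        moreover have "b \<le> C * norm \<omega> powr (2 * k) * (norm (?F \<omega>))\<^sup>2"
          using B C unfolding \<open>alias_sum s ?F \<omega> = ennreal b\<close> by (subst (asm) ennreal_le_iff) auto
        ultimately show ?thesis using that by blast
      qed
      have full: "bracket dual_lattice s ?F \<omega> = ennreal (?a + b)"
        unfolding bracket_full b(1) using a b(2) by (intro ennreal_plus[symmetric]) auto
      have p: "norm \<omega> powr (2 * k - 2 * s) > 0" using n by simp
      have "b / (?a + b) * (1 / norm \<omega> powr (2 * k - 2 * s)) \<le> C"
      proof -
        have "norm \<omega> powr (2 * k) = norm \<omega> powr (2 * k - 2 * s) * norm \<omega> powr (2 * s)"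
          by (simp add: powr_add[symmetric])
        then have "b \<le> C * norm \<omega> powr (2 * k - 2 * s) * ?a" using b(3) by (simp only: mult_ac)
        also have "\<dots> \<le> C * norm \<omega> powr (2 * k - 2 * s) * (?a + b)"
          using C p b(2) by (intro mult_left_mono) auto
        finally have "b / (?a + b) \<le> C * norm \<omega> powr (2 * k - 2 * s)"
          by (simp only: pos_divide_le_eq[OF add_pos_nonneg[OF a b(2)]])
        then show ?thesis by (simp only: times_divide_eq_right mult_1_right pos_divide_le_eq[OF p])
      qed
      then have "ennreal (b / (?a + b) * (1 / norm \<omega> powr (2 * k - 2 * s))) \<le> ennreal C" by (rule ennreal_leI)
      moreover have "ennreal b / ennreal (?a + b) * ennreal (1 / norm \<omega> powr (2 * k - 2 * s)) = ennreal (b / (?a + b) * (1 / norm \<omega> powr (2 * k - 2 * s)))"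
        by (rule ennreal_div_mult[OF b(2) add_pos_nonneg[OF a b(2)]]) (use p in simp)
      ultimately show "0 < bracket dual_lattice s ?F \<omega> \<and> bracket dual_lattice s ?F \<omega> < \<infinity> \<and>
         bracket (dual_lattice - {0}) s ?F \<omega> / bracket dual_lattice s ?F \<omega>
         * ennreal (1 / norm \<omega> powr (2 * k - 2 * s)) \<le> ennreal C"
        unfolding full bracket_alias b(1) using a b(2) by (simp del: ennreal_plus add: add_pos_nonneg)
    qed
  qed
  then show ?thesis unfolding approx_order_nonpos_def
    by (intro exI[of _ "ball 0 r"] conjI exI[of _ C]) (use r in auto)
qed

text \<open>Near the origin the quotient is at most 1/2, so the aliases make up at most half of the full bracket
  and the term at the origin makes up at least the other half. Positivity of the full bracket then gives
  \<open>F \<noteq> 0\<close>.\<close>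

lemma order_imp_alias_bound:
  fixes \<phi> :: "'d::finite functional"
  assumes "approx_order_nonpos s \<phi> k" and "k > s"
  shows "alias_bound s k (ft_fun \<phi>)"
proof -
  let ?F = "ft_fun \<phi>"
  let ?p = "2 * k - 2 * s"
  obtain \<Omega> C0 where \<Omega>: "open \<Omega>" "0 \<in> \<Omega>" and ae: "AE \<omega> in lborel. \<omega> \<in> \<Omega> \<longrightarrow>
     0 < bracket dual_lattice s ?F \<omega> \<and> bracket dual_lattice s ?F \<omega> < \<infinity> \<and>
     bracket (dual_lattice - {0}) s ?F \<omega> / bracket dual_lattice s ?F \<omega>
       * ennreal (1 / norm \<omega> powr ?p) \<le> ennreal C0"
    using assms(1) unfolding approx_order_nonpos_def by blast
  define C where "C = max 1 C0"
  have C1: "C \<ge> 1" "C0 \<le> C" unfolding C_def by auto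
  obtain r0 where r0: "r0 > 0" "ball 0 r0 \<subseteq> \<Omega>" using \<Omega> by (rule openE)
  obtain r1 where r1: "r1 > 0" "\<And>t. 0 \<le> t \<Longrightarrow> t < r1 \<Longrightarrow> t powr ?p \<le> 1 / (2 * C)"
    by (rule small_power[of ?p "1 / (2 * C)"]) (use assms(2) C1 in auto)
  (* The bound by r1 makes the quotient at most 1/2, the bound by r0 stays in the neighbourhood. *)
  define r where "r = min 1 (min r0 r1)"
  have r: "0 < r" "r \<le> 1" "r \<le> r0" "r \<le> r1" unfolding r_def using r0 r1 by auto
  have "AE \<omega> in lborel. norm \<omega> < r \<longrightarrow> ?F \<omega> \<noteq> 0 \<and>
        alias_sum s ?F \<omega> \<le> ennreal (2 * C * norm \<omega> powr (2 * k) * (norm (?F \<omega>))\<^sup>2)"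
    using ae AE_lborel_singleton[of 0]
  proof eventually_elim
    case (elim \<omega>)
    show ?case
    proof
      assume w: "norm \<omega> < r"
      let ?a = "(norm (?F \<omega>))\<^sup>2 * norm \<omega> powr (2 * s)"
      have n: "norm \<omega> > 0" using elim(2) by simp
      have "\<omega> \<in> \<Omega>" using r0(2) r(3) w by auto
      with elim(1) have T: "0 < bracket dual_lattice s ?F \<omega>" "bracket dual_lattice s ?F \<omega> < \<infinity>"
        and q: "bracket (dual_lattice - {0}) s ?F \<omega> / bracket dual_lattice s ?F \<omega> * ennreal (1 / norm \<omega> powr ?p) \<le> ennreal C0"
        by auto
      have a: "?a \<ge> 0" by simp
      have "alias_sum s ?F \<omega> < top" using T(2) unfolding bracket_full by simp
      then obtain b where b: "b \<ge> 0" "alias_sum s ?F \<omega> = ennreal b" by (cases "alias_sum s ?F \<omega>") auto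
      have full: "bracket dual_lattice s ?F \<omega> = ennreal (?a + b)"
        unfolding bracket_full b(2) using a b(1) by (intro ennreal_plus[symmetric])
      have ab: "?a + b > 0" using T(1) unfolding full by simp
      have p: "norm \<omega> powr ?p > 0" using n by simp
      have "ennreal (b / (?a + b) * (1 / norm \<omega> powr ?p)) = ennreal b / ennreal (?a + b) * ennreal (1 / norm \<omega> powr ?p)"
        by (rule ennreal_div_mult[OF b(1) ab, symmetric]) (use p in simp)
      also have "\<dots> \<le> ennreal C" using q order_trans[OF _ ennreal_leI[OF C1(2)]] unfolding full bracket_alias b(2) by blast
      finally have "b / (?a + b) * (1 / norm \<omega> powr ?p) \<le> C" using C1 by (subst (asm) ennreal_le_iff) auto
      then have "b / (?a + b) \<le> C * norm \<omega> powr ?p" by (simp only: times_divide_eq_right mult_1_right pos_divide_le_eq[OF p])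
      then have b1: "b \<le> C * norm \<omega> powr ?p * (?a + b)" by (simp only: pos_divide_le_eq[OF ab])
      have "norm \<omega> powr ?p \<le> 1 / (2 * C)" using r1(2)[of "norm \<omega>"] w r(4) by simp
      then have "C * norm \<omega> powr ?p \<le> C * (1 / (2 * C))" using C1 by (intro mult_left_mono) auto
      also have "\<dots> = 1 / 2" using C1 by simp
      finally have "C * norm \<omega> powr ?p * (?a + b) \<le> 1 / 2 * (?a + b)" using ab by (intro mult_right_mono) auto
      with b1 have ba: "b \<le> ?a" by simp
      have "C * norm \<omega> powr ?p * (?a + b) \<le> C * norm \<omega> powr ?p * (2 * ?a)"
        using C1 p ba by (intro mult_left_mono) auto
      with b1 have "b \<le> C * norm \<omega> powr ?p * (2 * ?a)" by (rule order_trans)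
      also have "\<dots> = 2 * C * (norm \<omega> powr ?p * norm \<omega> powr (2 * s)) * (norm (?F \<omega>))\<^sup>2" by (simp only: mult_ac)
      also have "norm \<omega> powr ?p * norm \<omega> powr (2 * s) = norm \<omega> powr (2 * k)" by (simp add: powr_add[symmetric])
      finally have "alias_sum s ?F \<omega> \<le> ennreal (2 * C * norm \<omega> powr (2 * k) * (norm (?F \<omega>))\<^sup>2)"
        unfolding b(2) by (rule ennreal_leI)
      moreover have "?F \<omega> \<noteq> 0"
      proof
        assume "?F \<omega> = 0"
        then have "?a = 0" by simp
        with ba b(1) ab show False by linarith
      qed
      ultimately show "?F \<omega> \<noteq> 0 \<and> alias_sum s ?F \<omega> \<le> ennreal (2 * C * norm \<omega> powr (2 * k) * (norm (?F \<omega>))\<^sup>2)" by blast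
    qed
  qed
  then show ?thesis unfolding alias_bound_def
    by (intro exI[of _ r] exI[of _ "2 * C"] conjI) (use r C1 in auto)
qed

lemma suminf_mult_le:
  fixes f g :: "nat \<Rightarrow> ennreal"
  shows "(\<Sum>n. f n * g n) \<le> (\<Sum>n. f n) * (\<Sum>n. g n)"
proof -
  have "g n \<le> (\<Sum>n. g n)" for n using sum_le_suminf[of g "{n}"] by simp
  then have "(\<Sum>n. f n * g n) \<le> (\<Sum>n. f n * (\<Sum>n. g n))"
    by (intro suminf_le mult_left_mono) auto
  also have "\<dots> = (\<Sum>n. f n) * (\<Sum>n. g n)" by simp
  finally show ?thesis .
qed

text \<open>The aliasing terms of a product are products of aliasing terms, and the sum over the diagonal of a
  product of nonnegative series is at most the product of the series.\<close>

lemma alias_bound_mult: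
  fixes F G :: "real^'d::finite \<Rightarrow> complex"
  assumes "alias_bound s\<^sub>1 k\<^sub>1 F" "alias_bound s\<^sub>2 k\<^sub>2 G"
  shows "alias_bound (s\<^sub>1 + s\<^sub>2) (k\<^sub>1 + k\<^sub>2) (\<lambda>\<omega>. F \<omega> * G \<omega>)"
proof -
  obtain r C where r: "0 < r" "r \<le> 1" "0 \<le> C" and F: "AE \<omega> in lborel. norm \<omega> < r \<longrightarrow> F \<omega> \<noteq> 0 \<and> alias_sum s\<^sub>1 F \<omega> \<le> ennreal (C * norm \<omega> powr (2 * k\<^sub>1) * (norm (F \<omega>))\<^sup>2)"
    using assms(1) unfolding alias_bound_def by blast
  obtain r' D where r': "0 < r'" "0 \<le> D" and G: "AE \<omega> in lborel. norm \<omega> < r' \<longrightarrow> G \<omega> \<noteq> 0 \<and> alias_sum s\<^sub>2 G \<omega> \<le> ennreal (D * norm \<omega> powr (2 * k\<^sub>2) * (norm (G \<omega>))\<^sup>2)"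
    using assms(2) unfolding alias_bound_def by blast
  have prod: "alias_sum (s\<^sub>1 + s\<^sub>2) (\<lambda>\<omega>. F \<omega> * G \<omega>) \<omega> \<le> alias_sum s\<^sub>1 F \<omega> * alias_sum s\<^sub>2 G \<omega>" for \<omega>
  proof -
    have "ennreal ((norm (F x * G x))\<^sup>2 * norm x powr (2 * (s\<^sub>1 + s\<^sub>2)))
        = ennreal ((norm (F x))\<^sup>2 * norm x powr (2 * s\<^sub>1)) * ennreal ((norm (G x))\<^sup>2 * norm x powr (2 * s\<^sub>2))" for x
      by (simp add: ennreal_mult'[symmetric] norm_mult power_mult_distrib powr_add distrib_left mult_ac)
    then show ?thesis unfolding alias_sum_def by (simp only: suminf_mult_le)
  qed
  have "AE \<omega> in lborel. norm \<omega> < min r r' \<longrightarrow> F \<omega> * G \<omega> \<noteq> 0 \<and>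
      alias_sum (s\<^sub>1 + s\<^sub>2) (\<lambda>\<omega>. F \<omega> * G \<omega>) \<omega> \<le> ennreal ((C * D) * norm \<omega> powr (2 * (k\<^sub>1 + k\<^sub>2)) * (norm (F \<omega> * G \<omega>))\<^sup>2)"
    using F G
  proof eventually_elim
    case (elim \<omega>)
    show ?case
    proof
      assume w: "norm \<omega> < min r r'"
      then have f: "F \<omega> \<noteq> 0" "alias_sum s\<^sub>1 F \<omega> \<le> ennreal (C * norm \<omega> powr (2 * k\<^sub>1) * (norm (F \<omega>))\<^sup>2)"
        and g: "G \<omega> \<noteq> 0" "alias_sum s\<^sub>2 G \<omega> \<le> ennreal (D * norm \<omega> powr (2 * k\<^sub>2) * (norm (G \<omega>))\<^sup>2)"
        using elim by auto
      have "alias_sum s\<^sub>1 F \<omega> * alias_sum s\<^sub>2 G \<omega> \<le> ennreal (C * norm \<omega> powr (2 * k\<^sub>1) * (norm (F \<omega>))\<^sup>2) * ennreal (D * norm \<omega> powr (2 * k\<^sub>2) * (norm (G \<omega>))\<^sup>2)"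
        by (intro mult_mono f g) auto
      also have "\<dots> = ennreal ((C * norm \<omega> powr (2 * k\<^sub>1) * (norm (F \<omega>))\<^sup>2) * (D * norm \<omega> powr (2 * k\<^sub>2) * (norm (G \<omega>))\<^sup>2))"
        using r(3) r'(2) by (intro ennreal_mult[symmetric]) auto
      also have "(C * norm \<omega> powr (2 * k\<^sub>1) * (norm (F \<omega>))\<^sup>2) * (D * norm \<omega> powr (2 * k\<^sub>2) * (norm (G \<omega>))\<^sup>2) = (C * D) * norm \<omega> powr (2 * (k\<^sub>1 + k\<^sub>2)) * (norm (F \<omega> * G \<omega>))\<^sup>2"
        by (simp add: norm_mult power_mult_distrib powr_add distrib_left mult_ac)
      finally show "F \<omega> * G \<omega> \<noteq> 0 \<and> alias_sum (s\<^sub>1 + s\<^sub>2) (\<lambda>\<omega>. F \<omega> * G \<omega>) \<omega> \<le> ennreal ((C * D) * norm \<omega> powr (2 * (k\<^sub>1 + k\<^sub>2)) * (norm (F \<omega> * G \<omega>))\<^sup>2)"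
        using f(1) g(1) prod[of \<omega>] by (auto intro: order_trans)
    qed
  qed
  then show ?thesis unfolding alias_bound_def
    by (intro exI[of _ "min r r'"] exI[of _ "C * D"] conjI) (use r r' in auto)
qed

lemma alias_bound_cong:
  fixes F G :: "real^'d::finite \<Rightarrow> complex"
  assumes ae: "AE \<omega> in lborel. F \<omega> = G \<omega>" and F: "alias_bound s k F"
  shows "alias_bound s k G"
proof -
  obtain r C where r: "0 < r" "r \<le> 1" "0 \<le> C" and F: "AE \<omega> in lborel. norm \<omega> < r \<longrightarrow> F \<omega> \<noteq> 0 \<and> alias_sum s F \<omega> \<le> ennreal (C * norm \<omega> powr (2 * k) * (norm (F \<omega>))\<^sup>2)"
    using F unfolding alias_bound_def by blast
  have "AE \<omega> in lborel. norm \<omega> < r \<longrightarrow> G \<omega> \<noteq> 0 \<and> alias_sum s G \<omega> \<le> ennreal (C * norm \<omega> powr (2 * k) * (norm (G \<omega>))\<^sup>2)"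
    using F ae AE_alias[OF ae] by eventually_elim (simp add: alias_sum_def)
  then show ?thesis unfolding alias_bound_def using r by blast
qed

lemma nn_integral_translate_indicator:
  fixes H :: "real^'d::finite \<Rightarrow> ennreal"
  assumes [measurable]: "H \<in> borel_measurable borel" "A \<in> sets borel"
  shows "(\<integral>\<^sup>+\<omega>. H \<omega> * indicator A (\<omega> - a) \<partial>lborel) = (\<integral>\<^sup>+\<omega>. H (\<omega> + a) * indicator A \<omega> \<partial>lborel)"
proof -
  have m: "(\<lambda>\<omega>. H \<omega> * indicator A (\<omega> - a)) \<in> borel_measurable borel" by measurable
  show ?thesis using nn_integral_affine[OF m, of 1 a] by (simp add: add.commute)
qed

text \<open>The lattice translates of a subset of the unit ball are pairwise disjoint, since distinct lattice
  points are more than 6 apart.\<close>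

lemma nn_integral_fold_lower:
  fixes H :: "real^'d::finite \<Rightarrow> ennreal"
  assumes [measurable]: "H \<in> borel_measurable borel" "A \<in> sets borel" and A: "A \<subseteq> ball 0 1"
  shows "(\<integral>\<^sup>+\<omega>. (H \<omega> + (\<Sum>n. H (\<omega> + alias_freq n))) * indicator A \<omega> \<partial>lborel) \<le> (\<integral>\<^sup>+\<omega>. H \<omega> \<partial>lborel)"
proof -
  have m0: "(\<lambda>\<omega>. H \<omega> * indicator A \<omega>) \<in> borel_measurable lborel"
    and m1: "(\<lambda>\<omega>. H (\<omega> + alias_freq n) * indicator A \<omega>) \<in> borel_measurable lborel"
    and m2: "(\<lambda>\<omega>. H \<omega> * indicator A (\<omega> - alias_freq n)) \<in> borel_measurable lborel" for n
    by measurable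
  have "(\<integral>\<^sup>+\<omega>. (H \<omega> + (\<Sum>n. H (\<omega> + alias_freq n))) * indicator A \<omega> \<partial>lborel)
     = (\<integral>\<^sup>+\<omega>. H \<omega> * indicator A \<omega> + (\<Sum>n. H (\<omega> + alias_freq n) * indicator A \<omega>) \<partial>lborel)"
    by (simp only: distrib_right ennreal_suminf_multc)
  also have "\<dots> = (\<integral>\<^sup>+\<omega>. H \<omega> * indicator A \<omega> \<partial>lborel) + (\<Sum>n. \<integral>\<^sup>+\<omega>. H (\<omega> + alias_freq n) * indicator A \<omega> \<partial>lborel)"
    by (simp only: nn_integral_add[OF m0 borel_measurable_suminf_order[OF m1]] nn_integral_suminf[OF m1])
  also have "\<dots> = (\<integral>\<^sup>+\<omega>. H \<omega> * indicator A \<omega> \<partial>lborel) + (\<Sum>n. \<integral>\<^sup>+\<omega>. H \<omega> * indicator A (\<omega> - alias_freq n) \<partial>lborel)"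
    by (simp only: nn_integral_translate_indicator[OF assms(1,2)])
  also have "\<dots> = (\<integral>\<^sup>+\<omega>. H \<omega> * indicator A \<omega> + (\<Sum>n. H \<omega> * indicator A (\<omega> - alias_freq n)) \<partial>lborel)"
    by (simp only: nn_integral_add[OF m0 borel_measurable_suminf_order[OF m2]] nn_integral_suminf[OF m2])
  also have "\<dots> \<le> (\<integral>\<^sup>+\<omega>. H \<omega> \<partial>lborel)"
  proof (rule nn_integral_mono)
    fix \<omega> :: "real^'d"
    (* At most one translate of A contains a given point. *)
    have far: "a = b" if "a \<in> dual_lattice" "b \<in> dual_lattice" "\<omega> - a \<in> A" "\<omega> - b \<in> A" for a b
    proof (rule ccontr)
      assume "a \<noteq> b"
      then have "6 \<le> norm (b - a)" using that by (intro dual_lattice_norm dual_lattice_diff) auto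
      also have "b - a = (\<omega> - a) - (\<omega> - b)" by simp
      also have "norm \<dots> \<le> norm (\<omega> - a) + norm (\<omega> - b)" by (rule norm_triangle_ineq4)
      also have "\<dots> < 1 + 1"
        using subsetD[OF A that(3)] subsetD[OF A that(4)] by (intro add_strict_mono) (simp_all only: mem_ball_0)
      finally show False by simp
    qed
    have "indicator A \<omega> + (\<Sum>n. indicator A (\<omega> - alias_freq n)) \<le> (1 :: ennreal)"
    proof (cases "\<exists>m. \<omega> - alias_freq m \<in> A")
      case False
      then have "indicator A (\<omega> - alias_freq n) = (0 :: ennreal)" for n by (intro indicator_simps) blast
      then show ?thesis by (simp only: suminf_zero add_0_right) (simp add: indicator_def)
    next
      case True
      then obtain m where m: "\<omega> - alias_freq m \<in> A" by blast
      have "\<omega> \<notin> A" using far[OF alias_mem(1) dual_lattice_zero m] alias_mem(2)[of m] by (metis diff_zero)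
      then have "indicator A \<omega> = (0 :: ennreal)" by (rule indicator_simps)
      moreover have "(\<lambda>n. indicator A (\<omega> - alias_freq n) :: ennreal) = (\<lambda>n. if n = m then 1 else 0)"
      proof
        fix n
        show "indicator A (\<omega> - alias_freq n) = (if n = m then 1 else 0 :: ennreal)"
        proof (cases "n = m")
          case False
          then have "\<omega> - alias_freq n \<notin> A" using far[OF alias_mem(1) alias_mem(1) _ m] alias_inj by blast
          then show ?thesis using False by simp
        qed (simp add: m)
      qed
      moreover have "(\<Sum>n. if n = m then 1 else 0) = (1 :: ennreal)"
        by (rule sums_unique[OF sums_single[of m "\<lambda>_. 1 :: ennreal"], symmetric])
      ultimately show ?thesis by (simp only: add_0_left order_refl)
    qed
    then have "H \<omega> * (indicator A \<omega> + (\<Sum>n. indicator A (\<omega> - alias_freq n))) \<le> H \<omega> * 1" by (rule mult_left_mono) simp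
    then show "H \<omega> * indicator A \<omega> + (\<Sum>n. H \<omega> * indicator A (\<omega> - alias_freq n)) \<le> H \<omega>" by (simp only: distrib_left mult_1_right ennreal_suminf_cmult)
  qed
  finally show ?thesis .
qed

lemma nn_integral_fold_upper:
  fixes H :: "real^'d::finite \<Rightarrow> ennreal"
  assumes [measurable]: "H \<in> borel_measurable borel" "A \<in> sets borel"
    and zero: "\<And>\<omega>. (\<And>n. \<omega> - alias_freq n \<notin> A) \<Longrightarrow> H \<omega> = 0"
  shows "(\<integral>\<^sup>+\<omega>. H \<omega> \<partial>lborel) \<le> (\<integral>\<^sup>+\<omega>. (\<Sum>n. H (\<omega> + alias_freq n)) * indicator A \<omega> \<partial>lborel)"
proof -
  have m1: "(\<lambda>\<omega>. H (\<omega> + alias_freq n) * indicator A \<omega>) \<in> borel_measurable lborel"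
    and m2: "(\<lambda>\<omega>. H \<omega> * indicator A (\<omega> - alias_freq n)) \<in> borel_measurable lborel" for n
    by measurable
  have "(\<integral>\<^sup>+\<omega>. H \<omega> \<partial>lborel) \<le> (\<integral>\<^sup>+\<omega>. (\<Sum>n. H \<omega> * indicator A (\<omega> - alias_freq n)) \<partial>lborel)"
  proof (rule nn_integral_mono)
    fix \<omega> :: "real^'d"
    show "H \<omega> \<le> (\<Sum>n. H \<omega> * indicator A (\<omega> - alias_freq n))"
    proof (cases "\<exists>m. \<omega> - alias_freq m \<in> A")
      case False
      then have "H \<omega> = 0" by (intro zero) blast
      then show ?thesis by simp
    next
      case True
      then obtain m where m: "\<omega> - alias_freq m \<in> A" by blast
      have "sum (\<lambda>n. H \<omega> * indicator A (\<omega> - alias_freq n)) {m} \<le> (\<Sum>n. H \<omega> * indicator A (\<omega> - alias_freq n))"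
        by (rule sum_le_suminf) auto
      then show ?thesis by (simp only: sum.insert[OF finite.emptyI] sum.empty empty_iff not_False_eq_True add_0_right indicator_simps(1)[OF m] mult_1_right)
    qed
  qed
  also have "\<dots> = (\<Sum>n. \<integral>\<^sup>+\<omega>. H \<omega> * indicator A (\<omega> - alias_freq n) \<partial>lborel)" by (rule nn_integral_suminf[OF m2])
  also have "\<dots> = (\<Sum>n. \<integral>\<^sup>+\<omega>. H (\<omega> + alias_freq n) * indicator A \<omega> \<partial>lborel)"
    by (simp only: nn_integral_translate_indicator[OF assms(1,2)])
  also have "\<dots> = (\<integral>\<^sup>+\<omega>. (\<Sum>n. H (\<omega> + alias_freq n) * indicator A \<omega>) \<partial>lborel)" by (rule nn_integral_suminf[OF m1, symmetric])
  also have "\<dots> = (\<integral>\<^sup>+\<omega>. (\<Sum>n. H (\<omega> + alias_freq n)) * indicator A \<omega> \<partial>lborel)" by (simp only: ennreal_suminf_multc)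
  finally show ?thesis .
qed

section \<open>Functions proportional to the generator along lattice orbits\<close>

text \<open>The squared Sobolev norm after the substitution \<open>x = h \<omega>\<close>, up to a power of \<open>h\<close>. In this form the
  dilation moves from the approximating space into the weight, which tends to \<open>|x| powr (2s)\<close> as \<open>h\<close>
  tends to 0.\<close>

definition hnorm2 :: "real \<Rightarrow> real \<Rightarrow> (real^'d::finite \<Rightarrow> complex) \<Rightarrow> ennreal" where
  "hnorm2 h s F = (\<integral>\<^sup>+x. ennreal (weight h s x * (norm (F x))\<^sup>2) \<partial>lborel)"

lemma hnorm2_scale:
  fixes F :: "real^'d::finite \<Rightarrow> complex"
  assumes h: "h > 0" and [measurable]: "F \<in> borel_measurable borel"
  shows "hnorm2 h s F = ennreal (h powr (2 * s + real CARD('d))) * wnorm2 s (\<lambda>\<omega>. F (h *\<^sub>R \<omega>))"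
proof -
  have m: "(\<lambda>x. ennreal (weight h s x * (norm (F x))\<^sup>2)) \<in> borel_measurable borel" by measurable
  have m': "(\<lambda>\<omega>. ennreal (weight 1 s \<omega> * (norm (F (h *\<^sub>R \<omega>)))\<^sup>2)) \<in> borel_measurable lborel" by measurable
  have h0: "h \<noteq> 0" using h by simp
  (* The weight is homogeneous of degree 2 s in the pair (h, x). *)
  have e: "ennreal (weight h s (0 + h *\<^sub>R \<omega>) * (norm (F (0 + h *\<^sub>R \<omega>)))\<^sup>2)
      = ennreal (h powr (2 * s)) * ennreal (weight 1 s \<omega> * (norm (F (h *\<^sub>R \<omega>)))\<^sup>2)" for \<omega>
  proof -
    have "h + norm (0 + h *\<^sub>R \<omega>) = h * (1 + norm \<omega>)" using h by (simp add: algebra_simps)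
    then have "weight h s (0 + h *\<^sub>R \<omega>) = h powr (2 * s) * weight 1 s \<omega>"
      using h by (simp only: powr_mult)
    then show ?thesis by (simp only: add_0 ennreal_mult'[symmetric] powr_ge_zero mult.assoc)
  qed
  have "hnorm2 h s F = ennreal (h ^ CARD('d)) * (ennreal (h powr (2 * s)) * wnorm2 s (\<lambda>\<omega>. F (h *\<^sub>R \<omega>)))"
    unfolding hnorm2_def wnorm2_def
    using nn_integral_affine[OF m h0, of 0] unfolding e nn_integral_cmult[OF m'] abs_of_pos[OF h] .
  also have "\<dots> = ennreal (h ^ CARD('d) * h powr (2 * s)) * wnorm2 s (\<lambda>\<omega>. F (h *\<^sub>R \<omega>))"
    using h by (simp add: ennreal_mult mult.assoc)
  also have "h ^ CARD('d) * h powr (2 * s) = h powr (2 * s + real CARD('d))"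
    using h by (simp add: powr_add powr_realpow mult.commute)
  finally show ?thesis .
qed

lemma weighted_L2_dilate:
  fixes F :: "real^'d::finite \<Rightarrow> complex"
  assumes h: "h > 0" and F: "weighted_L2 s F"
  shows "weighted_L2 s (\<lambda>\<omega>. F (h *\<^sub>R \<omega>))"
  unfolding weighted_L2_iff
proof
  have Fm[measurable]: "F \<in> borel_measurable borel" by (rule weighted_L2_measurable[OF F])
  show "(\<lambda>\<omega>. F (h *\<^sub>R \<omega>)) \<in> borel_measurable borel" by measurable
  define K where "K = (max 1 h) powr (2 * s) + (min 1 h) powr (2 * s)"
  have K: "weight h s x \<le> K * weight 1 s x" for x :: "real^'d"
  proof (cases "s \<ge> 0")
    case True
    have "h * 1 \<le> max 1 h * 1" by (rule mult_right_mono) simp_all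
    moreover have "1 * norm x \<le> max 1 h * norm x" by (rule mult_right_mono) simp_all
    ultimately have "h * 1 + 1 * norm x \<le> max 1 h * 1 + max 1 h * norm x" by (rule add_mono)
    then have "h + norm x \<le> max 1 h * (1 + norm x)" unfolding distrib_left mult_1_left mult_1_right .
    then have "weight h s x \<le> (max 1 h * (1 + norm x)) powr (2 * s)"
      using h True by (intro powr_mono2) auto
    also have "\<dots> = (max 1 h) powr (2 * s) * weight 1 s x" by (simp add: powr_mult)
    also have "\<dots> \<le> K * weight 1 s x" unfolding K_def by (intro mult_right_mono) auto
    finally show ?thesis .
  next
    case False
    have "min 1 h * 1 \<le> h * 1" by (rule mult_right_mono) simp_all
    moreover have "min 1 h * norm x \<le> 1 * norm x" by (rule mult_right_mono) simp_all
    ultimately have "min 1 h * 1 + min 1 h * norm x \<le> h * 1 + 1 * norm x" by (rule add_mono)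
    then have "min 1 h * (1 + norm x) \<le> h + norm x" unfolding distrib_left mult_1_left mult_1_right .
    then have "weight h s x \<le> (min 1 h * (1 + norm x)) powr (2 * s)"
      using h False by (intro powr_mono2') (auto intro!: mult_pos_pos add_pos_nonneg)
    also have "\<dots> = (min 1 h) powr (2 * s) * weight 1 s x" using h by (simp add: powr_mult)
    also have "\<dots> \<le> K * weight 1 s x" unfolding K_def by (intro mult_right_mono) auto
    finally show ?thesis .
  qed
  have K0: "K \<ge> 0" unfolding K_def by simp
  have "hnorm2 h s F \<le> (\<integral>\<^sup>+x. ennreal K * ennreal (weight 1 s x * (norm (F x))\<^sup>2) \<partial>lborel)"
    unfolding hnorm2_def
  proof (rule nn_integral_mono)
    fix x :: "real^'d"
    have "weight h s x * (norm (F x))\<^sup>2 \<le> (K * weight 1 s x) * (norm (F x))\<^sup>2"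
      by (rule mult_right_mono[OF K]) simp
    then show "ennreal (weight h s x * (norm (F x))\<^sup>2) \<le> ennreal K * ennreal (weight 1 s x * (norm (F x))\<^sup>2)"
      using K0 by (simp only: ennreal_mult'[symmetric] mult.assoc ennreal_leI)
  qed
  also have "\<dots> = ennreal K * wnorm2 s F" unfolding wnorm2_def by (rule nn_integral_cmult) measurable
  also have "\<dots> < \<infinity>" using weighted_L2_finite[OF F] by (simp add: ennreal_mult_less_top)
  finally have "hnorm2 h s F < \<infinity>" .
  then show "wnorm2 s (\<lambda>\<omega>. F (h *\<^sub>R \<omega>)) < \<infinity>"
    unfolding hnorm2_scale[OF h Fm] using h by (auto simp: ennreal_mult_less_top)
qed

lemma weighted_L2_bounded_support:
  fixes F :: "real^'d::finite \<Rightarrow> complex"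
  assumes Fm: "F \<in> borel_measurable borel" and b: "\<And>\<omega>. norm (F \<omega>) \<le> 1" and supp: "\<And>\<omega>. norm \<omega> \<ge> R \<Longrightarrow> F \<omega> = 0"
  shows "weighted_L2 s F"
  unfolding weighted_L2_iff
proof
  let ?c = "(1 + \<bar>R\<bar>) powr (2 * \<bar>s\<bar>)"
  have "wnorm2 s F \<le> (\<integral>\<^sup>+\<omega>. ennreal ?c * indicator (ball (0::real^'d) R) \<omega> \<partial>lborel)"
    unfolding wnorm2_def
  proof (rule nn_integral_mono)
    fix \<omega> :: "real^'d"
    show "ennreal (weight 1 s \<omega> * (norm (F \<omega>))\<^sup>2) \<le> ennreal ?c * indicator (ball 0 R) \<omega>"
    proof (cases "norm \<omega> < R")
      case True
      have "weight 1 s \<omega> \<le> (1 + norm \<omega>) powr (2 * \<bar>s\<bar>)" by (intro powr_mono) auto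
      also have "\<dots> \<le> ?c" using True by (intro powr_mono2) auto
      finally have "weight 1 s \<omega> * (norm (F \<omega>))\<^sup>2 \<le> ?c * 1\<^sup>2"
        using b[of \<omega>] by (intro mult_mono power_mono) auto
      then show ?thesis using True by (simp add: ennreal_leI)
    qed (simp add: supp)
  qed
  also have "\<dots> = ennreal ?c * emeasure lborel (ball (0::real^'d) R)" by (rule nn_integral_cmult_indicator) simp
  also have "\<dots> < \<infinity>" using emeasure_lborel_ball_finite[of "0::real^'d" R] by (simp add: ennreal_mult_less_top)
  finally show "wnorm2 s F < \<infinity>" .
qed (rule Fm)

text \<open>\<open>G\<close> is a multiple of \<open>\<Phi>\<close> along almost every orbit of the dual lattice. Stating this by cross
  multiplication, with a separate clause for the zeros of \<open>\<Phi>\<close>, avoids the choice of a periodic quotient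
  and is evidently stable under limits.\<close>

definition follows :: "(real^'d::finite \<Rightarrow> complex) \<Rightarrow> (real^'d \<Rightarrow> complex) \<Rightarrow> bool" where
  "follows \<Phi> G \<longleftrightarrow> (AE \<omega> in lborel. (\<Phi> \<omega> = 0 \<longrightarrow> G \<omega> = 0) \<and> (\<forall>n. \<Phi> (\<omega> + alias_freq n) * G \<omega> = G (\<omega> + alias_freq n) * \<Phi> \<omega>))"

text \<open>A closed shift-invariant space that contains the generator, hence an upper bound for \<open>shift_space\<close>.\<close>

definition follower_space :: "real \<Rightarrow> (real^'d::finite \<Rightarrow> complex) \<Rightarrow> 'd functional set" where
  "follower_space s \<Phi> = {u. \<exists>G. weighted_L2 s G \<and> follows \<Phi> G \<and> u = dist_of G}"

text \<open>Geometric convergence in the weighted norm makes the sum of the squared errors integrable, so it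
  is finite and its terms tend to 0 almost everywhere.\<close>

lemma wnorm2_small_imp_AE_lim:
  fixes G :: "nat \<Rightarrow> real^'d::finite \<Rightarrow> complex"
  assumes m: "\<And>n. weighted_L2 s (\<lambda>\<omega>. U \<omega> - G n \<omega>)"
    and small: "\<And>n. wnorm2 s (\<lambda>\<omega>. U \<omega> - G n \<omega>) \<le> ennreal ((1 / 2) ^ n)"
  shows "AE \<omega> in lborel. (\<lambda>n. G n \<omega>) \<longlonglongrightarrow> U \<omega>"
proof -
  let ?t = "\<lambda>n \<omega>. weight 1 s \<omega> * (norm (U \<omega> - G n \<omega>))\<^sup>2"
  have dm[measurable]: "(\<lambda>\<omega>. U \<omega> - G n \<omega>) \<in> borel_measurable borel" for n by (rule weighted_L2_measurable[OF m])
  have tm: "(\<lambda>\<omega>. ennreal (?t n \<omega>)) \<in> borel_measurable lborel" for n by measurable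
  have "(\<integral>\<^sup>+\<omega>. (\<Sum>n. ennreal (?t n \<omega>)) \<partial>lborel) = (\<Sum>n. wnorm2 s (\<lambda>\<omega>. U \<omega> - G n \<omega>))"
    unfolding wnorm2_def by (rule nn_integral_suminf[OF tm])
  also have "\<dots> \<le> (\<Sum>n. ennreal ((1 / 2) ^ n))" by (intro suminf_le small) auto
  also have "\<dots> = ennreal (\<Sum>n. (1 / 2) ^ n)" by (rule suminf_ennreal2) (auto intro: summable_geometric)
  also have "\<dots> < \<infinity>" by simp
  finally have "(\<integral>\<^sup>+\<omega>. (\<Sum>n. ennreal (?t n \<omega>)) \<partial>lborel) \<noteq> \<infinity>" by simp
  then have "AE \<omega> in lborel. (\<Sum>n. ennreal (?t n \<omega>)) \<noteq> \<infinity>"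
    by (intro nn_integral_noteq_infinite borel_measurable_suminf_order tm)
  then show ?thesis
  proof eventually_elim
    case (elim \<omega>)
    have w: "weight 1 s \<omega> > 0" using one_le_norm_pos[of \<omega>] by simp
    have "summable (\<lambda>n. ?t n \<omega>)" by (rule summable_suminf_not_top) (use elim in auto)
    then have "(\<lambda>n. ?t n \<omega>) \<longlonglongrightarrow> 0" by (rule summable_LIMSEQ_zero)
    then have "(\<lambda>n. ?t n \<omega> / weight 1 s \<omega>) \<longlonglongrightarrow> 0 / weight 1 s \<omega>"
      by (rule tendsto_divide[OF _ tendsto_const]) (use w in simp)
    then have "(\<lambda>n. (norm (U \<omega> - G n \<omega>))\<^sup>2) \<longlonglongrightarrow> 0" using w by simp
    then have "(\<lambda>n. sqrt ((norm (U \<omega> - G n \<omega>))\<^sup>2)) \<longlonglongrightarrow> sqrt 0" by (rule tendsto_real_sqrt)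
    then have "(\<lambda>n. norm (U \<omega> - G n \<omega>)) \<longlonglongrightarrow> 0" by simp
    then have "(\<lambda>n. norm (G n \<omega> - U \<omega>)) \<longlonglongrightarrow> 0" by (simp only: norm_minus_commute)
    then have "(\<lambda>n. G n \<omega> - U \<omega>) \<longlonglongrightarrow> 0" by (rule tendsto_norm_zero_cancel)
    then show ?case by (rule LIM_zero_cancel)
  qed
qed

lemma follows_limit:
  fixes G :: "nat \<Rightarrow> real^'d::finite \<Rightarrow> complex"
  assumes lim: "AE \<omega> in lborel. (\<lambda>n. G n \<omega>) \<longlonglongrightarrow> U \<omega>" and f: "\<And>n. follows \<Phi> (G n)"
  shows "follows \<Phi> U"
proof -
  have "AE \<omega> in lborel. \<forall>m. (\<Phi> \<omega> = 0 \<longrightarrow> G m \<omega> = 0) \<and> (\<forall>n. \<Phi> (\<omega> + alias_freq n) * G m \<omega> = G m (\<omega> + alias_freq n) * \<Phi> \<omega>)"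
    unfolding AE_all_countable using f unfolding follows_def by blast
  then show ?thesis unfolding follows_def using lim AE_alias[OF lim]
  proof eventually_elim
    case (elim \<omega>)
    show ?case
    proof (intro conjI impI allI)
      assume "\<Phi> \<omega> = 0"
      then have "G m \<omega> = 0" for m using elim(1) by blast
      with elim(2) have "(\<lambda>m::nat. 0) \<longlonglongrightarrow> U \<omega>" by (simp only:)
      then show "U \<omega> = 0" by (simp only: LIMSEQ_const_iff)
    next
      fix n
      have "(\<lambda>m. \<Phi> (\<omega> + alias_freq n) * G m \<omega>) \<longlonglongrightarrow> \<Phi> (\<omega> + alias_freq n) * U \<omega>"
        by (rule tendsto_mult_left[OF elim(2)])
      moreover have "(\<lambda>m. G m (\<omega> + alias_freq n) * \<Phi> \<omega>) \<longlonglongrightarrow> U (\<omega> + alias_freq n) * \<Phi> \<omega>"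
        by (rule tendsto_mult_right) (use elim(3) in blast)
      moreover have "(\<lambda>m. \<Phi> (\<omega> + alias_freq n) * G m \<omega>) = (\<lambda>m. G m (\<omega> + alias_freq n) * \<Phi> \<omega>)" using elim(1) by blast
      ultimately show "\<Phi> (\<omega> + alias_freq n) * U \<omega> = U (\<omega> + alias_freq n) * \<Phi> \<omega>" by (metis LIMSEQ_unique)
    qed
  qed
qed

text \<open>Integer translations act on transforms by factors that are periodic with respect to the dual lattice.\<close>

lemma cis_int_dual:
  fixes a :: "real^'d::finite"
  assumes a: "a \<in> int_lattice" and \<alpha>: "\<alpha> \<in> dual_lattice"
  shows "cis (a \<bullet> (\<omega> + \<alpha>)) = cis (a \<bullet> \<omega>)"
proof -
  have "\<forall>j. \<exists>m::int. a $ j = of_int m" using a unfolding int_lattice_def by (auto elim: Ints_cases)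
  then obtain m :: "'d \<Rightarrow> int" where m: "\<And>j. a $ j = of_int (m j)" by metis
  obtain n :: "'d \<Rightarrow> int" where n: "\<And>j. \<alpha> $ j = 2 * pi * of_int (n j)" using \<alpha> unfolding dual_lattice_iff by metis
  have "a \<bullet> \<alpha> = 2 * pi * of_int (\<Sum>j\<in>UNIV. m j * n j)"
    by (simp add: inner_vec_def m n sum_distrib_left mult_ac)
  moreover have "cis (2 * pi * of_int (\<Sum>j\<in>UNIV. m j * n j)) = 1" by (rule cis_multiple_2pi[OF Ints_of_int])
  ultimately have "cis (a \<bullet> \<alpha>) = 1" by (simp only:)
  moreover have "cis (a \<bullet> (\<omega> + \<alpha>)) = cis (a \<bullet> \<omega>) * cis (a \<bullet> \<alpha>)" by (simp only: cis_mult inner_add_right)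
  ultimately show ?thesis by (simp only: mult_1_right)
qed

lemma int_lattice_uminus: "a \<in> int_lattice \<Longrightarrow> - a \<in> int_lattice"
  unfolding int_lattice_def by simp

lemma follower_space_closed: "closed_subspace s (follower_space s \<Phi>)"
  for \<Phi> :: "real^'d::finite \<Rightarrow> complex"
  unfolding closed_subspace_def
proof (intro conjI ballI allI impI)
  show "follower_space s \<Phi> \<subseteq> sobolev_space s" unfolding follower_space_def using dist_of_sobolev by blast
  show "(\<lambda>f. 0) \<in> follower_space s \<Phi>"
    unfolding follower_space_def follows_def by (intro CollectI exI[of _ "\<lambda>\<omega>. 0"]) (simp add: dist_of_zero)
next
  fix u v :: "'d functional" and a b
  assume "u \<in> follower_space s \<Phi>" "v \<in> follower_space s \<Phi>"
  then obtain F G where F: "weighted_L2 s F" "follows \<Phi> F" "u = dist_of F" and G: "weighted_L2 s G" "follows \<Phi> G" "v = dist_of G"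
    unfolding follower_space_def by blast
  have "follows \<Phi> (\<lambda>\<omega>. a * F \<omega> + b * G \<omega>)"
    using F(2) G(2) unfolding follows_def
  proof eventually_elim
    case (elim \<omega>)
    have "\<Phi> (\<omega> + alias_freq n) * (a * F \<omega> + b * G \<omega>) = a * (\<Phi> (\<omega> + alias_freq n) * F \<omega>) + b * (\<Phi> (\<omega> + alias_freq n) * G \<omega>)" for n
      by (simp add: algebra_simps)
    moreover have "a * (\<Phi> (\<omega> + alias_freq n) * F \<omega>) + b * (\<Phi> (\<omega> + alias_freq n) * G \<omega>) = a * (F (\<omega> + alias_freq n) * \<Phi> \<omega>) + b * (G (\<omega> + alias_freq n) * \<Phi> \<omega>)" for n
      using elim by (simp only:)
    ultimately have "\<Phi> (\<omega> + alias_freq n) * (a * F \<omega> + b * G \<omega>) = (a * F (\<omega> + alias_freq n) + b * G (\<omega> + alias_freq n)) * \<Phi> \<omega>" for n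
      by (simp only: distrib_right mult.assoc)
    then show ?case using elim by simp
  qed
  moreover have "(\<lambda>f. a * u f + b * v f) = dist_of (\<lambda>\<omega>. a * F \<omega> + b * G \<omega>)"
    unfolding F(3) G(3) by (rule dist_of_lincomb[OF F(1) G(1)])
  ultimately show "(\<lambda>f. a * u f + b * v f) \<in> follower_space s \<Phi>"
    unfolding follower_space_def using weighted_L2_lincomb[OF F(1) G(1)] by blast
next
  fix u :: "'d functional"
  assume u: "u \<in> sobolev_space s" and app: "\<forall>e>0. \<exists>v\<in>follower_space s \<Phi>. sobolev_norm s (dist_diff u v) < e"
  let ?U = "ft_fun u"
  have U: "weighted_L2 s ?U" "u = dist_of ?U" using sobolev_ft[OF u] by auto
  have "\<exists>G. weighted_L2 s G \<and> follows \<Phi> G \<and> wnorm2 s (\<lambda>\<omega>. ?U \<omega> - G \<omega>) \<le> ennreal ((1 / 2) ^ n)" for n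
  proof -
    have "(1 / 2 :: real) ^ n > 0" by simp
    then obtain v where v: "v \<in> follower_space s \<Phi>" "sobolev_norm s (dist_diff u v) < (1 / 2) ^ n" using app by blast
    then obtain G where G: "weighted_L2 s G" "follows \<Phi> G" "v = dist_of G" unfolding follower_space_def by blast
    have d: "dist_diff u v = dist_of (\<lambda>\<omega>. ?U \<omega> - G \<omega>)" "weighted_L2 s (\<lambda>\<omega>. ?U \<omega> - G \<omega>)"
      using dist_diff_dist_of[OF U(1) G(1)] U(2) G(3) by simp_all
    have "wnorm2 s (\<lambda>\<omega>. ?U \<omega> - G \<omega>) \<le> ennreal (((1 / 2) ^ n)\<^sup>2)"
      using v(2) sobolev_norm_le_iff[OF d(2), of "(1 / 2) ^ n"] unfolding d(1) by simp
    also have "\<dots> \<le> ennreal ((1 / 2) ^ n)"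
      by (intro ennreal_leI) (simp add: power2_eq_square mult_left_le power_le_one)
    finally show ?thesis using G by blast
  qed
  then obtain G where G: "\<And>n. weighted_L2 s (G n)" "\<And>n. follows \<Phi> (G n)"
    and small: "\<And>n. wnorm2 s (\<lambda>\<omega>. ?U \<omega> - G n \<omega>) \<le> ennreal ((1 / 2) ^ n)" by metis
  have "follows \<Phi> ?U"
    by (rule follows_limit[OF wnorm2_small_imp_AE_lim[OF dist_diff_dist_of(2)[OF U(1) G(1)] small] G(2)])
  then show "u \<in> follower_space s \<Phi>" unfolding follower_space_def using U by blast
qed

lemma follower_space_shift: "shift_invariant (follower_space s \<Phi>)"
  for \<Phi> :: "real^'d::finite \<Rightarrow> complex"
  unfolding shift_invariant_def
proof (intro ballI)
  fix u :: "'d functional" and a :: "real^'d"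
  assume "u \<in> follower_space s \<Phi>" and a: "a \<in> int_lattice"
  then obtain G where G: "weighted_L2 s G" "follows \<Phi> G" "u = dist_of G" unfolding follower_space_def by blast
  have m: "(\<lambda>\<omega>::real^'d. cis (- a \<bullet> \<omega>)) \<in> borel_measurable borel"
    by (intro borel_measurable_continuous_onI continuous_on_cis_comp continuous_intros)
  have p: "cis (- a \<bullet> (\<omega> + alias_freq n)) = cis (- a \<bullet> \<omega>)" for \<omega> n
    by (rule cis_int_dual[OF int_lattice_uminus[OF a] alias_mem(1)])
  have "follows \<Phi> (\<lambda>\<omega>. cis (- a \<bullet> \<omega>) * G \<omega>)"
    using G(2) unfolding follows_def p
  proof eventually_elim
    case (elim \<omega>)
    have "\<Phi> (\<omega> + alias_freq n) * (cis (- a \<bullet> \<omega>) * G \<omega>) = cis (- a \<bullet> \<omega>) * (\<Phi> (\<omega> + alias_freq n) * G \<omega>)" for n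
      by (rule mult.left_commute)
    moreover have "cis (- a \<bullet> \<omega>) * (\<Phi> (\<omega> + alias_freq n) * G \<omega>) = cis (- a \<bullet> \<omega>) * G (\<omega> + alias_freq n) * \<Phi> \<omega>" for n
      using elim by (simp only: mult.assoc)
    ultimately show ?case using elim by simp
  qed
  moreover have "weighted_L2 s (\<lambda>\<omega>. cis (- a \<bullet> \<omega>) * G \<omega>)"
    by (rule weighted_L2_bounded_mult[OF G(1) m, of 1]) simp
  ultimately show "dist_translate a u \<in> follower_space s \<Phi>"
    unfolding follower_space_def G(3) dist_translate_dist_of by blast
qed

lemma shift_space_follower:
  fixes \<phi> :: "'d::finite functional"
  assumes \<phi>: "\<phi> \<in> sobolev_space s" and g: "g \<in> shift_space s \<phi>"
  obtains G where "weighted_L2 s G" "follows (ft_fun \<phi>) G" "g = dist_of G"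
proof -
  have "\<phi> \<in> follower_space s (ft_fun \<phi>)"
    unfolding follower_space_def follows_def using sobolev_ft[OF \<phi>] by (intro CollectI exI[of _ "ft_fun \<phi>"]) (simp add: mult.commute)
  then have "g \<in> follower_space s (ft_fun \<phi>)"
    using g follower_space_closed follower_space_shift unfolding shift_space_def by blast
  then show ?thesis using that unfolding follower_space_def by blast
qed

text \<open>A lower bound, up to a constant, for the squared distance in the weight \<open>|x| powr (2s)\<close> between the unit
  vector at the origin of the orbit of \<open>\<eta>\<close> and the line spanned by \<open>\<Phi>\<close> on that orbit. The exact squared
  distance is the weight at \<open>\<eta>\<close> times the quotient of brackets.\<close>

definition orbit_defect :: "real \<Rightarrow> (real^'d::finite \<Rightarrow> complex) \<Rightarrow> real^'d \<Rightarrow> ennreal" where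
  "orbit_defect s \<Phi> \<eta> = (if \<Phi> \<eta> = 0 then ennreal (norm \<eta> powr (2 * s) / 4)
     else min (ennreal (norm \<eta> powr (2 * s) / 4)) (ennreal (1 / (4 * (norm (\<Phi> \<eta>))\<^sup>2)) * alias_sum s \<Phi> \<eta>))"

lemma orbit_defect_measurable[measurable]:
  assumes [measurable]: "\<Phi> \<in> borel_measurable borel"
  shows "orbit_defect s \<Phi> \<in> borel_measurable borel"
  unfolding orbit_defect_def by measurable

lemma weight_lower:
  fixes h t s :: real
  assumes "0 < h" "h \<le> t"
  shows "2 powr (- 2 * \<bar>s\<bar>) * t powr (2 * s) \<le> (h + t) powr (2 * s)"
proof (cases "s \<ge> 0")
  case True
  have "2 powr (- 2 * \<bar>s\<bar>) \<le> (2::real) powr 0" by (intro powr_mono) auto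
  then have "2 powr (- 2 * \<bar>s\<bar>) * t powr (2 * s) \<le> 1 * t powr (2 * s)" by (intro mult_right_mono) auto
  also have "\<dots> \<le> (h + t) powr (2 * s)" using assms True by (simp add: powr_mono2)
  finally show ?thesis .
next
  case False
  then have "2 powr (- 2 * \<bar>s\<bar>) * t powr (2 * s) = (2 * t) powr (2 * s)" using assms by (simp add: powr_mult)
  also have "\<dots> \<le> (h + t) powr (2 * s)" using assms False by (intro powr_mono2') auto
  finally show ?thesis .
qed

lemma weight_upper:
  fixes h t s :: real
  assumes "0 < h" "h \<le> t"
  shows "(h + t) powr (2 * s) \<le> 2 powr (2 * \<bar>s\<bar>) * t powr (2 * s)"
proof (cases "s \<ge> 0")
  case True
  then have "(h + t) powr (2 * s) \<le> (2 * t) powr (2 * s)" using assms by (intro powr_mono2) auto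
  then show ?thesis using assms True by (simp add: powr_mult)
next
  case False
  have "(h + t) powr (2 * s) \<le> t powr (2 * s)" using assms False by (intro powr_mono2') auto
  also have "\<dots> = 1 * t powr (2 * s)" by simp
  also have "\<dots> \<le> 2 powr (2 * \<bar>s\<bar>) * t powr (2 * s)"
  proof (rule mult_right_mono)
    have "(2::real) powr 0 \<le> 2 powr (2 * \<bar>s\<bar>)" by (intro powr_mono) auto
    then show "1 \<le> (2::real) powr (2 * \<bar>s\<bar>)" by simp
  qed simp
  finally show ?thesis .
qed

text \<open>If \<open>G(\<eta>)\<close> differs from 1 by at least 1/2, the first term on the right is large. Otherwise
  \<open>|G(\<eta>)| \<ge> 1/2\<close>, so \<open>G\<close> is \<open>\<Phi>\<close> times a factor of modulus at least \<open>1 / (2 |\<Phi>(\<eta>)|)\<close> along the orbit, and the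
  aliases are large. The factor 1/4 in \<open>orbit_defect\<close> comes from squaring 1/2.\<close>

lemma orbit_defect_le:
  fixes \<Phi> G :: "real^'d::finite \<Rightarrow> complex"
  assumes h: "0 < h" "h \<le> norm \<eta>" and \<eta>: "norm \<eta> < 1"
    and z: "\<Phi> \<eta> = 0 \<Longrightarrow> G \<eta> = 0" and p: "\<And>n. \<Phi> (\<eta> + alias_freq n) * G \<eta> = G (\<eta> + alias_freq n) * \<Phi> \<eta>"
  shows "ennreal (2 powr (- 2 * \<bar>s\<bar>)) * orbit_defect s \<Phi> \<eta>
    \<le> ennreal (weight h s \<eta> * (norm (1 - G \<eta>))\<^sup>2)
      + (\<Sum>n. ennreal (weight h s (\<eta> + alias_freq n) * (norm (G (\<eta> + alias_freq n)))\<^sup>2))" (is "ennreal ?c * _ \<le> ?Z + (\<Sum>n. ?T n)")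
proof (cases "norm (1 - G \<eta>) \<ge> 1 / 2")
  case True
  have "orbit_defect s \<Phi> \<eta> \<le> ennreal (norm \<eta> powr (2 * s) / 4)" unfolding orbit_defect_def by simp
  then have "ennreal ?c * orbit_defect s \<Phi> \<eta> \<le> ennreal ?c * ennreal (norm \<eta> powr (2 * s) / 4)" by (rule mult_left_mono) simp
  also have "\<dots> = ennreal (?c * norm \<eta> powr (2 * s) * (1 / 2)\<^sup>2)"
    by (simp add: ennreal_mult'[symmetric] power2_eq_square)
  also have "\<dots> \<le> ?Z"
    by (intro ennreal_leI mult_mono weight_lower h power_mono True) auto
  also have "\<dots> \<le> ?Z + (\<Sum>n. ?T n)" by simp
  finally show ?thesis .
next
  case False
  have "1 \<le> norm (1 - G \<eta>) + norm (G \<eta>)" using norm_triangle_ineq[of "1 - G \<eta>" "G \<eta>"] by simp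
  then have g: "1 / 2 \<le> norm (G \<eta>)" using False by simp
  then have \<Phi>0: "\<Phi> \<eta> \<noteq> 0" using z by auto
  let ?q = "1 / (4 * (norm (\<Phi> \<eta>))\<^sup>2)"
  (* Cross multiplication gives the modulus of G at an alias; it is compared term by term. *)
  have T: "ennreal (?c * ?q) * ennreal ((norm (\<Phi> (\<eta> + alias_freq n)))\<^sup>2 * norm (\<eta> + alias_freq n) powr (2 * s)) \<le> ?T n" for n
  proof -
    have "norm (G (\<eta> + alias_freq n)) = norm (\<Phi> (\<eta> + alias_freq n)) * norm (G \<eta>) / norm (\<Phi> \<eta>)"
      using arg_cong[OF p[of n], of norm] \<Phi>0 by (simp add: norm_mult field_simps)
    moreover have "norm (\<Phi> (\<eta> + alias_freq n)) * (1 / 2) / norm (\<Phi> \<eta>) \<le> norm (\<Phi> (\<eta> + alias_freq n)) * norm (G \<eta>) / norm (\<Phi> \<eta>)"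
      by (intro divide_right_mono mult_left_mono g) auto
    ultimately have "(norm (\<Phi> (\<eta> + alias_freq n)) * (1 / 2) / norm (\<Phi> \<eta>))\<^sup>2 \<le> (norm (G (\<eta> + alias_freq n)))\<^sup>2" by (intro power_mono) auto
    moreover have "(norm (\<Phi> (\<eta> + alias_freq n)) * (1 / 2) / norm (\<Phi> \<eta>))\<^sup>2 = ?q * (norm (\<Phi> (\<eta> + alias_freq n)))\<^sup>2"
      by (simp add: power2_eq_square)
    ultimately have a: "?q * (norm (\<Phi> (\<eta> + alias_freq n)))\<^sup>2 \<le> (norm (G (\<eta> + alias_freq n)))\<^sup>2" by (simp only:)
    have "h \<le> norm (\<eta> + alias_freq n)" using alias_norm[OF \<eta>, of n] h \<eta> by linarith
    then have b: "?c * norm (\<eta> + alias_freq n) powr (2 * s) \<le> weight h s (\<eta> + alias_freq n)" by (rule weight_lower[OF h(1)])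
    have "(?c * norm (\<eta> + alias_freq n) powr (2 * s)) * (?q * (norm (\<Phi> (\<eta> + alias_freq n)))\<^sup>2) \<le> weight h s (\<eta> + alias_freq n) * (norm (G (\<eta> + alias_freq n)))\<^sup>2"
      by (rule mult_mono[OF b a]) auto
    moreover have "ennreal (?c * ?q) * ennreal ((norm (\<Phi> (\<eta> + alias_freq n)))\<^sup>2 * norm (\<eta> + alias_freq n) powr (2 * s)) = ennreal ((?c * norm (\<eta> + alias_freq n) powr (2 * s)) * (?q * (norm (\<Phi> (\<eta> + alias_freq n)))\<^sup>2))"
      by (subst ennreal_mult'[symmetric]) (simp_all add: mult_ac)
    ultimately show ?thesis by (simp only: ennreal_leI)
  qed
  have "ennreal ?c * orbit_defect s \<Phi> \<eta> \<le> ennreal ?c * (ennreal ?q * alias_sum s \<Phi> \<eta>)"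
    unfolding orbit_defect_def using \<Phi>0 by (intro mult_left_mono) auto
  also have "\<dots> = ennreal (?c * ?q) * alias_sum s \<Phi> \<eta>" 
  proof -
    have "ennreal (?c * ?q) = ennreal ?c * ennreal ?q" by (rule ennreal_mult) auto
    then show ?thesis by (simp only: mult.assoc)
  qed
  also have "\<dots> = (\<Sum>n. ennreal (?c * ?q) * ennreal ((norm (\<Phi> (\<eta> + alias_freq n)))\<^sup>2 * norm (\<eta> + alias_freq n) powr (2 * s)))"
    unfolding alias_sum_def by (rule ennreal_suminf_cmult[symmetric])
  also have "\<dots> \<le> (\<Sum>n. ?T n)" by (intro suminf_le T) auto
  also have "\<dots> \<le> ?Z + (\<Sum>n. ?T n)" by simp
  finally show ?thesis .
qed

lemma AE_le_if_integrals_le: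
  fixes f g :: "'a \<Rightarrow> ennreal"
  assumes [measurable]: "f \<in> borel_measurable M" "g \<in> borel_measurable M" "S \<in> sets M"
    and fin: "(\<integral>\<^sup>+x. g x * indicator S x \<partial>M) < \<infinity>" and gfin: "\<And>x. x \<in> S \<Longrightarrow> g x < \<infinity>"
    and le: "\<And>A. A \<in> sets M \<Longrightarrow> A \<subseteq> S \<Longrightarrow> (\<integral>\<^sup>+x. f x * indicator A x \<partial>M) \<le> (\<integral>\<^sup>+x. g x * indicator A x \<partial>M)"
  shows "AE x in M. x \<in> S \<longrightarrow> f x \<le> g x"
proof -
  define A where "A = {x \<in> S. g x < f x}"
  have AS: "A \<subseteq> S" unfolding A_def by blast
  have "A = {x \<in> space M. x \<in> S \<and> g x < f x}" unfolding A_def using sets.sets_into_space[OF assms(3)] by blast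
  then have Am[measurable]: "A \<in> sets M" by (simp only:) measurable
  have gA: "(\<integral>\<^sup>+x. g x * indicator A x \<partial>M) < \<infinity>"
    by (rule order_le_less_trans[OF nn_integral_mono fin]) (use AS in \<open>auto simp: indicator_def\<close>)
  have "(\<integral>\<^sup>+x. g x * indicator A x \<partial>M) + (\<integral>\<^sup>+x. (f x - g x) * indicator A x \<partial>M) = (\<integral>\<^sup>+x. g x * indicator A x + (f x - g x) * indicator A x \<partial>M)"
    by (rule nn_integral_add[symmetric]) measurable
  also have "\<dots> = (\<integral>\<^sup>+x. f x * indicator A x \<partial>M)"
  proof (rule nn_integral_cong)
    fix x
    show "g x * indicator A x + (f x - g x) * indicator A x = f x * indicator A x"
    proof (cases "x \<in> A")
      case True
      then have "g x \<le> f x" unfolding A_def by auto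
      then show ?thesis using True by (simp add: add_diff_inverse_ennreal)
    qed simp
  qed
  also have "\<dots> \<le> (\<integral>\<^sup>+x. g x * indicator A x \<partial>M)" by (rule le[OF Am AS])
  also have "\<dots> = (\<integral>\<^sup>+x. g x * indicator A x \<partial>M) + 0" by simp
  finally have "(\<integral>\<^sup>+x. (f x - g x) * indicator A x \<partial>M) \<le> 0"
    using gA by (subst (asm) ennreal_add_left_cancel_le) auto
  then have "(\<integral>\<^sup>+x. (f x - g x) * indicator A x \<partial>M) = 0" by simp
  then have "AE x in M. (f x - g x) * indicator A x = 0" by (subst (asm) nn_integral_0_iff_AE) auto
  then show ?thesis
  proof eventually_elim
    case (elim x)
    show ?case
    proof
      assume x: "x \<in> S"
      show "f x \<le> g x"
      proof (rule ccontr)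
        assume "\<not> f x \<le> g x"
        then have lt: "g x < f x" by simp
        then have "x \<in> A" using x unfolding A_def by blast
        then have "f x - g x = 0" using elim by simp
        then show False using diff_gr0_ennreal[OF lt] by simp
      qed
    qed
  qed
qed

section \<open>Approximation order implies an aliasing bound\<close>

lemma shift_space_zero: "(\<lambda>f. 0) \<in> shift_space s \<phi>"
  unfolding shift_space_def closed_subspace_def by blast

lemma defect_integral_le:
  fixes \<Phi> G :: "real^'d::finite \<Rightarrow> complex"
  assumes \<Phi>[measurable]: "\<Phi> \<in> borel_measurable borel" and G[measurable]: "G \<in> borel_measurable borel"
    and fol: "follows \<Phi> G" and A[measurable]: "A \<in> sets borel"
    and h: "0 < h" and hA: "\<And>x. x \<in> A \<Longrightarrow> h \<le> norm x" and bA: "\<And>x. x \<in> A \<Longrightarrow> norm x < 1"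
  shows "(\<integral>\<^sup>+x. ennreal (2 powr (- 2 * \<bar>s\<bar>)) * orbit_defect s \<Phi> x * indicator A x \<partial>lborel)
    \<le> hnorm2 h s (\<lambda>x. of_real (indicator A x) - G x)"
proof -
  define H where "H = (\<lambda>x. ennreal (weight h s x * (norm (of_real (indicator A x) - G x))\<^sup>2))"
  have Hm[measurable]: "H \<in> borel_measurable borel" unfolding H_def by measurable
  have "(\<integral>\<^sup>+x. ennreal (2 powr (- 2 * \<bar>s\<bar>)) * orbit_defect s \<Phi> x * indicator A x \<partial>lborel)
     \<le> (\<integral>\<^sup>+x. (H x + (\<Sum>n. H (x + alias_freq n))) * indicator A x \<partial>lborel)"
  proof (rule nn_integral_mono_AE)
    show "AE x in lborel. ennreal (2 powr (- 2 * \<bar>s\<bar>)) * orbit_defect s \<Phi> x * indicator A x \<le> (H x + (\<Sum>n. H (x + alias_freq n))) * indicator A x"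
      using fol unfolding follows_def
    proof eventually_elim
      case (elim x)
      show ?case
      proof (cases "x \<in> A")
        case True
        have out: "x + alias_freq n \<notin> A" for n
        proof
          assume "x + alias_freq n \<in> A"
          then have "norm (x + alias_freq n) < 1" by (rule bA)
          then show False using alias_norm[OF bA[OF True], of n] by simp
        qed
        have H0: "H x = ennreal (weight h s x * (norm (1 - G x))\<^sup>2)" unfolding H_def using True by simp
        have Hn: "H (x + alias_freq n) = ennreal (weight h s (x + alias_freq n) * (norm (G (x + alias_freq n)))\<^sup>2)" for n
          unfolding H_def using out by simp
        have "ennreal (2 powr (- 2 * \<bar>s\<bar>)) * orbit_defect s \<Phi> x \<le> H x + (\<Sum>n. H (x + alias_freq n))"
          unfolding H0 Hn
        proof (rule orbit_defect_le[OF h hA[OF True] bA[OF True]])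
          show "\<Phi> x = 0 \<Longrightarrow> G x = 0" using elim by blast
          show "\<Phi> (x + alias_freq n) * G x = G (x + alias_freq n) * \<Phi> x" for n using elim by blast
        qed
        then show ?thesis by (rule mult_right_mono) simp
      qed simp
    qed
  qed
  also have "\<dots> \<le> (\<integral>\<^sup>+x. H x \<partial>lborel)"
    by (rule nn_integral_fold_lower[OF Hm A]) (use bA in auto)
  also have "\<dots> = hnorm2 h s (\<lambda>x. of_real (indicator A x) - G x)" unfolding hnorm2_def H_def ..
  finally show ?thesis .
qed

lemma le_ennreal_limit:
  assumes "\<And>e. e > 0 \<Longrightarrow> I \<le> ennreal (q * (X + e)\<^sup>2)"
  shows "I \<le> ennreal (q * X\<^sup>2)"
proof (rule LIMSEQ_le_const)
  have "(\<lambda>n. q * (X + 1 / real (Suc n))\<^sup>2) \<longlonglongrightarrow> q * (X + 0)\<^sup>2"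
    by (intro tendsto_mult tendsto_const tendsto_power tendsto_add LIMSEQ_Suc[OF lim_1_over_n])
  then have "(\<lambda>n. ennreal (q * (X + 1 / real (Suc n))\<^sup>2)) \<longlonglongrightarrow> ennreal (q * (X + 0)\<^sup>2)"
    by (rule tendsto_ennrealI)
  then show "(\<lambda>n. ennreal (q * (X + 1 / real (Suc n))\<^sup>2)) \<longlonglongrightarrow> ennreal (q * X\<^sup>2)" by simp
  show "\<exists>N. \<forall>n\<ge>N. I \<le> ennreal (q * (X + 1 / real (Suc n))\<^sup>2)"
    by (intro exI[of _ 0] allI impI assms) simp
qed

text \<open>The target has the indicator of \<open>A\<close> as its transform in the variable \<open>x = h \<omega>\<close>. Both sides of the error
  estimate scale with \<open>h\<close> in the same way, so \<open>h\<close> cancels. On \<open>A\<close> one has \<open>h \<le> |x|\<close>, which makes the weight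
  \<open>(h + |x|) powr (2k)\<close> comparable to \<open>|x| powr (2k)\<close>.\<close>

lemma defect_shell_le:
  fixes \<phi> :: "'d::finite functional"
  assumes \<phi>: "\<phi> \<in> sobolev_space s" and h: "0 < h"
    and C: "\<And>f. f \<in> sobolev_space k \<Longrightarrow>
     (INF g\<in>dist_dilate h ` shift_space s \<phi>. sobolev_norm s (dist_diff f g)) \<le> C * h powr (k - s) * sobolev_norm k f"
    and A[measurable]: "A \<in> sets borel" and hA: "\<And>x. x \<in> A \<Longrightarrow> h \<le> norm x" and bA: "\<And>x. x \<in> A \<Longrightarrow> norm x < 1"
  shows "(\<integral>\<^sup>+x. ennreal (2 powr (- 2 * \<bar>s\<bar>)) * orbit_defect s (ft_fun \<phi>) x * indicator A x \<partial>lborel)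
    \<le> (\<integral>\<^sup>+x. ennreal (C\<^sup>2 * 2 powr (2 * \<bar>k\<bar>) * norm x powr (2 * k)) * indicator A x \<partial>lborel)" (is "?I \<le> _")
proof -
  let ?\<Phi> = "ft_fun \<phi>"
  let ?a = "\<lambda>x::real^'d. complex_of_real (indicator A x)"
  let ?F = "\<lambda>\<omega>. ?a (h *\<^sub>R \<omega>)"
  have \<Phi>: "weighted_L2 s ?\<Phi>" by (rule sobolev_ft(1)[OF \<phi>])
  have am: "?a \<in> borel_measurable borel" by measurable
  have wa: "weighted_L2 t ?a" for t
  proof (rule weighted_L2_bounded_support[OF am])
    show "norm (?a \<omega>) \<le> 1" for \<omega> by (simp add: indicator_def)
    show "?a \<omega> = 0" if "1 \<le> norm \<omega>" for \<omega> using bA[of \<omega>] that by (auto simp: indicator_def)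
  qed
  have wF: "weighted_L2 t ?F" for t by (rule weighted_L2_dilate[OF h wa])
  define N where "N = sobolev_norm k (dist_of ?F)"
  define X where "X = C * h powr (k - s) * N"
  define q where "q = h powr (2 * s + real CARD('d))"
  have q: "q > 0" unfolding q_def using h by simp
  have inf: "(INF g\<in>dist_dilate h ` shift_space s \<phi>. sobolev_norm s (dist_diff (dist_of ?F) g)) \<le> X"
    unfolding X_def N_def by (rule C[OF dist_of_sobolev[OF wF]])
  (* The absolute value allows for a negative constant C and disappears on squaring. *)
  have "?I \<le> ennreal (q * (\<bar>X\<bar> + e)\<^sup>2)" if e: "e > 0" for e
  proof -
    have "(INF g\<in>dist_dilate h ` shift_space s \<phi>. sobolev_norm s (dist_diff (dist_of ?F) g)) < \<bar>X\<bar> + e"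
      using inf e by linarith
    then obtain y where "y \<in> (\<lambda>g. sobolev_norm s (dist_diff (dist_of ?F) g)) ` (dist_dilate h ` shift_space s \<phi>)" "y < \<bar>X\<bar> + e"
      using cInf_lessD[of "(\<lambda>g. sobolev_norm s (dist_diff (dist_of ?F) g)) ` (dist_dilate h ` shift_space s \<phi>)" "\<bar>X\<bar> + e"] shift_space_zero[of s \<phi>] by blast
    then obtain g where g: "g \<in> shift_space s \<phi>" and lt: "sobolev_norm s (dist_diff (dist_of ?F) (dist_dilate h g)) < \<bar>X\<bar> + e" by blast
    obtain G0 where G0: "weighted_L2 s G0" "follows ?\<Phi> G0" "g = dist_of G0" by (rule shift_space_follower[OF \<phi> g])
    define G where "G = (\<lambda>x. of_real (h ^ CARD('d)) * G0 x)"
    have wG: "weighted_L2 s G" unfolding G_def by (rule weighted_L2_bounded_mult[OF G0(1) _ order_refl]) simp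
    have fG: "follows ?\<Phi> G" using G0(2) unfolding follows_def
    proof eventually_elim
      case (elim \<omega>)
      have "?\<Phi> (\<omega> + alias_freq n) * G \<omega> = of_real (h ^ CARD('d)) * (?\<Phi> (\<omega> + alias_freq n) * G0 \<omega>)" for n
        unfolding G_def by (rule mult.left_commute)
      moreover have "of_real (h ^ CARD('d)) * (?\<Phi> (\<omega> + alias_freq n) * G0 \<omega>) = G (\<omega> + alias_freq n) * ?\<Phi> \<omega>" for n
        unfolding G_def using elim by (simp only: mult.assoc)
      ultimately show ?case using elim by (simp add: G_def)
    qed
    have dil: "dist_dilate h g = dist_of (\<lambda>\<omega>. G (h *\<^sub>R \<omega>))"
      unfolding G0(3) G_def by (rule dist_dilate_dist_of[OF h weighted_L2_measurable[OF G0(1)]])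
    note d = dist_diff_dist_of[OF wF weighted_L2_dilate[OF h wG]]
    have wle: "wnorm2 s (\<lambda>\<omega>. ?F \<omega> - G (h *\<^sub>R \<omega>)) \<le> ennreal ((\<bar>X\<bar> + e)\<^sup>2)"
      using lt sobolev_norm_le_iff[OF d(2), of "\<bar>X\<bar> + e"] e unfolding dil d(1) by simp
    have "?I \<le> hnorm2 h s (\<lambda>x. ?a x - G x)"
      by (rule defect_integral_le[OF weighted_L2_measurable[OF \<Phi>] weighted_L2_measurable[OF wG] fG A h hA bA])
    also have "\<dots> = ennreal q * wnorm2 s (\<lambda>\<omega>. ?F \<omega> - G (h *\<^sub>R \<omega>))"
      unfolding q_def by (rule hnorm2_scale[OF h]) (intro borel_measurable_diff am weighted_L2_measurable[OF wG])
    also have "\<dots> \<le> ennreal q * ennreal ((\<bar>X\<bar> + e)\<^sup>2)" by (rule mult_left_mono[OF wle]) simp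
    also have "\<dots> = ennreal (q * (\<bar>X\<bar> + e)\<^sup>2)" using q by (intro ennreal_mult[symmetric]) auto
    finally show ?thesis .
  qed
  then have "?I \<le> ennreal (q * \<bar>X\<bar>\<^sup>2)" by (rule le_ennreal_limit)
  also have "q * \<bar>X\<bar>\<^sup>2 = C\<^sup>2 * (h powr (2 * k + real CARD('d)) * N\<^sup>2)"
  proof -
    have "(h powr (k - s))\<^sup>2 = h powr (2 * k - 2 * s)" by (simp add: power2_eq_square powr_add[symmetric])
    then have "q * \<bar>X\<bar>\<^sup>2 = C\<^sup>2 * ((h powr (2 * s + real CARD('d)) * h powr (2 * k - 2 * s)) * N\<^sup>2)"
      unfolding q_def X_def by (simp add: power_mult_distrib mult_ac)
    also have "h powr (2 * s + real CARD('d)) * h powr (2 * k - 2 * s) = h powr (2 * k + real CARD('d))"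
      by (simp only: powr_add[symmetric]) (simp add: add.commute)
    finally show ?thesis .
  qed
  also have "ennreal \<dots> = ennreal (C\<^sup>2) * (ennreal (h powr (2 * k + real CARD('d))) * ennreal (N\<^sup>2))"
    by (simp add: ennreal_mult)
  also have "ennreal (N\<^sup>2) = wnorm2 k ?F" unfolding N_def by (rule sobolev_normE[OF wF])
  also have "ennreal (h powr (2 * k + real CARD('d))) * wnorm2 k ?F = hnorm2 h k ?a" by (rule hnorm2_scale[OF h am, symmetric])
  also have "ennreal (C\<^sup>2) * hnorm2 h k ?a = (\<integral>\<^sup>+x. ennreal (C\<^sup>2) * ennreal (weight h k x * (norm (?a x))\<^sup>2) \<partial>lborel)"
    unfolding hnorm2_def by (rule nn_integral_cmult[symmetric]) measurable
  also have "\<dots> \<le> (\<integral>\<^sup>+x. ennreal (C\<^sup>2 * 2 powr (2 * \<bar>k\<bar>) * norm x powr (2 * k)) * indicator A x \<partial>lborel)"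
  proof (rule nn_integral_mono)
    fix x
    show "ennreal (C\<^sup>2) * ennreal (weight h k x * (norm (?a x))\<^sup>2) \<le> ennreal (C\<^sup>2 * 2 powr (2 * \<bar>k\<bar>) * norm x powr (2 * k)) * indicator A x"
    proof (cases "x \<in> A")
      case True
      have "C\<^sup>2 * weight h k x \<le> C\<^sup>2 * (2 powr (2 * \<bar>k\<bar>) * norm x powr (2 * k))"
        by (rule mult_left_mono[OF weight_upper[OF h hA[OF True]]]) simp
      then show ?thesis using True by (simp add: ennreal_mult'[symmetric] mult.assoc ennreal_leI)
    qed simp
  qed
  finally show ?thesis .
qed

text \<open>The sets \<open>(1/2)^n \<le> |x| < 1\<close> exhaust the punctured unit ball, and for each of them \<open>defect_shell_le\<close> is
  applied with \<open>h = (1/2)^n\<close> and all its Borel subsets. Near the origin \<open>|x| powr (2k)\<close> is much smaller than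
  \<open>|x| powr (2s)\<close>, so the alternatives in \<open>orbit_defect\<close> that do not involve the aliases are excluded.\<close>

lemma order_pos_imp_alias_bound:
  fixes \<phi> :: "'d::finite functional"
  assumes \<phi>: "\<phi> \<in> sobolev_space s" and ks: "k > s" and order: "approx_order_pos s \<phi> k"
  shows "alias_bound s k (ft_fun \<phi>)"
proof -
  let ?\<Phi> = "ft_fun \<phi>"
  have \<Phi>m[measurable]: "?\<Phi> \<in> borel_measurable borel" by (rule weighted_L2_measurable[OF sobolev_ft(1)[OF \<phi>]])
  obtain C where C: "\<And>f h. f \<in> sobolev_space k \<Longrightarrow> h > 0 \<Longrightarrow>
     (INF g\<in>dist_dilate h ` shift_space s \<phi>. sobolev_norm s (dist_diff f g)) \<le> C * h powr (k - s) * sobolev_norm k f"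
    using order unfolding approx_order_pos_def by blast
  define K where "K = C\<^sup>2 * 2 powr (2 * \<bar>k\<bar>)"
  define c where "c = (2::real) powr (- 2 * \<bar>s\<bar>)"
  have K: "K \<ge> 0" unfolding K_def by simp
  have c: "c > 0" unfolding c_def by simp
  define S where "S = (\<lambda>n. {x::real^'d. (1 / 2) ^ n \<le> norm x \<and> norm x < 1})"
  have Sm: "S n \<in> sets lborel" for n unfolding S_def by measurable
  have shell: "AE x in lborel. x \<in> S n \<longrightarrow> ennreal c * orbit_defect s ?\<Phi> x \<le> ennreal (K * norm x powr (2 * k))" for n
  proof (rule AE_le_if_integrals_le)
    let ?h = "(1 / 2 :: real) ^ n"
    have h: "?h > 0" by simp
    show "(\<lambda>x. ennreal c * orbit_defect s ?\<Phi> x) \<in> borel_measurable lborel" by measurable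
    show "(\<lambda>x::real^'d. ennreal (K * norm x powr (2 * k))) \<in> borel_measurable lborel" by measurable
    show "S n \<in> sets lborel" by (rule Sm)
    show "ennreal (K * norm x powr (2 * k)) < \<infinity>" for x :: "real^'d" by simp
    have "(\<integral>\<^sup>+x. ennreal (K * norm x powr (2 * k)) * indicator (S n) x \<partial>lborel)
       \<le> (\<integral>\<^sup>+x. ennreal (K * (1 + ?h powr (2 * k))) * indicator (ball (0::real^'d) 1) x \<partial>lborel)"
    proof (rule nn_integral_mono)
      fix x :: "real^'d"
      show "ennreal (K * norm x powr (2 * k)) * indicator (S n) x \<le> ennreal (K * (1 + ?h powr (2 * k))) * indicator (ball 0 1) x"
      proof (cases "x \<in> S n")
        case True
        then have x: "?h \<le> norm x" "norm x < 1" unfolding S_def by auto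
        have "norm x powr (2 * k) \<le> 1 + ?h powr (2 * k)"
        proof (cases "k \<ge> 0")
          case True
          then have "norm x powr (2 * k) \<le> 1 powr (2 * k)" using x by (intro powr_mono2) auto
          moreover have "0 \<le> ?h powr (2 * k)" by simp
          ultimately show ?thesis by (simp only: powr_one_eq_one add_increasing2)
        next
          case False
          then have "norm x powr (2 * k) \<le> ?h powr (2 * k)" using x h by (intro powr_mono2') auto
          then show ?thesis by simp
        qed
        then have "K * norm x powr (2 * k) \<le> K * (1 + ?h powr (2 * k))" using K by (rule mult_left_mono)
        then show ?thesis using x(2) True by (simp add: ennreal_leI)
      qed simp
    qed
    also have "\<dots> = ennreal (K * (1 + ?h powr (2 * k))) * emeasure lborel (ball (0::real^'d) 1)" by (rule nn_integral_cmult_indicator) simp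
    also have "\<dots> < \<infinity>" using emeasure_lborel_ball_finite[of "0::real^'d" 1] by (simp add: ennreal_mult_less_top)
    finally show "(\<integral>\<^sup>+x. ennreal (K * norm x powr (2 * k)) * indicator (S n) x \<partial>lborel) < \<infinity>" .
    fix A assume "A \<in> sets (lborel :: (real^'d) measure)" "A \<subseteq> S n"
    then have A: "A \<in> sets borel" "\<And>x. x \<in> A \<Longrightarrow> ?h \<le> norm x" "\<And>x. x \<in> A \<Longrightarrow> norm x < 1"
      unfolding S_def by auto
    show "(\<integral>\<^sup>+x. ennreal c * orbit_defect s ?\<Phi> x * indicator A x \<partial>lborel) \<le> (\<integral>\<^sup>+x. ennreal (K * norm x powr (2 * k)) * indicator A x \<partial>lborel)"
      unfolding c_def K_def by (rule defect_shell_le[OF \<phi> h C[OF _ h] A])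
  qed
  (* Any constant below c / (4 K) would do; K + 1 avoids a division by 0. *)
  obtain r0 where r0: "r0 > 0" "\<And>t. 0 \<le> t \<Longrightarrow> t < r0 \<Longrightarrow> t powr (2 * k - 2 * s) \<le> c / (8 * (K + 1))"
    by (rule small_power[of "2 * k - 2 * s" "c / (8 * (K + 1))"]) (use ks c K in auto)
  define r where "r = min 1 r0"
  have r: "0 < r" "r \<le> 1" "r \<le> r0" unfolding r_def using r0 by auto
  have "AE x in lborel. \<forall>n. x \<in> S n \<longrightarrow> ennreal c * orbit_defect s ?\<Phi> x \<le> ennreal (K * norm x powr (2 * k))"
    unfolding AE_all_countable using shell by blast
  then have "AE x in lborel. norm x < r \<longrightarrow> ?\<Phi> x \<noteq> 0 \<and> alias_sum s ?\<Phi> x \<le> ennreal (4 * K / c * norm x powr (2 * k) * (norm (?\<Phi> x))\<^sup>2)"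
    using AE_lborel_singleton[of 0]
  proof eventually_elim
    case (elim x)
    show ?case
    proof
      assume xr: "norm x < r"
      have x0: "norm x > 0" using elim(2) by simp
      obtain n where n: "(1 / 2 :: real) ^ n < norm x" using real_arch_pow_inv[OF x0, of "1 / 2"] by auto
      then have "x \<in> S n" unfolding S_def using xr r by simp
      with elim(1) have le: "ennreal c * orbit_defect s ?\<Phi> x \<le> ennreal (K * norm x powr (2 * k))" by blast
      have p: "norm x powr (2 * s) > 0" using x0 by simp
      have small: "K * norm x powr (2 * k) < c * (norm x powr (2 * s) / 4)"
      proof -
        have "norm x powr (2 * k - 2 * s) \<le> c / (8 * (K + 1))" using r0(2)[of "norm x"] xr r by simp
        then have "K * norm x powr (2 * k - 2 * s) \<le> K * (c / (8 * (K + 1)))" using K by (rule mult_left_mono)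
        also have "\<dots> = (K / (K + 1)) * (c / 8)" using K by (simp add: field_simps)
        also have "\<dots> \<le> 1 * (c / 8)" using K c by (intro mult_right_mono) auto
        also have "\<dots> < c / 4" using c by simp
        finally have "K * norm x powr (2 * k - 2 * s) * norm x powr (2 * s) < c / 4 * norm x powr (2 * s)"
          using p by (rule mult_strict_right_mono)
        moreover have "norm x powr (2 * k - 2 * s) * norm x powr (2 * s) = norm x powr (2 * k)" by (simp add: powr_add[symmetric])
        ultimately show ?thesis by (simp add: mult.assoc)
      qed
      then have small': "ennreal (K * norm x powr (2 * k)) < ennreal c * ennreal (norm x powr (2 * s) / 4)"
        using c K by (simp add: ennreal_mult[symmetric] ennreal_less_iff)
      have \<Phi>0: "?\<Phi> x \<noteq> 0"
      proof
        assume "?\<Phi> x = 0"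
        then have "orbit_defect s ?\<Phi> x = ennreal (norm x powr (2 * s) / 4)" unfolding orbit_defect_def by simp
        then show False using le small' by simp
      qed
      let ?q = "1 / (4 * (norm (?\<Phi> x))\<^sup>2)"
      have q: "?q > 0" using \<Phi>0 by simp
      have "orbit_defect s ?\<Phi> x = ennreal ?q * alias_sum s ?\<Phi> x"
      proof (rule ccontr)
        assume "orbit_defect s ?\<Phi> x \<noteq> ennreal ?q * alias_sum s ?\<Phi> x"
        then have "orbit_defect s ?\<Phi> x = ennreal (norm x powr (2 * s) / 4)"
          using \<Phi>0 unfolding orbit_defect_def min_def by (simp split: if_splits)
        then show False using le small' by simp
      qed
      with le have "ennreal c * (ennreal ?q * alias_sum s ?\<Phi> x) \<le> ennreal (K * norm x powr (2 * k))" by (simp only:)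
      then have le2: "ennreal (c * ?q) * alias_sum s ?\<Phi> x \<le> ennreal (K * norm x powr (2 * k))"
        using c q by (simp only: ennreal_mult[OF less_imp_le less_imp_le] mult.assoc)
      have cq: "c * ?q > 0" using c q by (rule mult_pos_pos)
      have "K * norm x powr (2 * k) = (c * ?q) * (4 * K / c * norm x powr (2 * k) * (norm (?\<Phi> x))\<^sup>2)"
        using c \<Phi>0 by simp
      with le2 have "ennreal (c * ?q) * alias_sum s ?\<Phi> x \<le> ennreal (c * ?q) * ennreal (4 * K / c * norm x powr (2 * k) * (norm (?\<Phi> x))\<^sup>2)"
        using cq c K by (simp only: ennreal_mult'[OF less_imp_le[OF cq], symmetric])
      then have "alias_sum s ?\<Phi> x \<le> ennreal (4 * K / c * norm x powr (2 * k) * (norm (?\<Phi> x))\<^sup>2)"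
        using cq by (subst (asm) ennreal_mult_le_mult_iff) auto
      with \<Phi>0 show "?\<Phi> x \<noteq> 0 \<and> alias_sum s ?\<Phi> x \<le> ennreal (4 * K / c * norm x powr (2 * k) * (norm (?\<Phi> x))\<^sup>2)" by blast
    qed
  qed
  then show ?thesis unfolding alias_bound_def
    by (intro exI[of _ r] exI[of _ "4 * K / c"] conjI) (use r K c in auto)
qed

section \<open>An aliasing bound implies approximation order\<close>

lemma wnorm2_dominated:
  fixes D :: "nat \<Rightarrow> real^'d::finite \<Rightarrow> complex"
  assumes Dm[measurable]: "\<And>n. D n \<in> borel_measurable borel"
    and lim: "AE \<omega> in lborel. (\<lambda>n. D n \<omega>) \<longlonglongrightarrow> 0" and W: "weighted_L2 s W" and b: "\<And>n \<omega>. norm (D n \<omega>) \<le> norm (W \<omega>)"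
  shows "(\<lambda>n. wnorm2 s (D n)) \<longlonglongrightarrow> 0"
proof -
  have [measurable]: "W \<in> borel_measurable borel" by (rule weighted_L2_measurable[OF W])
  have "(\<lambda>n. wnorm2 s (D n)) \<longlonglongrightarrow> (\<integral>\<^sup>+\<omega>. 0 \<partial>(lborel :: (real^'d) measure))"
    unfolding wnorm2_def
  proof (rule nn_integral_dominated_convergence[where w="\<lambda>\<omega>. ennreal (weight 1 s \<omega> * (norm (W \<omega>))\<^sup>2)"])
    show "(\<lambda>\<omega>. ennreal (weight 1 s \<omega> * (norm (D n \<omega>))\<^sup>2)) \<in> borel_measurable lborel" for n by measurable
    show "(\<lambda>\<omega>. ennreal (weight 1 s \<omega> * (norm (W \<omega>))\<^sup>2)) \<in> borel_measurable lborel" by measurable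
    show "AE \<omega> in lborel. ennreal (weight 1 s \<omega> * (norm (D n \<omega>))\<^sup>2) \<le> ennreal (weight 1 s \<omega> * (norm (W \<omega>))\<^sup>2)" for n
      by (intro AE_I2 ennreal_leI mult_left_mono power_mono b) auto
    show "(\<integral>\<^sup>+\<omega>. ennreal (weight 1 s \<omega> * (norm (W \<omega>))\<^sup>2) \<partial>lborel) < \<infinity>"
      using weighted_L2_finite[OF W] unfolding wnorm2_def .
    show "AE \<omega> in lborel. (\<lambda>n. ennreal (weight 1 s \<omega> * (norm (D n \<omega>))\<^sup>2)) \<longlonglongrightarrow> 0"
      using lim
    proof eventually_elim
      case (elim \<omega>)
      have "(\<lambda>n. weight 1 s \<omega> * (norm (D n \<omega>))\<^sup>2) \<longlonglongrightarrow> weight 1 s \<omega> * (norm (0::complex))\<^sup>2"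
        by (intro tendsto_mult tendsto_const tendsto_power tendsto_norm elim)
      then have "(\<lambda>n. ennreal (weight 1 s \<omega> * (norm (D n \<omega>))\<^sup>2)) \<longlonglongrightarrow> ennreal (weight 1 s \<omega> * (norm (0::complex))\<^sup>2)"
        by (rule tendsto_ennrealI)
      then show ?case by simp
    qed
  qed simp
  then show ?thesis by simp
qed

lemma sobolev_norm_less:
  fixes F :: "real^'d::finite \<Rightarrow> complex"
  assumes F: "weighted_L2 s F" and e: "e > 0" and w: "wnorm2 s F < ennreal (e\<^sup>2)"
  shows "sobolev_norm s (dist_of F) < e"
proof -
  have "ennreal ((sobolev_norm s (dist_of F))\<^sup>2) < ennreal (e\<^sup>2)" using w unfolding sobolev_normE[OF F] .
  then have "(sobolev_norm s (dist_of F))\<^sup>2 < e\<^sup>2" by (simp add: ennreal_less_iff)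
  then show ?thesis by (rule power2_less_imp_less) (use e in simp)
qed

text \<open>The bounded functions \<open>\<sigma>\<close> for which \<open>\<sigma> \<Psi>\<close> is the transform of an element of \<open>V\<close> form a class as in
  \<open>bp_closed\<close>: characters correspond to integer translations, and bounded pointwise limits to limits in
  the Sobolev norm by dominated convergence.\<close>

lemma periodic_multiplier_mem:
  fixes V :: "'d::finite functional set" and \<Psi> :: "real^'d \<Rightarrow> complex"
  assumes V: "closed_subspace s V" "shift_invariant V" and \<Psi>: "weighted_L2 s \<Psi>" "dist_of \<Psi> \<in> V"
    and \<tau>: "\<tau> \<in> borel_measurable borel" "\<And>x. norm (\<tau> x) \<le> K"
  shows "dist_of (\<lambda>\<omega>. \<tau> (reduce \<omega>) * \<Psi> \<omega>) \<in> V"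
proof -
  define T where "T = {\<sigma>. \<sigma> \<in> borel_measurable borel \<and> (\<exists>K. \<forall>x. norm (\<sigma> x) \<le> K) \<and> dist_of (\<lambda>\<omega>. \<sigma> \<omega> * \<Psi> \<omega>) \<in> V}"
  have w: "weighted_L2 s (\<lambda>\<omega>. \<sigma> \<omega> * \<Psi> \<omega>)" if "\<sigma> \<in> borel_measurable borel" "\<And>x. norm (\<sigma> x) \<le> K" for \<sigma> K
    by (rule weighted_L2_bounded_mult[OF \<Psi>(1) that])
  interpret bp_closed T
  proof
    fix a :: "real^'d"
    assume a: "a \<in> int_lattice"
    have "dist_translate (- a) (dist_of \<Psi>) \<in> V" using V(2) \<Psi>(2) int_lattice_uminus[OF a] unfolding shift_invariant_def by blast
    then have "dist_of (\<lambda>\<omega>. cis (a \<bullet> \<omega>) * \<Psi> \<omega>) \<in> V" unfolding dist_translate_dist_of minus_minus .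
    moreover have "(\<lambda>\<omega>::real^'d. cis (a \<bullet> \<omega>)) \<in> borel_measurable borel"
      by (intro borel_measurable_continuous_onI continuous_on_cis_comp continuous_intros)
    ultimately show "(\<lambda>x. cis (a \<bullet> x)) \<in> T" unfolding T_def by (auto intro!: exI[of _ 1])
  next
    fix f g :: "real^'d \<Rightarrow> complex" and a b
    assume "f \<in> T" "g \<in> T"
    then obtain K L where f: "f \<in> borel_measurable borel" "\<And>x. norm (f x) \<le> K" "dist_of (\<lambda>\<omega>. f \<omega> * \<Psi> \<omega>) \<in> V"
      and g: "g \<in> borel_measurable borel" "\<And>x. norm (g x) \<le> L" "dist_of (\<lambda>\<omega>. g \<omega> * \<Psi> \<omega>) \<in> V"
      unfolding T_def by blast
    have "(\<lambda>x. a * f x + b * g x) \<in> borel_measurable borel" using f(1) g(1) by measurable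
    moreover have "norm (a * f x + b * g x) \<le> norm a * K + norm b * L" for x
      using norm_triangle_ineq[of "a * f x" "b * g x"] mult_left_mono[OF f(2)[of x], of "norm a"] mult_left_mono[OF g(2)[of x], of "norm b"]
      by (simp add: norm_mult)
    moreover have "dist_of (\<lambda>\<omega>. (a * f \<omega> + b * g \<omega>) * \<Psi> \<omega>) \<in> V"
    proof -
      have "(\<lambda>h. a * dist_of (\<lambda>\<omega>. f \<omega> * \<Psi> \<omega>) h + b * dist_of (\<lambda>\<omega>. g \<omega> * \<Psi> \<omega>) h) \<in> V"
        using V(1) f(3) g(3) unfolding closed_subspace_def by blast
      then show ?thesis unfolding dist_of_lincomb[OF w[OF f(1,2)] w[OF g(1,2)]] by (simp only: distrib_right mult.assoc)
    qed
    ultimately show "(\<lambda>x. a * f x + b * g x) \<in> T" unfolding T_def by blast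
  next
    fix F :: "nat \<Rightarrow> real^'d \<Rightarrow> complex" and K f
    assume F: "\<And>n. F n \<in> T" and K: "\<And>n x. norm (F n x) \<le> K" and l: "\<And>x. (\<lambda>n. F n x) \<longlonglongrightarrow> f x"
    have Fm: "F n \<in> borel_measurable borel" and FV: "dist_of (\<lambda>\<omega>. F n \<omega> * \<Psi> \<omega>) \<in> V" for n using F[of n] unfolding T_def by blast+
    have fm: "f \<in> borel_measurable borel" by (rule borel_measurable_LIMSEQ_metric[OF Fm l])
    have fK: "norm (f x) \<le> K" for x by (rule LIMSEQ_le_const2[OF tendsto_norm[OF l]]) (use K in blast)
    have K0: "K \<ge> 0" using order_trans[OF norm_ge_zero fK] .
    let ?D = "\<lambda>n \<omega>. f \<omega> * \<Psi> \<omega> - F n \<omega> * \<Psi> \<omega>"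
    note d = dist_diff_dist_of[OF w[OF fm fK] w[OF Fm K]]
    have "dist_of (\<lambda>\<omega>. f \<omega> * \<Psi> \<omega>) \<in> V"
    proof -
      have "(\<lambda>n. wnorm2 s (?D n)) \<longlonglongrightarrow> 0"
      proof (rule wnorm2_dominated)
        show "?D n \<in> borel_measurable borel" for n by (rule weighted_L2_measurable[OF d(2)])
        show "weighted_L2 s (\<lambda>\<omega>. of_real (2 * K) * \<Psi> \<omega>)" by (rule weighted_L2_bounded_mult[OF \<Psi>(1) _ order_refl]) simp
        show "norm (?D n \<omega>) \<le> norm (of_real (2 * K) * \<Psi> \<omega>)" for n \<omega>
        proof -
          have "norm (f \<omega> - F n \<omega>) \<le> norm (f \<omega>) + norm (F n \<omega>)" by (rule norm_triangle_ineq4)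
          also have "\<dots> \<le> K + K" by (rule add_mono[OF fK K])
          finally have "norm (f \<omega> - F n \<omega>) * norm (\<Psi> \<omega>) \<le> (2 * K) * norm (\<Psi> \<omega>)" by (intro mult_right_mono) auto
          moreover have "\<bar>2 * K\<bar> = 2 * K" using K0 by simp
          ultimately show ?thesis by (simp only: left_diff_distrib[symmetric] norm_mult norm_of_real)
        qed
        show "AE \<omega> in lborel. (\<lambda>n. ?D n \<omega>) \<longlonglongrightarrow> 0"
        proof (rule AE_I2)
          fix \<omega>
          have "(\<lambda>n. ?D n \<omega>) \<longlonglongrightarrow> f \<omega> * \<Psi> \<omega> - f \<omega> * \<Psi> \<omega>"
            by (intro tendsto_diff tendsto_const tendsto_mult l)
          then show "(\<lambda>n. ?D n \<omega>) \<longlonglongrightarrow> 0" by simp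
        qed
      qed
      then have ev: "\<forall>\<^sub>F n in sequentially. wnorm2 s (?D n) < ennreal (e\<^sup>2)" if "e > 0" for e
        by (rule order_tendstoD(2)) (use that in simp)
      have "\<exists>v\<in>V. sobolev_norm s (dist_diff (dist_of (\<lambda>\<omega>. f \<omega> * \<Psi> \<omega>)) v) < e" if e: "e > 0" for e
      proof -
        obtain n where "wnorm2 s (?D n) < ennreal (e\<^sup>2)" using ev[OF e] unfolding eventually_sequentially by blast
        then have "sobolev_norm s (dist_of (?D n)) < e" by (rule sobolev_norm_less[OF d(2) e])
        then show ?thesis using FV[of n] unfolding d(1)[symmetric] by blast
      qed
      then show ?thesis using V(1) dist_of_sobolev[OF w[OF fm fK]] unfolding closed_subspace_def by blast
    qed
    then show "f \<in> T" using fm fK unfolding T_def by blast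
  qed
  have "(\<lambda>x. \<tau> (reduce x)) \<in> T" by (rule bounded_reduce[OF \<tau>])
  then show ?thesis unfolding T_def by blast
qed

lemma shift_space_multiplier:
  fixes \<psi> :: "'d::finite functional"
  assumes \<psi>: "\<psi> \<in> sobolev_space s" and \<tau>: "\<tau> \<in> borel_measurable borel" "\<And>x. norm (\<tau> x) \<le> K"
  shows "dist_of (\<lambda>\<omega>. \<tau> (reduce \<omega>) * ft_fun \<psi> \<omega>) \<in> shift_space s \<psi>"
  unfolding shift_space_def
proof (rule InterI)
  fix V assume "V \<in> {V. closed_subspace s V \<and> shift_invariant V \<and> \<psi> \<in> V}"
  then have V: "closed_subspace s V" "shift_invariant V" "\<psi> \<in> V" by auto
  show "dist_of (\<lambda>\<omega>. \<tau> (reduce \<omega>) * ft_fun \<psi> \<omega>) \<in> V"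
    by (rule periodic_multiplier_mem[OF V(1,2) sobolev_ft(1)[OF \<psi>] _ \<tau>]) (use V(3) sobolev_ft(2)[OF \<psi>] in simp)
qed

text \<open>The multiplier that reproduces \<open>f\<close> from \<open>\<Psi>\<close> on the ball of radius \<open>r\<close>. The second condition keeps it
  bounded by \<open>n\<close>; its effect disappears as \<open>n\<close> grows. Where \<open>\<Psi>\<close> vanishes, the condition forces \<open>f x = 0\<close>.\<close>

definition truncated_ratio :: "real \<Rightarrow> nat \<Rightarrow> (real^'d::finite \<Rightarrow> complex) \<Rightarrow> (real^'d \<Rightarrow> complex) \<Rightarrow> real^'d \<Rightarrow> complex" where
  "truncated_ratio r n \<Psi> f x = (if norm x < r \<and> norm (f x) \<le> real n * norm (\<Psi> x) then f x / \<Psi> x else 0)"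

lemma truncated_ratio_measurable[measurable]:
  assumes [measurable]: "\<Psi> \<in> borel_measurable borel" "f \<in> borel_measurable borel"
  shows "truncated_ratio r n \<Psi> f \<in> borel_measurable borel"
  unfolding truncated_ratio_def by measurable

lemma norm_ratio_le: "norm (truncated_ratio r n \<Psi> f x) \<le> real n"
proof (cases "\<Psi> x = 0")
  case False
  then show ?thesis unfolding truncated_ratio_def by (auto simp: norm_divide pos_divide_le_eq)
qed (simp add: truncated_ratio_def)

lemma norm_ratio_mult: "norm (truncated_ratio r n \<Psi> f x) * norm (\<Psi> x) \<le> norm (f x)"
  unfolding truncated_ratio_def by (simp add: norm_divide)

text \<open>Outside the ball the product of the periodic multiplier with \<open>\<Psi>\<close> lives on the lattice translates of the
  ball. Folding these back, the integrand at \<open>x\<close> becomes the square of the multiplier times the aliasing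
  sum, and the aliasing bound replaces the latter by \<open>|x| powr (2k) |\<Psi>(x)|\<^sup>2\<close>.\<close>

lemma alias_part_le:
  fixes \<Psi> f :: "real^'d::finite \<Rightarrow> complex"
  assumes \<Psi>[measurable]: "\<Psi> \<in> borel_measurable borel" and f[measurable]: "f \<in> borel_measurable borel"
    and r: "0 < r" "r \<le> 1" and C: "0 \<le> C" and h: "0 < h" "h \<le> 1" and k: "k \<ge> 0"
    and bound: "AE \<omega> in lborel. norm \<omega> < r \<longrightarrow> \<Psi> \<omega> \<noteq> 0 \<and> alias_sum s \<Psi> \<omega> \<le> ennreal (C * norm \<omega> powr (2 * k) * (norm (\<Psi> \<omega>))\<^sup>2)"
  shows "(\<integral>\<^sup>+x. (if norm x < r then 0 else ennreal (weight h s x * (norm (truncated_ratio r n \<Psi> f (reduce x) * \<Psi> x))\<^sup>2)) \<partial>lborel)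
    \<le> ennreal (2 powr (2 * \<bar>s\<bar>) * C) * hnorm2 h k f" (is "(\<integral>\<^sup>+x. ?P x \<partial>lborel) \<le> _")
proof -
  let ?\<tau> = "truncated_ratio r n \<Psi> f"
  let ?c = "2 powr (2 * \<bar>s\<bar>)"
  have Pm: "?P \<in> borel_measurable borel" by measurable
  have "(\<integral>\<^sup>+x. ?P x \<partial>lborel) \<le> (\<integral>\<^sup>+x. (\<Sum>m. ?P (x + alias_freq m)) * indicator (ball 0 r) x \<partial>lborel)"
  proof (rule nn_integral_fold_upper[OF Pm])
    show "ball (0::real^'d) r \<in> sets borel" by simp
    fix x :: "real^'d"
    assume no: "\<And>m. x - alias_freq m \<notin> ball 0 r"
    show "?P x = 0"
    proof (cases "norm x < r")
      case False
      have "\<not> norm (reduce x) < r"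
      proof
        assume lt: "norm (reduce x) < r"
        then have "x - reduce x \<noteq> 0" using False by auto
        then obtain m where "x - reduce x = alias_freq m" using alias_surj[OF reduce_diff] by blast
        then have "x - alias_freq m = reduce x" by (simp add: algebra_simps)
        then show False using no[of m] lt by simp
      qed
      then have "?\<tau> (reduce x) = 0" unfolding truncated_ratio_def by simp
      then show ?thesis by simp
    qed simp
  qed
  also have "\<dots> \<le> (\<integral>\<^sup>+x. ennreal (?c * C) * ennreal (weight h k x * (norm (f x))\<^sup>2) \<partial>lborel)"
  proof (rule nn_integral_mono_AE)
    show "AE x in lborel. (\<Sum>m. ?P (x + alias_freq m)) * indicator (ball 0 r) x \<le> ennreal (?c * C) * ennreal (weight h k x * (norm (f x))\<^sup>2)"
      using bound
    proof eventually_elim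
      case (elim x)
      show ?case
      proof (cases "norm x < r")
        case True
        with elim have A: "alias_sum s \<Psi> x \<le> ennreal (C * norm x powr (2 * k) * (norm (\<Psi> x))\<^sup>2)" by blast
        have x1: "norm x < 1" using True r by simp
        have red: "reduce (x + alias_freq m) = x" for m
        proof -
          have "reduce (x + alias_freq m) = reduce x" by (rule reduce_periodic[OF alias_mem(1)])
          also have "\<dots> = x" by (rule reduce_small) (use x1 pi_gt3 in linarith)
          finally show ?thesis .
        qed
        let ?q = "?c * (norm (?\<tau> x))\<^sup>2"
        have P: "?P (x + alias_freq m) \<le> ennreal ?q * ennreal ((norm (\<Psi> (x + alias_freq m)))\<^sup>2 * norm (x + alias_freq m) powr (2 * s))" for m
        proof -
          have "h \<le> norm (x + alias_freq m)" using alias_norm[OF x1, of m] h(2) by linarith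
          then have "weight h s (x + alias_freq m) * (norm (?\<tau> x * \<Psi> (x + alias_freq m)))\<^sup>2 \<le> (?c * norm (x + alias_freq m) powr (2 * s)) * (norm (?\<tau> x * \<Psi> (x + alias_freq m)))\<^sup>2"
            by (intro mult_right_mono weight_upper[OF h(1)]) auto
          also have "\<dots> = ?q * ((norm (\<Psi> (x + alias_freq m)))\<^sup>2 * norm (x + alias_freq m) powr (2 * s))"
            by (simp add: norm_mult power_mult_distrib mult_ac)
          finally have "ennreal (weight h s (x + alias_freq m) * (norm (?\<tau> x * \<Psi> (x + alias_freq m)))\<^sup>2) \<le> ennreal ?q * ennreal ((norm (\<Psi> (x + alias_freq m)))\<^sup>2 * norm (x + alias_freq m) powr (2 * s))"
            by (subst ennreal_mult'[symmetric]) (auto intro!: ennreal_leI)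
          then show ?thesis unfolding red by auto
        qed
        have "(\<Sum>m. ?P (x + alias_freq m)) \<le> (\<Sum>m. ennreal ?q * ennreal ((norm (\<Psi> (x + alias_freq m)))\<^sup>2 * norm (x + alias_freq m) powr (2 * s)))"
          by (intro suminf_le P) auto
        also have "\<dots> = ennreal ?q * alias_sum s \<Psi> x" unfolding alias_sum_def by (rule ennreal_suminf_cmult)
        also have "\<dots> \<le> ennreal ?q * ennreal (C * norm x powr (2 * k) * (norm (\<Psi> x))\<^sup>2)" by (rule mult_left_mono[OF A]) simp
        also have "\<dots> = ennreal (?q * (C * norm x powr (2 * k) * (norm (\<Psi> x))\<^sup>2))" by (rule ennreal_mult'[symmetric]) simp
        also have "\<dots> \<le> ennreal ((?c * C) * (weight h k x * (norm (f x))\<^sup>2))"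
        proof (rule ennreal_leI)
          have "?q * (C * norm x powr (2 * k) * (norm (\<Psi> x))\<^sup>2) = (?c * C) * (norm x powr (2 * k) * (norm (?\<tau> x) * norm (\<Psi> x))\<^sup>2)"
            by (simp add: power_mult_distrib mult_ac)
          also have "\<dots> \<le> (?c * C) * (weight h k x * (norm (f x))\<^sup>2)"
            using C h k by (intro mult_left_mono mult_mono powr_mono2 power_mono norm_ratio_mult) auto
          finally show "?q * (C * norm x powr (2 * k) * (norm (\<Psi> x))\<^sup>2) \<le> (?c * C) * (weight h k x * (norm (f x))\<^sup>2)" .
        qed
        also have "\<dots> = ennreal (?c * C) * ennreal (weight h k x * (norm (f x))\<^sup>2)"
          using C by (intro ennreal_mult) auto
        finally show ?thesis using True by simp
      qed simp
    qed
  qed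
  also have "\<dots> = ennreal (?c * C) * hnorm2 h k f" unfolding hnorm2_def by (rule nn_integral_cmult) measurable
  finally show ?thesis .
qed

text \<open>At frequencies above \<open>r\<close> the weight of order \<open>s \<le> k\<close> is at most a constant multiple, depending on
  \<open>r\<close>, of the weight of order \<open>k\<close>.\<close>

lemma tail_part_le:
  fixes f :: "real^'d::finite \<Rightarrow> complex"
  assumes f[measurable]: "f \<in> borel_measurable borel" and r: "0 < r" and h: "0 < h" and ks: "s \<le> k"
  shows "(\<integral>\<^sup>+x. (if norm x < r then 0 else ennreal (weight h s x * (norm (f x))\<^sup>2)) \<partial>lborel)
    \<le> ennreal (r powr (2 * s - 2 * k)) * hnorm2 h k f"
proof -
  have "(\<integral>\<^sup>+x. (if norm x < r then 0 else ennreal (weight h s x * (norm (f x))\<^sup>2)) \<partial>lborel)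
    \<le> (\<integral>\<^sup>+x. ennreal (r powr (2 * s - 2 * k)) * ennreal (weight h k x * (norm (f x))\<^sup>2) \<partial>lborel)"
  proof (rule nn_integral_mono)
    fix x :: "real^'d"
    show "(if norm x < r then 0 else ennreal (weight h s x * (norm (f x))\<^sup>2)) \<le> ennreal (r powr (2 * s - 2 * k)) * ennreal (weight h k x * (norm (f x))\<^sup>2)"
    proof (cases "norm x < r")
      case False
      have "weight h s x = (h + norm x) powr (2 * s - 2 * k) * weight h k x"
        by (simp add: powr_add[symmetric])
      also have "\<dots> \<le> r powr (2 * s - 2 * k) * weight h k x"
        using False r h ks by (intro mult_right_mono powr_mono2') auto
      finally have "weight h s x * (norm (f x))\<^sup>2 \<le> (r powr (2 * s - 2 * k) * weight h k x) * (norm (f x))\<^sup>2"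
        by (rule mult_right_mono) simp
      then have "ennreal (weight h s x * (norm (f x))\<^sup>2) \<le> ennreal (r powr (2 * s - 2 * k) * (weight h k x * (norm (f x))\<^sup>2))"
        by (simp only: mult.assoc ennreal_leI)
      also have "\<dots> = ennreal (r powr (2 * s - 2 * k)) * ennreal (weight h k x * (norm (f x))\<^sup>2)" by (rule ennreal_mult') simp
      finally show ?thesis using False by simp
    qed simp
  qed
  also have "\<dots> = ennreal (r powr (2 * s - 2 * k)) * hnorm2 h k f" unfolding hnorm2_def by (rule nn_integral_cmult) measurable
  finally show ?thesis .
qed

lemma unresolved_part_tendsto:
  fixes \<Psi> f :: "real^'d::finite \<Rightarrow> complex"
  assumes \<Psi>[measurable]: "\<Psi> \<in> borel_measurable borel" and f[measurable]: "f \<in> borel_measurable borel"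
    and fin: "hnorm2 h s f < \<infinity>" and nz: "AE x in lborel. norm x < r \<longrightarrow> \<Psi> x \<noteq> 0"
  shows "(\<lambda>n. \<integral>\<^sup>+x. (if norm x < r \<and> \<not> norm (f x) \<le> real n * norm (\<Psi> x) then ennreal (weight h s x * (norm (f x))\<^sup>2) else 0) \<partial>lborel) \<longlonglongrightarrow> 0"
proof -
  let ?R = "\<lambda>n x. (if norm x < r \<and> \<not> norm (f x) \<le> real n * norm (\<Psi> x) then ennreal (weight h s x * (norm (f x))\<^sup>2) else 0)"
  have "(\<lambda>n. \<integral>\<^sup>+x. ?R n x \<partial>lborel) \<longlonglongrightarrow> (\<integral>\<^sup>+x. 0 \<partial>(lborel :: (real^'d) measure))"
  proof (rule nn_integral_dominated_convergence[where w="\<lambda>x. ennreal (weight h s x * (norm (f x))\<^sup>2)"])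
    show "?R n \<in> borel_measurable lborel" for n by measurable
    show "(\<lambda>x. ennreal (weight h s x * (norm (f x))\<^sup>2)) \<in> borel_measurable lborel" by measurable
    show "AE x in lborel. ?R n x \<le> ennreal (weight h s x * (norm (f x))\<^sup>2)" for n by (rule AE_I2) simp
    show "(\<integral>\<^sup>+x. ennreal (weight h s x * (norm (f x))\<^sup>2) \<partial>lborel) < \<infinity>" using fin unfolding hnorm2_def .
    show "AE x in lborel. (\<lambda>n. ?R n x) \<longlonglongrightarrow> 0"
      using nz
    proof eventually_elim
      case (elim x)
      show ?case
      proof (cases "norm x < r")
        case True
        then have pos: "norm (\<Psi> x) > 0" using elim by simp
        obtain N :: nat where N: "norm (f x) < real N * norm (\<Psi> x)" using reals_Archimedean3[OF pos] by blast
        have "?R n x = 0" if "n \<ge> N" for n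
        proof -
          have "real N * norm (\<Psi> x) \<le> real n * norm (\<Psi> x)" using that by (intro mult_right_mono) auto
          with N have "norm (f x) \<le> real n * norm (\<Psi> x)" by (rule order_trans[OF less_imp_le])
          then show ?thesis by simp
        qed
        then have "\<forall>\<^sub>F n in sequentially. ?R n x = 0" unfolding eventually_sequentially by blast
        then show ?thesis by (rule tendsto_eventually)
      qed simp
    qed
  qed simp
  then show ?thesis by simp
qed

text \<open>Inside the ball the multiplier reproduces \<open>f\<close> except where it was truncated; outside, the error is at
  most the tail of \<open>f\<close> plus the aliases. The factors 2 come from \<open>(a + b)\<^sup>2 \<le> 2 a\<^sup>2 + 2 b\<^sup>2\<close>.\<close>

lemma interpolation_error_le:
  fixes \<Psi> f :: "real^'d::finite \<Rightarrow> complex"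
  assumes \<Psi>[measurable]: "\<Psi> \<in> borel_measurable borel" and f[measurable]: "f \<in> borel_measurable borel"
    and r: "0 < r" "r \<le> 1" and C: "0 \<le> C" and h: "0 < h" "h \<le> 1" and k: "k \<ge> 0" "s \<le> k"
    and bound: "AE \<omega> in lborel. norm \<omega> < r \<longrightarrow> \<Psi> \<omega> \<noteq> 0 \<and> alias_sum s \<Psi> \<omega> \<le> ennreal (C * norm \<omega> powr (2 * k) * (norm (\<Psi> \<omega>))\<^sup>2)"
  shows "hnorm2 h s (\<lambda>x. f x - truncated_ratio r n \<Psi> f (reduce x) * \<Psi> x)
    \<le> ennreal (2 * r powr (2 * s - 2 * k) + 2 * (2 powr (2 * \<bar>s\<bar>) * C)) * hnorm2 h k f
      + (\<integral>\<^sup>+x. (if norm x < r \<and> \<not> norm (f x) \<le> real n * norm (\<Psi> x) then ennreal (weight h s x * (norm (f x))\<^sup>2) else 0) \<partial>lborel)"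
proof -
  let ?\<tau> = "truncated_ratio r n \<Psi> f"
  let ?v = "\<lambda>x. weight h s x"
  let ?L = "\<lambda>x. if norm x < r then 0 else ennreal (?v x * (norm (f x))\<^sup>2)"
  let ?P = "\<lambda>x. if norm x < r then 0 else ennreal (?v x * (norm (?\<tau> (reduce x) * \<Psi> x))\<^sup>2)"
  let ?R = "\<lambda>x. if norm x < r \<and> \<not> norm (f x) \<le> real n * norm (\<Psi> x) then ennreal (?v x * (norm (f x))\<^sup>2) else 0"
  have Lm: "?L \<in> borel_measurable lborel" and Pm: "?P \<in> borel_measurable lborel" and Rm: "?R \<in> borel_measurable lborel" by measurable
  have Lm2: "(\<lambda>x. 2 * ?L x) \<in> borel_measurable lborel" and Pm2: "(\<lambda>x. 2 * ?P x) \<in> borel_measurable lborel"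
    using Lm Pm by measurable
  have LPm: "(\<lambda>x. 2 * ?L x + 2 * ?P x) \<in> borel_measurable lborel" using Lm2 Pm2 by (rule borel_measurable_add)
  have "hnorm2 h s (\<lambda>x. f x - ?\<tau> (reduce x) * \<Psi> x) \<le> (\<integral>\<^sup>+x. (2 * ?L x + 2 * ?P x) + ?R x \<partial>lborel)"
    unfolding hnorm2_def
  proof (rule nn_integral_mono_AE)
    show "AE x in lborel. ennreal (?v x * (norm (f x - ?\<tau> (reduce x) * \<Psi> x))\<^sup>2) \<le> (2 * ?L x + 2 * ?P x) + ?R x"
      using bound
    proof eventually_elim
      case (elim x)
      show ?case
      proof (cases "norm x < r")
        case True
        then have red: "reduce x = x" by (intro reduce_small) (use r pi_gt3 in linarith)
        have nz: "\<Psi> x \<noteq> 0" using elim True by blast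
        show ?thesis
        proof (cases "norm (f x) \<le> real n * norm (\<Psi> x)")
          case in_D: True
          have e: "f x - ?\<tau> (reduce x) * \<Psi> x = 0" unfolding red truncated_ratio_def using True in_D nz by simp
          show ?thesis unfolding e by simp
        next
          case False
          have e: "f x - ?\<tau> (reduce x) * \<Psi> x = f x" unfolding red truncated_ratio_def using False by simp
          show ?thesis unfolding e using True False by simp
        qed
      next
        case False
        let ?a = "norm (f x)" and ?b = "norm (?\<tau> (reduce x) * \<Psi> x)"
        have "(norm (f x - ?\<tau> (reduce x) * \<Psi> x))\<^sup>2 \<le> (?a + ?b)\<^sup>2" by (intro power_mono norm_triangle_ineq4) simp
        also have "\<dots> \<le> 2 * ?a\<^sup>2 + 2 * ?b\<^sup>2" by (rule square_sum_le)
        finally have "?v x * (norm (f x - ?\<tau> (reduce x) * \<Psi> x))\<^sup>2 \<le> ?v x * (2 * ?a\<^sup>2 + 2 * ?b\<^sup>2)" by (rule mult_left_mono) simp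
        also have "\<dots> = 2 * (?v x * ?a\<^sup>2) + 2 * (?v x * ?b\<^sup>2)" by (simp only: distrib_left mult.left_commute)
        finally have "ennreal (?v x * (norm (f x - ?\<tau> (reduce x) * \<Psi> x))\<^sup>2) \<le> ennreal (2 * (?v x * ?a\<^sup>2) + 2 * (?v x * ?b\<^sup>2))" by (rule ennreal_leI)
        also have "\<dots> = ennreal (2 * (?v x * ?a\<^sup>2)) + ennreal (2 * (?v x * ?b\<^sup>2))" by (rule ennreal_plus) simp_all
        also have "ennreal (2 * (?v x * ?a\<^sup>2)) = 2 * ?L x" using False by (simp add: ennreal_mult)
        also have "ennreal (2 * (?v x * ?b\<^sup>2)) = 2 * ?P x" using False by (simp add: ennreal_mult)
        also have "2 * ?L x + 2 * ?P x \<le> (2 * ?L x + 2 * ?P x) + ?R x" by (rule add_increasing2) simp_all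
        finally show ?thesis .
      qed
    qed
  qed
  also have "\<dots> = (2 * (\<integral>\<^sup>+x. ?L x \<partial>lborel) + 2 * (\<integral>\<^sup>+x. ?P x \<partial>lborel)) + (\<integral>\<^sup>+x. ?R x \<partial>lborel)"
    by (simp only: nn_integral_add[OF LPm Rm] nn_integral_add[OF Lm2 Pm2] nn_integral_cmult[OF Lm] nn_integral_cmult[OF Pm])
  also have "\<dots> \<le> (2 * (ennreal (r powr (2 * s - 2 * k)) * hnorm2 h k f) + 2 * (ennreal (2 powr (2 * \<bar>s\<bar>) * C) * hnorm2 h k f)) + (\<integral>\<^sup>+x. ?R x \<partial>lborel)"
    by (intro add_mono mult_left_mono tail_part_le[OF f r(1) h(1) k(2)] alias_part_le[OF \<Psi> f r C h k(1) bound]) simp_all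
  also have "2 * (ennreal (r powr (2 * s - 2 * k)) * hnorm2 h k f) + 2 * (ennreal (2 powr (2 * \<bar>s\<bar>) * C) * hnorm2 h k f)
     = ennreal (2 * r powr (2 * s - 2 * k) + 2 * (2 powr (2 * \<bar>s\<bar>) * C)) * hnorm2 h k f"
  proof -
    have "ennreal (2 * r powr (2 * s - 2 * k) + 2 * (2 powr (2 * \<bar>s\<bar>) * C)) = 2 * ennreal (r powr (2 * s - 2 * k)) + 2 * ennreal (2 powr (2 * \<bar>s\<bar>) * C)"
      using C by (subst ennreal_plus) (simp_all add: ennreal_mult)
    then show ?thesis by (simp only: distrib_right mult.assoc)
  qed
  finally show ?thesis .
qed

text \<open>For \<open>h \<ge> 1\<close> the zero function is a good enough approximant. For \<open>h < 1\<close> the approximant is the one with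
  multiplier \<open>truncated_ratio\<close>, where \<open>n\<close> is taken so large that the truncation contributes at most \<open>e\<close>.\<close>

lemma alias_bound_imp_order_pos:
  fixes \<psi> :: "'d::finite functional"
  assumes \<psi>: "\<psi> \<in> sobolev_space s" and ks: "k > s" and k0: "k > 0" and ab: "alias_bound s k (ft_fun \<psi>)"
  shows "approx_order_pos s \<psi> k"
proof -
  let ?\<Psi> = "ft_fun \<psi>"
  have w\<Psi>: "weighted_L2 s ?\<Psi>" by (rule sobolev_ft(1)[OF \<psi>])
  have \<Psi>m[measurable]: "?\<Psi> \<in> borel_measurable borel" by (rule weighted_L2_measurable[OF w\<Psi>])
  obtain r C where r: "0 < r" "r \<le> 1" and C: "0 \<le> C" and
    bound: "AE \<omega> in lborel. norm \<omega> < r \<longrightarrow> ?\<Psi> \<omega> \<noteq> 0 \<and> alias_sum s ?\<Psi> \<omega> \<le> ennreal (C * norm \<omega> powr (2 * k) * (norm (?\<Psi> \<omega>))\<^sup>2)"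
    using ab unfolding alias_bound_def by blast
  define B where "B = 2 * r powr (2 * s - 2 * k) + 2 * (2 powr (2 * \<bar>s\<bar>) * C)"
  have B: "B \<ge> 0" unfolding B_def using C by simp
  have main: "(INF g\<in>dist_dilate h ` shift_space s \<psi>. sobolev_norm s (dist_diff f g)) \<le> (sqrt B + 1) * h powr (k - s) * sobolev_norm k f"
    if f: "f \<in> sobolev_space k" and h: "h > 0" for f h
  proof -
    let ?F = "ft_fun f"
    have wF: "weighted_L2 k ?F" and fF: "f = dist_of ?F" using sobolev_ft[OF f] by auto
    have Fm[measurable]: "?F \<in> borel_measurable borel" by (rule weighted_L2_measurable[OF wF])
    have wFs: "weighted_L2 s ?F" by (rule weighted_L2_mono[OF wF]) (use ks in simp)
    define N where "N = sobolev_norm k f"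
    have N0: "N \<ge> 0" unfolding N_def by (rule sobolev_norm_nonneg)
    have N2: "wnorm2 k ?F = ennreal (N\<^sup>2)" unfolding N_def by (subst fF) (rule sobolev_normE[OF wF, symmetric])
    have bdd: "bdd_below ((\<lambda>g. sobolev_norm s (dist_diff f g)) ` (dist_dilate h ` shift_space s \<psi>))"
      by (rule bdd_belowI[of _ 0]) (auto simp: sobolev_norm_nonneg)
    show ?thesis
    proof (cases "h \<ge> 1")
      case True
      have z: "dist_dilate h (\<lambda>f. 0) = (\<lambda>f. 0)" unfolding dist_dilate_def by simp
      have "(\<lambda>f. 0) \<in> dist_dilate h ` shift_space s \<psi>" using imageI[OF shift_space_zero, of "dist_dilate h" s \<psi>] unfolding z .
      then have "(INF g\<in>dist_dilate h ` shift_space s \<psi>. sobolev_norm s (dist_diff f g)) \<le> sobolev_norm s (dist_diff f (\<lambda>f. 0))"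
        by (rule cINF_lower[OF bdd])
      also have "dist_diff f (\<lambda>f. 0) = f" unfolding dist_diff_def by simp
      also have "sobolev_norm s f \<le> N"
      proof -
        have "wnorm2 s ?F \<le> ennreal (N\<^sup>2)" unfolding N2[symmetric] by (rule wnorm2_mono) (use ks in simp)
        then show ?thesis using sobolev_norm_le_iff[OF wFs N0] fF by simp
      qed
      also have "N \<le> (sqrt B + 1) * h powr (k - s) * N"
      proof -
        have "1 * 1 \<le> (sqrt B + 1) * h powr (k - s)" using B True ks by (intro mult_mono ge_one_powr_ge_zero) auto
        from mult_right_mono[OF this N0] show ?thesis by simp
      qed
      finally show ?thesis unfolding N_def .
    next
      case False
      then have h1: "h \<le> 1" by simp
      define X where "X = sqrt B * h powr (k - s) * N"
      have X0: "X \<ge> 0" unfolding X_def using B N0 by simp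
      define q where "q = h powr (2 * s + real CARD('d))"
      have q: "q > 0" unfolding q_def using h by simp
      define f1 where "f1 = (\<lambda>x. ?F ((1 / h) *\<^sub>R x))"
      have f1m[measurable]: "f1 \<in> borel_measurable borel" unfolding f1_def by measurable
      have f1F: "(\<lambda>\<omega>. f1 (h *\<^sub>R \<omega>)) = ?F" unfolding f1_def using h by simp
      have hk: "hnorm2 h k f1 = ennreal (h powr (2 * k + real CARD('d)) * N\<^sup>2)"
        unfolding hnorm2_scale[OF h f1m] f1F N2 by (rule ennreal_mult[symmetric]) simp_all
      have hs: "hnorm2 h s f1 < \<infinity>"
        unfolding hnorm2_scale[OF h f1m] f1F using weighted_L2_finite[OF wFs] by (simp add: ennreal_mult_less_top)
      have "(INF g\<in>dist_dilate h ` shift_space s \<psi>. sobolev_norm s (dist_diff f g)) \<le> X + e" if e: "e > 0" for e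
      proof -
        let ?R = "\<lambda>n. \<integral>\<^sup>+x. (if norm x < r \<and> \<not> norm (f1 x) \<le> real n * norm (?\<Psi> x) then ennreal (weight h s x * (norm (f1 x))\<^sup>2) else 0) \<partial>lborel"
        have "?R \<longlonglongrightarrow> 0"
          by (rule unresolved_part_tendsto[OF \<Psi>m f1m hs]) (use bound in eventually_elim, blast)
        then have "\<forall>\<^sub>F n in sequentially. ?R n < ennreal (q * e\<^sup>2)"
          by (rule order_tendstoD(2)) (use q e in simp)
        then obtain n where n: "?R n < ennreal (q * e\<^sup>2)" unfolding eventually_sequentially by blast
        let ?\<tau> = "truncated_ratio r n ?\<Psi> f1"
        (* The factor compensates the power of h in dist_dilate. *)
        let ?c = "complex_of_real (1 / h ^ CARD('d))"
        define E where "E = (\<lambda>x. f1 x - ?\<tau> (reduce x) * ?\<Psi> x)"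
        have Em: "E \<in> borel_measurable borel" unfolding E_def by measurable
        have \<tau>m: "(\<lambda>x. ?c * ?\<tau> x) \<in> borel_measurable borel" by measurable
        have \<tau>b: "norm (?c * ?\<tau> x) \<le> norm ?c * real n" for x
          unfolding norm_mult by (rule mult_left_mono[OF norm_ratio_le]) simp
        define G where "G = (\<lambda>\<omega>. ?c * ?\<tau> (reduce \<omega>) * ?\<Psi> \<omega>)"
        have G_mem: "dist_of G \<in> shift_space s \<psi>"
          unfolding G_def by (rule shift_space_multiplier[OF \<psi> \<tau>m \<tau>b])
        have wG: "weighted_L2 s G" unfolding G_def
          by (rule weighted_L2_bounded_mult[OF w\<Psi> _ \<tau>b]) measurable
        have scale: "of_real (h ^ CARD('d)) * G x = ?\<tau> (reduce x) * ?\<Psi> x" for x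
          unfolding G_def using h by simp
        have dil: "dist_dilate h (dist_of G) = dist_of (\<lambda>\<omega>. of_real (h ^ CARD('d)) * G (h *\<^sub>R \<omega>))"
          by (rule dist_dilate_dist_of[OF h weighted_L2_measurable[OF wG]])
        have wD: "weighted_L2 s (\<lambda>\<omega>. of_real (h ^ CARD('d)) * G (h *\<^sub>R \<omega>))"
          by (rule weighted_L2_bounded_mult[OF weighted_L2_dilate[OF h wG] _ order_refl]) simp
        note d = dist_diff_dist_of[OF wFs wD]
        have dE: "(\<lambda>\<omega>. ?F \<omega> - of_real (h ^ CARD('d)) * G (h *\<^sub>R \<omega>)) = (\<lambda>\<omega>. E (h *\<^sub>R \<omega>))"
          unfolding scale E_def f1F[symmetric] ..
        have "ennreal q * wnorm2 s (\<lambda>\<omega>. E (h *\<^sub>R \<omega>)) = hnorm2 h s E"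
          unfolding q_def by (rule hnorm2_scale[OF h Em, symmetric])
        also have "\<dots> \<le> ennreal B * hnorm2 h k f1 + ?R n"
          unfolding E_def B_def by (rule interpolation_error_le[OF \<Psi>m f1m r C h h1 less_imp_le[OF k0] less_imp_le[OF ks] bound])
        also have "\<dots> \<le> ennreal B * hnorm2 h k f1 + ennreal (q * e\<^sup>2)" by (rule add_left_mono[OF less_imp_le[OF n]])
        also have "\<dots> = ennreal (B * (h powr (2 * k + real CARD('d)) * N\<^sup>2) + q * e\<^sup>2)"
          unfolding hk using B q by (simp add: ennreal_mult'[symmetric] ennreal_plus[symmetric] del: ennreal_plus)
        also have "B * (h powr (2 * k + real CARD('d)) * N\<^sup>2) + q * e\<^sup>2 = q * (X\<^sup>2 + e\<^sup>2)"
        proof -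
          have "X\<^sup>2 = B * h powr (2 * k - 2 * s) * N\<^sup>2"
          proof -
            have "(h powr (k - s))\<^sup>2 = h powr (2 * k - 2 * s)" by (simp add: power2_eq_square powr_add[symmetric])
            then show ?thesis unfolding X_def power_mult_distrib using B by simp
          qed
          moreover have "q * h powr (2 * k - 2 * s) = h powr (2 * k + real CARD('d))"
            unfolding q_def by (simp only: powr_add[symmetric]) (simp add: add.commute)
          ultimately show ?thesis by (simp add: distrib_left mult_ac)
        qed
        also have "ennreal (q * (X\<^sup>2 + e\<^sup>2)) = ennreal q * ennreal (X\<^sup>2 + e\<^sup>2)" using q by (intro ennreal_mult) auto
        finally have "wnorm2 s (\<lambda>\<omega>. E (h *\<^sub>R \<omega>)) \<le> ennreal (X\<^sup>2 + e\<^sup>2)"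
          using q by (subst (asm) ennreal_mult_le_mult_iff) auto
        also have "\<dots> \<le> ennreal ((X + e)\<^sup>2)" using X0 e by (intro ennreal_leI) (simp add: power2_sum)
        finally have le: "sobolev_norm s (dist_diff f (dist_dilate h (dist_of G))) \<le> X + e"
          using sobolev_norm_le_iff[OF d(2), of "X + e"] X0 e d(1) unfolding dil dE fF[symmetric] by simp
        have "(INF g\<in>dist_dilate h ` shift_space s \<psi>. sobolev_norm s (dist_diff f g)) \<le> sobolev_norm s (dist_diff f (dist_dilate h (dist_of G)))"
          by (rule cINF_lower[OF bdd imageI[OF G_mem]])
        then show ?thesis using le by (rule order_trans)
      qed
      then have "(INF g\<in>dist_dilate h ` shift_space s \<psi>. sobolev_norm s (dist_diff f g)) \<le> X"
        by (rule field_le_epsilon)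
      also have "X \<le> (sqrt B + 1) * h powr (k - s) * N"
        unfolding X_def using N0 by (intro mult_right_mono) auto
      finally show ?thesis unfolding N_def .
    qed
  qed
  then show ?thesis unfolding approx_order_pos_def by blast
qed

section \<open>Convolution products\<close>

theorem proposition14:
  fixes \<phi>\<^sub>1 \<phi>\<^sub>2 \<psi> :: "'d::finite functional" and s\<^sub>1 s\<^sub>2 k\<^sub>1 k\<^sub>2 :: real
  assumes "\<phi>\<^sub>1 \<in> sobolev_space s\<^sub>1" and "k\<^sub>1 > s\<^sub>1" and "provides_approx_order s\<^sub>1 \<phi>\<^sub>1 k\<^sub>1"
    and "\<phi>\<^sub>2 \<in> sobolev_space s\<^sub>2" and "k\<^sub>2 > s\<^sub>2" and "provides_approx_order s\<^sub>2 \<phi>\<^sub>2 k\<^sub>2"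
    and "is_convolution \<psi> \<phi>\<^sub>1 \<phi>\<^sub>2" and "\<psi> \<in> sobolev_space (s\<^sub>1 + s\<^sub>2)"
  shows "provides_approx_order (s\<^sub>1 + s\<^sub>2) \<psi> (k\<^sub>1 + k\<^sub>2)"
proof -
  have bound: "alias_bound s k (ft_fun \<phi>)"
    if "\<phi> \<in> sobolev_space s" "k > s" "provides_approx_order s \<phi> k" for \<phi> :: "'d functional" and s k
    using that order_pos_imp_alias_bound order_imp_alias_bound unfolding provides_approx_order_def
    by (cases "k > 0") auto
  have "represented_by (dist_fourier \<psi>) (ft_fun \<psi>)"
    using dist_of_represented[OF sobolev_ft(1)[OF assms(8)]] unfolding sobolev_ft(2)[OF assms(8), symmetric] .
  moreover have "represented_by (dist_fourier \<psi>) (\<lambda>\<omega>. ft_fun \<phi>\<^sub>1 \<omega> * ft_fun \<phi>\<^sub>2 \<omega>)"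
    using assms(7) unfolding is_convolution_def by blast
  ultimately have "AE \<omega> in lborel. ft_fun \<phi>\<^sub>1 \<omega> * ft_fun \<phi>\<^sub>2 \<omega> = ft_fun \<psi> \<omega>"
    by (rule represented_unique[rotated])
  from alias_bound_cong[OF this alias_bound_mult[OF bound[OF assms(1-3)] bound[OF assms(4-6)]]]
  have "alias_bound (s\<^sub>1 + s\<^sub>2) (k\<^sub>1 + k\<^sub>2) (ft_fun \<psi>)" .
  moreover have "k\<^sub>1 + k\<^sub>2 > s\<^sub>1 + s\<^sub>2" using assms(2,5) by simp
  ultimately show ?thesis
    unfolding provides_approx_order_def
    using alias_bound_imp_order_pos[OF assms(8)] alias_bound_imp_order by auto
qed

end
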